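(* Let $R$ be a Noetherian domain of altitude one, let $I$ be a nonzero proper ideal in $R$, let $R'$ be the integral closure of $R$ in its quotient field, and let $IR'=M_1^{e_1}\cdots M_n^{e_n}$ be a normal primary decomposition of $IR'$. Then there exists a finite separable integral extension domain $A$ of $R$ such that $(IA)_a=((\mathrm{Rad}(IA))^{e_1\cdots e_n})_a$, and, if $A'$ denotes the integral closure of $A$ in its quotient field, then for each $P\in\mathbf{M}_I(A)$ we have: (i) $PA'$ is a maximal ideal of $A'$, and (ii) $A'/PA'\cong A/P$.
   Context: Altitude means Krull dimension. "$IR'=M_1^{e_1}\cdots M_n^{e_n}$ is a normal primary decomposition" means that $M_1,\ldots,M_n$ are the distinct maximal ideals of the Dedekind domain $R'$ containing $IR'$ and $e_1,\ldots,e_n$ are positive integers. A finite separable integral extension domain $A$ of $R$ is a domain $A\supseteq R$ that is integral over $R$ and finitely generated as an $R$-module, and whose quotient field is a finite separable algebraic extension of the quotient field of $R$. For an ideal $K$ of a ring $B$, $K_a$ denotes the integral closure of $K$ in $B$: the set of $x\in B$ satisfying an equation $x^h+k_1x^{h-1}+\cdots+k_h=0$ with $h\ge 1$ and $k_j\in K^j$ for $j=1,\ldots,h$. $\mathrm{Rad}(K)$ is the radical of $K$. $\mathbf{M}_I(A)$ denotes the set of maximal ideals $P$ of $A$ such that $P\cap R\in\{M_1\cap R,\ldots,M_n\cap R\}$, equivalently the maximal ideals of $A$ containing $IA$. *)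

theory Defs
  imports "HOL-Algebra.Algebra" "HOL-Algebra.Algebraic_Closure_Type" "HOL-Library.Extended_Nat"
begin

(* All rings are subrings, given by their carriers, of one algebraically closed field 'k.  This
   costs no generality: a domain of type 'a::idom embeds into 'a fract alg_closure.  It makes
   quotient fields, integral closures and finite field extensions plain subsets of 'k. *)

definition ring_on :: "'k::field set \<Rightarrow> 'k ring" where
  "ring_on S = ring_of_type_algebra \<lparr>carrier := S\<rparr>"

lemma ring_on_simps [simp]:
  "carrier (ring_on S) = S"
  "x \<otimes>\<^bsub>ring_on S\<^esub> y = x * y"
  "\<one>\<^bsub>ring_on S\<^esub> = 1"
  "x \<oplus>\<^bsub>ring_on S\<^esub> y = x + y"
  "\<zero>\<^bsub>ring_on S\<^esub> = 0"
  by (simp_all add: ring_on_def ring_of_type_algebra_def)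

definition altitude :: "('a, 'b) ring_scheme \<Rightarrow> enat" where
  "altitude B = (SUP l \<in> {l. \<exists>Q :: nat \<Rightarrow> 'a set.
     (\<forall>i\<le>l. primeideal (Q i) B) \<and> (\<forall>i<l. Q i \<subset> Q (Suc i))}. enat l)"

definition quotient_field :: "'k::field set \<Rightarrow> 'k set" where
  "quotient_field S = {a / b | a b. a \<in> S \<and> b \<in> S \<and> b \<noteq> 0}"

definition integral_over :: "'k::field set \<Rightarrow> 'k \<Rightarrow> bool" where
  "integral_over S x \<longleftrightarrow>
     (\<exists>p :: 'k poly. lead_coeff p = 1 \<and> (\<forall>i. coeff p i \<in> S) \<and> poly p x = 0)"

definition normalization :: "'k::field set \<Rightarrow> 'k set" where
  "normalization S = {x \<in> quotient_field S. integral_over S x}"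

definition finitely_generated_module :: "'k::field set \<Rightarrow> 'k set \<Rightarrow> bool" where
  "finitely_generated_module S N \<longleftrightarrow>
     (\<exists>G. finite G \<and> N = {\<Sum>g\<in>G. c g * g | c. \<forall>g\<in>G. c g \<in> S})"

definition minimal_polynomial :: "'k::field set \<Rightarrow> 'k \<Rightarrow> 'k poly \<Rightarrow> bool" where
  "minimal_polynomial K x p \<longleftrightarrow>
     lead_coeff p = 1 \<and> (\<forall>i. coeff p i \<in> K) \<and> poly p x = 0 \<and>
     (\<forall>q. q \<noteq> 0 \<and> (\<forall>i. coeff q i \<in> K) \<and> poly q x = 0 \<longrightarrow> degree p \<le> degree q)"

(* rsquarefree excludes multiple roots in 'k; as 'k is algebraically closed, this says that the
   minimal polynomial has no multiple roots in an algebraic closure of K. *)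
definition separable_over :: "'k::alg_closed_field set \<Rightarrow> 'k \<Rightarrow> bool" where
  "separable_over K x \<longleftrightarrow> (\<exists>p. minimal_polynomial K x p \<and> rsquarefree p)"

definition finite_separable_field_extension :: "'k::alg_closed_field set \<Rightarrow> 'k set \<Rightarrow> bool" where
  "finite_separable_field_extension K F \<longleftrightarrow>
     K \<subseteq> F \<and> finitely_generated_module K F \<and> (\<forall>x\<in>F. separable_over K x)"

definition finite_separable_integral_extension_domain ::
    "'k::alg_closed_field set \<Rightarrow> 'k set \<Rightarrow> bool" where
  "finite_separable_integral_extension_domain R A \<longleftrightarrow>
     domain (ring_on A) \<and> R \<subseteq> A \<and> (\<forall>x\<in>A. integral_over R x) \<and>
     finitely_generated_module R A \<and>
     finite_separable_field_extension (quotient_field R) (quotient_field A)"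

(* The ideal K B, for a subset K of B *)
definition ideal_extension :: "'k::field set \<Rightarrow> 'k set \<Rightarrow> 'k set" where
  "ideal_extension K B = Idl\<^bsub>ring_on B\<^esub> K"

definition ideal_power :: "'k::field set \<Rightarrow> 'k set \<Rightarrow> nat \<Rightarrow> 'k set" where
  "ideal_power B K m = K [^]\<^bsub>ideals_set (ring_on B)\<^esub> m"

definition radical_ideal :: "'k::field set \<Rightarrow> 'k set \<Rightarrow> 'k set" where
  "radical_ideal B K = {x \<in> B. \<exists>m\<ge>1. x ^ m \<in> K}"

definition ideal_integral_closure :: "'k::field set \<Rightarrow> 'k set \<Rightarrow> 'k set" where
  "ideal_integral_closure B K = {x \<in> B. \<exists>h\<ge>1. \<exists>k :: nat \<Rightarrow> 'k.
     (\<forall>j\<in>{1..h}. k j \<in> ideal_power B K j) \<and> x ^ h + (\<Sum>j=1..h. k j * x ^ (h - j)) = 0}"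

definition normal_primary_decomposition ::
    "'k::field set \<Rightarrow> 'k set \<Rightarrow> nat \<Rightarrow> (nat \<Rightarrow> 'k set) \<Rightarrow> (nat \<Rightarrow> nat) \<Rightarrow> bool" where
  "normal_primary_decomposition B J n M e \<longleftrightarrow>
     inj_on M {1..n} \<and>
     M ` {1..n} = {N. maximalideal N (ring_on B) \<and> J \<subseteq> N} \<and>
     (\<forall>i\<in>{1..n}. e i > 0) \<and>
     J = (\<Otimes>\<^bsub>ideals_set (ring_on B)\<^esub> i \<in> {1..n}. ideal_power B (M i) (e i))"

(* The maximal ideals of A whose contraction to R is the contraction of some M i *)
definition maximal_ideals_over ::
    "'k::field set \<Rightarrow> nat \<Rightarrow> (nat \<Rightarrow> 'k set) \<Rightarrow> 'k set \<Rightarrow> 'k set set" where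
  "maximal_ideals_over R n M A =
     {P. maximalideal P (ring_on A) \<and> P \<inter> R \<in> (\<lambda>i. M i \<inter> R) ` {1..n}}"

end

theory Submission
  imports Defs "Jordan_Normal_Form.Char_Poly"
begin

text \<open>Write B for the integral closure of R, let I have order \<open>e i\<close> at the maximal ideal
  \<open>M i\<close> of B, and put \<open>D = (\<Prod>i. e i)\<close> and \<open>d i = D / e i\<close>. The extension is built so that I
  acquires the same order D at every place over I; then I and the D-th power of the radical are
  indistinguishable by orders, and orders determine integral closures.

  Let \<open>h i\<close> be a monic polynomial of degree \<open>e i\<close> which is separable modulo \<open>M i\<close>, and let
  \<open>\<pi> i\<close> be a uniformizer at \<open>M i\<close>. The polynomials \<open>h i ^ d i + \<pi> i\<close> are all monic of degree D, so
  the Chinese remainder theorem gives one monic f over B congruent to each of them modulo the square of the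
  localisation of \<open>M i\<close> (\<open>ramified_polynomial_exists\<close>). Let t be a root of f. At a prime N of
  \<open>B[t]\<close> over \<open>M i\<close> the element \<open>\<pi> i\<close> is then \<open>h i (t) ^ d i\<close> times a unit. As \<open>h i\<close> is separable
  modulo \<open>M i\<close>, the ideal N is generated locally by \<open>M i\<close> and \<open>h i (t)\<close>, hence by \<open>h i (t)\<close> alone: this is a
  uniformizer, \<open>\<pi> i\<close> has order \<open>d i\<close>, and I has order \<open>e i * d i = D\<close> (\<open>uniformizer_adjoin\<close>,
  \<open>order_of_decomposed_ideal\<close>). A
  small change of f makes it squarefree, which makes the extension of quotient fields generated by t
  separable (\<open>separable_adjoin\<close>).

  Let C be the integral closure of \<open>R[t]\<close> and let a be a nonzero element of I. By the Krull--Akizuki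
  theorem C/aC has finite length over R, so finitely many elements of C generate it modulo aC. Adjoining them to
  \<open>R[t]\<close> gives A with normalization C and \<open>C = A + aC\<close>
  (\<open>finite_extension_filling_normalization\<close>). For a maximal ideal P of A over I the map from A/P to
  C/PC is therefore bijective, which gives the two statements on residue fields.

  Let H be the radical of IA. By \<open>C = A + aC\<close> the ideal HC contains a local generator of every N over I,
  so that both IA and \<open>H ^ D\<close> have order D there. Finally an ideal J of A which has order D at every N
  over I, and contains a power of each element of I, has as integral closure the set of elements of A of order
  at least D at these places: an equation of integral dependence bounds orders from below, and conversely
  an element of sufficient order lies in JC, where the determinant trick yields an equation
  (\<open>integral_closure_eq_order\<close>).

  All rings are subsets of one field, and localisation at a prime Q is expressed by denominators outside Q:
  x has order at least m with respect to \<open>\<tau>\<close> if \<open>s * x = \<tau> ^ m * y\<close> with s outside Q.\<close>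

section \<open>Subrings and submodules of a field\<close>

definition is_subring :: "'k::field set \<Rightarrow> bool" where
  "is_subring S \<longleftrightarrow> 1 \<in> S \<and> (\<forall>x\<in>S. - x \<in> S) \<and> (\<forall>x\<in>S. \<forall>y\<in>S. x + y \<in> S \<and> x * y \<in> S)"

lemma subring_one: "is_subring S \<Longrightarrow> 1 \<in> S"
  and subring_uminus: "is_subring S \<Longrightarrow> x \<in> S \<Longrightarrow> - x \<in> S"
  and subring_add: "is_subring S \<Longrightarrow> x \<in> S \<Longrightarrow> y \<in> S \<Longrightarrow> x + y \<in> S"
  and subring_mult: "is_subring S \<Longrightarrow> x \<in> S \<Longrightarrow> y \<in> S \<Longrightarrow> x * y \<in> S"
  by (auto simp: is_subring_def)

lemma subring_zero: "is_subring S \<Longrightarrow> 0 \<in> S"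
  using subring_add[of S 1 "-1"] subring_uminus[of S 1] subring_one[of S] by simp

lemma subring_diff: "is_subring S \<Longrightarrow> x \<in> S \<Longrightarrow> y \<in> S \<Longrightarrow> x - y \<in> S"
  using subring_add[of S x "-y"] subring_uminus[of S y] by simp

lemma subring_power: "is_subring S \<Longrightarrow> x \<in> S \<Longrightarrow> x ^ m \<in> S"
  by (induction m) (auto intro: subring_one subring_mult)

lemma subring_sum: "is_subring S \<Longrightarrow> (\<And>i. i \<in> F \<Longrightarrow> f i \<in> S) \<Longrightarrow> sum f F \<in> S"
  by (induction F rule: infinite_finite_induct) (auto intro: subring_zero subring_add)

lemma subring_prod: "is_subring S \<Longrightarrow> (\<And>i. i \<in> F \<Longrightarrow> f i \<in> S) \<Longrightarrow> prod f F \<in> S"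
  by (induction F rule: infinite_finite_induct) (auto intro: subring_one subring_mult)

lemma subring_of_nat: "is_subring S \<Longrightarrow> of_nat m \<in> S"
  by (induction m) (auto intro: subring_zero subring_one subring_add)

lemmas subring_closed = subring_one subring_zero subring_uminus subring_add subring_mult
  subring_diff subring_power subring_sum subring_prod subring_of_nat

definition submodule_over :: "'k::field set \<Rightarrow> 'k set \<Rightarrow> bool" where
  "submodule_over S V \<longleftrightarrow>
     0 \<in> V \<and> (\<forall>v\<in>V. \<forall>w\<in>V. v + w \<in> V) \<and> (\<forall>s\<in>S. \<forall>v\<in>V. s * v \<in> V)"

lemma submodule_zero: "submodule_over S V \<Longrightarrow> 0 \<in> V"
  and submodule_add: "submodule_over S V \<Longrightarrow> v \<in> V \<Longrightarrow> w \<in> V \<Longrightarrow> v + w \<in> V"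
  and submodule_scale: "submodule_over S V \<Longrightarrow> s \<in> S \<Longrightarrow> v \<in> V \<Longrightarrow> s * v \<in> V"
  by (auto simp: submodule_over_def)

lemma submodule_scale': "submodule_over S V \<Longrightarrow> s \<in> S \<Longrightarrow> v \<in> V \<Longrightarrow> v * s \<in> V"
  by (metis submodule_scale mult.commute)

lemma submodule_uminus: "submodule_over S V \<Longrightarrow> is_subring S \<Longrightarrow> v \<in> V \<Longrightarrow> - v \<in> V"
  using submodule_scale[of S V "-1" v] by (auto intro: subring_closed)

lemma submodule_diff:
  "submodule_over S V \<Longrightarrow> is_subring S \<Longrightarrow> v \<in> V \<Longrightarrow> w \<in> V \<Longrightarrow> v - w \<in> V"
  using submodule_add[of S V v "-w"] submodule_uminus[of S V w] by simp

lemma submodule_sum: "submodule_over S V \<Longrightarrow> (\<And>i. i \<in> F \<Longrightarrow> f i \<in> V) \<Longrightarrow> sum f F \<in> V"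
  by (induction F rule: infinite_finite_induct) (auto intro: submodule_zero submodule_add)

lemma submodule_self: "is_subring S \<Longrightarrow> submodule_over S S"
  by (auto simp: submodule_over_def intro: subring_closed)

lemma submodule_restrict: "submodule_over S V \<Longrightarrow> S' \<subseteq> S \<Longrightarrow> submodule_over S' V"
  by (auto simp: submodule_over_def)

lemma submodule_Int: "submodule_over S V \<Longrightarrow> submodule_over S W \<Longrightarrow> submodule_over S (V \<inter> W)"
  by (auto simp: submodule_over_def)

lemma submodule_plus:
  assumes V: "submodule_over S V" and W: "submodule_over S W"
  shows "submodule_over S {v + w | v w. v \<in> V \<and> w \<in> W}"
  unfolding submodule_over_def
proof (intro conjI ballI)
  have "0 = 0 + (0::'a)" by simp
  then show "0 \<in> {v + w | v w. v \<in> V \<and> w \<in> W}"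
    using submodule_zero[OF V] submodule_zero[OF W] by blast
next
  fix x y assume "x \<in> {v + w | v w. v \<in> V \<and> w \<in> W}" "y \<in> {v + w | v w. v \<in> V \<and> w \<in> W}"
  then obtain v w v' w' where *: "x = v + w" "y = v' + w'" "v \<in> V" "v' \<in> V" "w \<in> W" "w' \<in> W"
    by blast
  have "x + y = (v + v') + (w + w')" by (simp add: *)
  then show "x + y \<in> {v + w | v w. v \<in> V \<and> w \<in> W}"
    using submodule_add[OF V *(3,4)] submodule_add[OF W *(5,6)] by blast
next
  fix s x assume s: "s \<in> S" and "x \<in> {v + w | v w. v \<in> V \<and> w \<in> W}"
  then obtain v w where *: "x = v + w" "v \<in> V" "w \<in> W" by blast
  have "s * x = s * v + s * w" by (simp add: * distrib_left)
  then show "s * x \<in> {v + w | v w. v \<in> V \<and> w \<in> W}"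
    using submodule_scale[OF V s *(2)] submodule_scale[OF W s *(3)] by blast
qed

lemma submodule_image_mult: "submodule_over S V \<Longrightarrow> submodule_over S ((*) c ` V)"
  unfolding submodule_over_def
proof (intro conjI ballI; elim conjE)
  assume "0 \<in> V" then show "0 \<in> (*) c ` V" by force
next
  fix v w assume "\<forall>v\<in>V. \<forall>w\<in>V. v + w \<in> V" "v \<in> (*) c ` V" "w \<in> (*) c ` V"
  then show "v + w \<in> (*) c ` V" by (auto simp flip: distrib_left)
next
  fix s v assume *: "\<forall>s\<in>S. \<forall>v\<in>V. s * v \<in> V" "s \<in> S" "v \<in> (*) c ` V"
  then obtain w where "v = c * w" "w \<in> V" by blast
  then have "s * v = c * (s * w)" "s * w \<in> V" using * by auto
  then show "s * v \<in> (*) c ` V" by blast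
qed

text \<open>The submodule generated by G. The intersection yields induction over generators and needs no finiteness.\<close>

definition lin :: "'k::field set \<Rightarrow> 'k set \<Rightarrow> 'k set" where
  "lin S G = \<Inter>{V. submodule_over S V \<and> G \<subseteq> V}"

lemma lin_submodule: "submodule_over S (lin S G)"
  by (auto simp: lin_def submodule_over_def)

lemma lin_superset: "G \<subseteq> lin S G"
  by (auto simp: lin_def)

lemma lin_inc: "g \<in> G \<Longrightarrow> g \<in> lin S G"
  using lin_superset by blast

lemma lin_least: "submodule_over S V \<Longrightarrow> G \<subseteq> V \<Longrightarrow> lin S G \<subseteq> V"
  by (auto simp: lin_def)

lemma lin_mono: "G \<subseteq> H \<Longrightarrow> lin S G \<subseteq> lin S H"
  by (auto simp: lin_def)

lemma lin_induct [consumes 1, case_names zero add scale gen]: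
  assumes "x \<in> lin S G" "P 0" "\<And>v w. P v \<Longrightarrow> P w \<Longrightarrow> P (v + w)"
    and "\<And>s v. s \<in> S \<Longrightarrow> P v \<Longrightarrow> P (s * v)" "\<And>g. g \<in> G \<Longrightarrow> P g"
  shows "P x"
proof -
  have "submodule_over S {v. P v}" using assms(2-4) by (auto simp: submodule_over_def)
  then show ?thesis using lin_least[of S "{v. P v}" G] assms(1,5) by blast
qed

lemma lin_submodule_eq: "submodule_over S V \<Longrightarrow> lin S V = V"
  by (simp add: lin_least lin_superset subset_antisym)

lemma lin_insert:
  assumes "is_subring S"
  shows "lin S (insert g Z) = {v + s * g | v s. v \<in> lin S Z \<and> s \<in> S}" (is "_ = ?Y")
proof
  have "submodule_over S ?Y"
    unfolding submodule_over_def
  proof (intro conjI ballI)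
    show "0 \<in> ?Y" using lin_submodule[of S Z] assms
      by (force intro: exI[of _ 0] submodule_zero subring_closed)
  next
    fix v w assume "v \<in> ?Y" "w \<in> ?Y"
    then obtain v1 s1 w1 s2 where *: "v = v1 + s1 * g" "w = w1 + s2 * g" "v1 \<in> lin S Z"
      "w1 \<in> lin S Z" "s1 \<in> S" "s2 \<in> S" by blast
    have "v + w = (v1 + w1) + (s1 + s2) * g" using * by (simp add: algebra_simps)
    then show "v + w \<in> ?Y" using * assms lin_submodule[of S Z]
      by (blast intro: submodule_add subring_closed)
  next
    fix s v assume "s \<in> S" "v \<in> ?Y"
    then obtain v1 s1 where *: "v = v1 + s1 * g" "v1 \<in> lin S Z" "s1 \<in> S" by blast
    have "s * v = s * v1 + (s * s1) * g" using * by (simp add: algebra_simps)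
    then show "s * v \<in> ?Y" using * \<open>s \<in> S\<close> assms lin_submodule[of S Z]
      by (blast intro: submodule_scale subring_closed)
  qed
  moreover have "x \<in> ?Y" if "x \<in> insert g Z" for x
  proof (cases "x = g")
    case True
    then have "x = 0 + 1 * g" by simp
    then show ?thesis using assms lin_submodule[of S Z] by (blast intro: submodule_zero subring_closed)
  next
    case False
    then have "x = x + 0 * g" "x \<in> lin S Z" using that by (auto intro: lin_inc)
    then show ?thesis using assms by (blast intro: subring_closed)
  qed
  ultimately show "lin S (insert g Z) \<subseteq> ?Y" by (intro lin_least) auto
next
  have "lin S Z \<subseteq> lin S (insert g Z)" by (intro lin_mono) auto
  moreover have "g \<in> lin S (insert g Z)" by (simp add: lin_inc)
  ultimately show "?Y \<subseteq> lin S (insert g Z)"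
    using lin_submodule[of S "insert g Z"] by (blast intro: submodule_add submodule_scale)
qed

lemma lin_finite:
  assumes "is_subring S" "finite G"
  shows "lin S G = {\<Sum>g\<in>G. c g * g | c. \<forall>g\<in>G. c g \<in> S}"
  using assms(2)
proof (induction G)
  case empty
  have "submodule_over S {0}" by (auto simp: submodule_over_def)
  then have "lin S {} \<subseteq> {0}" by (intro lin_least) auto
  then show ?case using submodule_zero[OF lin_submodule[of S "{}"]] by auto
next
  case (insert g G)
  show ?case
  proof (intro equalityI subsetI)
    fix x assume "x \<in> lin S (insert g G)"
    then obtain v s where "x = v + s * g" "v \<in> lin S G" "s \<in> S"
      using lin_insert[OF assms(1)] by auto
    then obtain c where c: "v = (\<Sum>g\<in>G. c g * g)" "\<forall>g\<in>G. c g \<in> S" using insert.IH by auto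
    have "(\<Sum>h\<in>G. (c(g := s)) h * h) = v" unfolding c(1)
      using insert.hyps by (intro sum.cong) auto
    then have "x = (\<Sum>h\<in>insert g G. (c(g := s)) h * h)"
      using insert.hyps \<open>x = v + s * g\<close> by (simp add: algebra_simps)
    then show "x \<in> {\<Sum>g\<in>insert g G. c g * g | c. \<forall>g\<in>insert g G. c g \<in> S}"
      using c(2) \<open>s \<in> S\<close> by (intro CollectI exI[of _ "c(g := s)"]) auto
  next
    fix x assume "x \<in> {\<Sum>g\<in>insert g G. c g * g | c. \<forall>g\<in>insert g G. c g \<in> S}"
    then obtain c where c: "x = (\<Sum>g\<in>insert g G. c g * g)" "\<forall>g\<in>insert g G. c g \<in> S" by blast
    have "c h * h \<in> lin S (insert g G)" if "h \<in> insert g G" for h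
      using c(2) that by (intro submodule_scale[OF lin_submodule] lin_inc) auto
    then show "x \<in> lin S (insert g G)" unfolding c(1) by (rule submodule_sum[OF lin_submodule])
  qed
qed

lemma finitely_generated_module_iff:
  "is_subring S \<Longrightarrow> finitely_generated_module S N \<longleftrightarrow> (\<exists>G. finite G \<and> N = lin S G)"
  unfolding finitely_generated_module_def by (rule ex_cong1) (auto simp: lin_finite)

definition prime_in :: "'k::field set \<Rightarrow> 'k set \<Rightarrow> bool" where
  "prime_in S Q \<longleftrightarrow> submodule_over S Q \<and> Q \<subseteq> S \<and> 1 \<notin> Q \<and>
     (\<forall>x\<in>S. \<forall>y\<in>S. x * y \<in> Q \<longrightarrow> x \<in> Q \<or> y \<in> Q)"

text \<open>Maximality is expressed by the invertibility of the nonzero residue classes, the form in which it is applied.\<close>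

definition maximal_in :: "'k::field set \<Rightarrow> 'k set \<Rightarrow> bool" where
  "maximal_in S N \<longleftrightarrow> submodule_over S N \<and> N \<subseteq> S \<and> 1 \<notin> N \<and> (\<forall>x\<in>S - N. \<exists>y\<in>S. 1 - x * y \<in> N)"

lemma maximal_inD:
  assumes "maximal_in S N"
  shows "submodule_over S N" "N \<subseteq> S" "1 \<notin> N"
    "\<And>x. x \<in> S \<Longrightarrow> x \<notin> N \<Longrightarrow> \<exists>y\<in>S. 1 - x * y \<in> N"
  using assms unfolding maximal_in_def by blast+

lemma maximal_in_prime_in:
  assumes "maximal_in S N" shows "prime_in S N"
  unfolding prime_in_def
proof (intro conjI ballI impI)
  fix x y assume xy: "x \<in> S" "y \<in> S" "x * y \<in> N"
  show "x \<in> N \<or> y \<in> N"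
  proof (rule disjCI)
    assume "y \<notin> N"
    then obtain z where z: "z \<in> S" "1 - y * z \<in> N" using assms xy by (auto simp: maximal_in_def)
    have N: "submodule_over S N" using assms by (simp add: maximal_in_def)
    have "x * (1 - y * z) + z * (x * y) \<in> N"
      by (rule submodule_add[OF N submodule_scale[OF N xy(1) z(2)] submodule_scale[OF N z(1) xy(3)]])
    then show "x \<in> N" by (simp add: algebra_simps)
  qed
qed (use assms in \<open>simp_all add: maximal_in_def\<close>)

lemma prime_inD:
  assumes "prime_in S Q"
  shows "submodule_over S Q" "Q \<subseteq> S" "1 \<notin> Q"
    "\<And>x y. x \<in> S \<Longrightarrow> y \<in> S \<Longrightarrow> x * y \<in> Q \<Longrightarrow> x \<in> Q \<or> y \<in> Q"
  using assms unfolding prime_in_def by blast+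

lemma prime_in_compl_mult:
  "prime_in S Q \<Longrightarrow> is_subring S \<Longrightarrow> s \<in> S - Q \<Longrightarrow> u \<in> S - Q \<Longrightarrow> s * u \<in> S - Q"
  using subring_mult[of S s u] prime_inD(4)[of S Q s u] by blast

lemma prime_in_compl_one: "prime_in S Q \<Longrightarrow> is_subring S \<Longrightarrow> 1 \<in> S - Q"
  using subring_one[of S] prime_inD(3)[of S Q] by blast

lemma prime_in_compl_power: "prime_in S Q \<Longrightarrow> is_subring S \<Longrightarrow> s \<in> S - Q \<Longrightarrow> s ^ m \<in> S - Q"
proof (induction m)
  case 0
  then show ?case using prime_in_compl_one by auto
next
  case (Suc m)
  then show ?case using prime_in_compl_mult[of S Q s "s ^ m"] by simp
qed

lemma prime_in_compl_prod:
  "prime_in S Q \<Longrightarrow> is_subring S \<Longrightarrow> (\<And>i. i \<in> F \<Longrightarrow> f i \<in> S - Q) \<Longrightarrow> prod f F \<in> S - Q"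
proof (induction F rule: infinite_finite_induct)
  case (insert x F)
  then show ?case using prime_in_compl_mult[of S Q "f x" "prod f F"] by auto
qed (use prime_in_compl_one in auto)

lemma prime_in_contract:
  assumes N: "prime_in C N" and S: "is_subring S" "S \<subseteq> C"
  shows "prime_in S (N \<inter> S)"
  unfolding prime_in_def
proof (intro conjI)
  show "submodule_over S (N \<inter> S)"
    using submodule_restrict[OF prime_inD(1)[OF N] S(2)] submodule_self[OF S(1)] by (rule submodule_Int)
  show "\<forall>x\<in>S. \<forall>y\<in>S. x * y \<in> N \<inter> S \<longrightarrow> x \<in> N \<inter> S \<or> y \<in> N \<inter> S"
    using prime_inD(4)[OF N] S(2) by blast
qed (use prime_inD(3)[OF N] in auto)

section \<open>Modules of finite length and the Krull--Akizuki theorem\<close>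

text \<open>Finite length of W/V means that both ascending and descending chains between V and W become
  stationary. Treating both kinds of chain at once dispenses with quotient modules and composition series.\<close>

definition finite_length :: "'k::field set \<Rightarrow> 'k set \<Rightarrow> 'k set \<Rightarrow> bool" where
  "finite_length S V W \<longleftrightarrow> (\<forall>Z :: nat \<Rightarrow> 'k set.
     (\<forall>n. submodule_over S (Z n) \<and> V \<subseteq> Z n \<and> Z n \<subseteq> W) \<longrightarrow> mono Z \<or> antimono Z \<longrightarrow>
     (\<exists>m. \<forall>n\<ge>m. Z n = Z m))"

lemma finite_lengthD:
  fixes Z :: "nat \<Rightarrow> 'k::field set"
  assumes "finite_length S V W" "\<And>n. submodule_over S (Z n)" "\<And>n. V \<subseteq> Z n" "\<And>n. Z n \<subseteq> W"
    and "mono Z \<or> antimono Z"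
  obtains m where "\<And>n. n \<ge> m \<Longrightarrow> Z n = Z m"
proof -
  have "\<exists>m. \<forall>n\<ge>m. Z n = Z m"
    using assms(1)[unfolded finite_length_def, rule_format, of Z] assms(2-5) by blast
  then show ?thesis using that by blast
qed

lemma mono_or_antimono_compose:
  assumes "mono Z \<or> antimono Z" "\<And>i j. Z i \<subseteq> Z j \<Longrightarrow> Y i \<subseteq> Y j"
  shows "mono Y \<or> antimono Y"
  using assms(1)
proof
  assume "mono Z"
  then have "mono Y" by (intro monoI assms(2)) (rule monoD)
  then show ?thesis ..
next
  assume "antimono Z"
  then have "antimono Y" by (intro antimonoI assms(2)) (rule antimonoD)
  then show ?thesis ..
qed

lemma finite_length_subinterval:
  assumes "finite_length S V W" "V \<subseteq> V'" "W' \<subseteq> W"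
  shows "finite_length S V' W'"
  unfolding finite_length_def
proof (intro allI impI)
  fix Z :: "nat \<Rightarrow> _ set"
  assume Z: "\<forall>n. submodule_over S (Z n) \<and> V' \<subseteq> Z n \<and> Z n \<subseteq> W'" and mon: "mono Z \<or> antimono Z"
  have *: "submodule_over S (Z n)" "V' \<subseteq> Z n" "Z n \<subseteq> W'" for n using Z by blast+
  have "\<forall>n. submodule_over S (Z n) \<and> V \<subseteq> Z n \<and> Z n \<subseteq> W"
    by (intro allI conjI *(1) order_trans[OF assms(2) *(2)] order_trans[OF *(3) assms(3)])
  from assms(1)[unfolded finite_length_def, THEN spec, THEN mp, OF this, THEN mp, OF mon]
  show "\<exists>m. \<forall>n\<ge>m. Z n = Z m" .
qed

lemma finite_length_refl: "finite_length S V V"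
  unfolding finite_length_def
proof (intro allI impI)
  fix Z :: "nat \<Rightarrow> _ set"
  assume Z: "\<forall>n. submodule_over S (Z n) \<and> V \<subseteq> Z n \<and> Z n \<subseteq> V"
  have "Z n = V" for n using Z by (intro subset_antisym) blast+
  then show "\<exists>m. \<forall>n\<ge>m. Z n = Z m" by simp
qed

text \<open>By the modular law a member Z of a chain is determined, among those comparable with it, by \<open>Z \<inter> V\<close> and \<open>Z + V\<close>.\<close>

lemma finite_length_trans:
  assumes S: "is_subring S" and V: "submodule_over S V"
    and "finite_length S U V" "finite_length S V W" "U \<subseteq> V" "V \<subseteq> W"
  and W: "submodule_over S W"
  shows "finite_length S U W"
  unfolding finite_length_def
proof (intro allI impI)
  fix Z :: "nat \<Rightarrow> 'a set"
  assume Z: "\<forall>n. submodule_over S (Z n) \<and> U \<subseteq> Z n \<and> Z n \<subseteq> W" and mon: "mono Z \<or> antimono Z"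
  define Y where "Y n = {x + v | x v. x \<in> Z n \<and> v \<in> V}" for n
  obtain m1 where m1: "\<And>n. n \<ge> m1 \<Longrightarrow> Z n \<inter> V = Z m1 \<inter> V"
  proof (rule finite_lengthD[OF assms(3), of "\<lambda>n. Z n \<inter> V"])
    show "submodule_over S (Z n \<inter> V)" for n using Z V by (auto intro: submodule_Int)
    show "mono (\<lambda>n. Z n \<inter> V) \<or> antimono (\<lambda>n. Z n \<inter> V)"
      by (rule mono_or_antimono_compose[OF mon]) blast
  qed (use Z \<open>U \<subseteq> V\<close> in auto)
  obtain m2 where m2: "\<And>n. n \<ge> m2 \<Longrightarrow> Y n = Y m2"
  proof (rule finite_lengthD[OF assms(4), of Y])
    show "submodule_over S (Y n)" for n
      using Z V unfolding Y_def by (intro submodule_plus) auto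
    show "V \<subseteq> Y n" for n
    proof
      fix v assume "v \<in> V"
      moreover have "v = 0 + v" by simp
      moreover have "0 \<in> Z n" using Z by (auto intro: submodule_zero)
      ultimately show "v \<in> Y n" unfolding Y_def by blast
    qed
    show "Y n \<subseteq> W" for n using Z W \<open>V \<subseteq> W\<close> unfolding Y_def by (blast intro: submodule_add)
    show "mono Y \<or> antimono Y"
      by (rule mono_or_antimono_compose[OF mon]) (auto simp: Y_def)
  qed (rule that, assumption)
  have sub: "A = B" if "A \<in> range Z" "B \<in> range Z" "A \<subseteq> B" "A \<inter> V = B \<inter> V"
    "{x + v | x v. x \<in> A \<and> v \<in> V} = {x + v | x v. x \<in> B \<and> v \<in> V}" for A B
  proof -
    have AB: "submodule_over S A" "submodule_over S B" using that(1,2) Z by auto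
    note sub = that(3) and int = that(4) and sum = that(5)
    have "b \<in> A" if b: "b \<in> B" for b
    proof -
      have "b = b + 0" "0 \<in> V" using submodule_zero[OF V] by auto
      then have "b \<in> {x + v | x v. x \<in> B \<and> v \<in> V}" using b by blast
      then have "b \<in> {x + v | x v. x \<in> A \<and> v \<in> V}" by (simp only: sum)
      then obtain x v where *: "b = x + v" "x \<in> A" "v \<in> V" by blast
      then have "b - x \<in> B" using submodule_diff[OF AB(2) S b] *(2) sub by blast
      then have "v \<in> B" using *(1) by simp
      then have "v \<in> A" using *(3) int by blast
      then show ?thesis using * submodule_add[OF AB(1)] by blast
    qed
    then show ?thesis using \<open>A \<subseteq> B\<close> by blast
  qed
  show "\<exists>m. \<forall>n\<ge>m. Z n = Z m"
  proof (intro exI allI impI)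
    fix n assume n: "n \<ge> max m1 m2"
    have 1: "Z n \<inter> V = Z (max m1 m2) \<inter> V" using m1[of n] m1[of "max m1 m2"] n by auto
    have 2: "Y n = Y (max m1 m2)" using m2[of n] m2[of "max m1 m2"] n by auto
    from mon n have "Z n \<subseteq> Z (max m1 m2) \<or> Z (max m1 m2) \<subseteq> Z n"
      by (elim disjE) (simp_all add: antimonoD monoD)
    then show "Z n = Z (max m1 m2)"
    proof
      assume "Z n \<subseteq> Z (max m1 m2)"
      from sub[OF rangeI rangeI this 1 2[unfolded Y_def]] show ?thesis .
    next
      assume "Z (max m1 m2) \<subseteq> Z n"
      from sub[OF rangeI rangeI this 1[symmetric] 2[symmetric, unfolded Y_def]] show ?thesis by simp
    qed
  qed
qed

text \<open>An order-preserving map carries chains to chains, and its injectivity pulls stationarity back. It serves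
  in place of an isomorphism of modules.\<close>

lemma finite_length_embed:
  assumes "finite_length S' V' W'"
    and "\<And>Z. submodule_over S Z \<Longrightarrow> V \<subseteq> Z \<Longrightarrow> Z \<subseteq> W \<Longrightarrow>
      submodule_over S' (\<phi> Z) \<and> V' \<subseteq> \<phi> Z \<and> \<phi> Z \<subseteq> W'"
    and "\<And>Z Y. Z \<subseteq> Y \<Longrightarrow> \<phi> Z \<subseteq> \<phi> Y"
    and "\<And>Z Y. submodule_over S Z \<Longrightarrow> V \<subseteq> Z \<Longrightarrow> Z \<subseteq> W \<Longrightarrow> submodule_over S Y \<Longrightarrow> V \<subseteq> Y \<Longrightarrow> Y \<subseteq> W \<Longrightarrow>
      \<phi> Z = \<phi> Y \<Longrightarrow> Z = Y"
  shows "finite_length S V W"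
  unfolding finite_length_def
proof (intro allI impI)
  fix Z :: "nat \<Rightarrow> _ set"
  assume Z: "\<forall>n. submodule_over S (Z n) \<and> V \<subseteq> Z n \<and> Z n \<subseteq> W" and mon: "mono Z \<or> antimono Z"
  obtain m where "\<And>n. n \<ge> m \<Longrightarrow> \<phi> (Z n) = \<phi> (Z m)"
  proof (rule finite_lengthD[OF assms(1), of "\<lambda>n. \<phi> (Z n)"])
    show "mono (\<lambda>n. \<phi> (Z n)) \<or> antimono (\<lambda>n. \<phi> (Z n))"
      by (rule mono_or_antimono_compose[OF mon]) (rule assms(3))
    show "submodule_over S' (\<phi> (Z n))" "V' \<subseteq> \<phi> (Z n)" "\<phi> (Z n) \<subseteq> W'" for n
      using assms(2)[of "Z n"] Z by auto
  qed (rule that, assumption)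
  then have "Z n = Z m" if "n \<ge> m" for n
    using assms(4)[of "Z n" "Z m"] Z that by blast
  then show "\<exists>m. \<forall>n\<ge>m. Z n = Z m" by blast
qed

lemma finite_length_maximal:
  assumes "finite_length S V W" "F \<noteq> {}"
    and F: "\<And>Z. Z \<in> F \<Longrightarrow> submodule_over S Z \<and> V \<subseteq> Z \<and> Z \<subseteq> W"
  shows "\<exists>Z\<in>F. \<forall>Y\<in>F. Z \<subseteq> Y \<longrightarrow> Y = Z"
proof (rule ccontr)
    assume neg: "\<not> ?thesis"
    have "\<exists>f. \<forall>n. f n \<in> F \<and> f n \<subset> f (Suc n)"
    proof (rule dependent_nat_choice[where P = "\<lambda>_ x. x \<in> F" and Q = "\<lambda>_ x y. x \<subset> y"])
      show "\<exists>x. x \<in> F" using assms(2) by blast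
      show "\<exists>y. y \<in> F \<and> x \<subset> y" if x: "x \<in> F" for x
      proof -
        have "\<not> (\<forall>Y\<in>F. x \<subseteq> Y \<longrightarrow> Y = x)" using neg x by (simp only: bex_simps) blast
        then obtain Y where "Y \<in> F" "x \<subseteq> Y" "Y \<noteq> x" by blast
        then show ?thesis by (intro exI[of _ Y]) (simp add: psubset_eq)
      qed
    qed
    then obtain f where "\<forall>n. f n \<in> F \<and> f n \<subset> f (Suc n)" ..
    then have f: "\<And>n. f n \<in> F" "\<And>n. f n \<subset> f (Suc n)" by simp_all
    have "mono f" by (rule incseq_SucI) (rule psubset_imp_subset[OF f(2)])
    obtain m where m: "\<And>n. n \<ge> m \<Longrightarrow> f n = f m"
    proof (rule finite_lengthD[OF assms(1), of f])
      show "submodule_over S (f n)" "V \<subseteq> f n" "f n \<subseteq> W" for n using F[OF f(1)] by auto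
      show "mono f \<or> antimono f" using \<open>mono f\<close> ..
    qed (rule that, assumption)
    have "f (Suc m) = f m" by (rule m) simp
    then show False using f(2)[of m] by simp
qed

text \<open>Among the submodules generated over V by finitely many elements of W a maximal one must be W itself.\<close>

lemma finite_length_finitely_generated:
  assumes "finite_length S V W" "submodule_over S W" "V \<subseteq> W"
  obtains G where "finite G" "G \<subseteq> W" "W = lin S (V \<union> G)"
proof -
  let ?F = "{lin S (V \<union> G) | G. finite G \<and> G \<subseteq> W}"
  have "lin S (V \<union> {}) \<in> ?F" by (rule CollectI, rule exI[of _ "{}"]) simp
  then have "?F \<noteq> {}" by blast
  moreover have "submodule_over S Z \<and> V \<subseteq> Z \<and> Z \<subseteq> W" if Z: "Z \<in> ?F" for Z
  proof -
    obtain G where G: "Z = lin S (V \<union> G)" "G \<subseteq> W" using Z by blast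
    have "V \<subseteq> Z" using lin_superset[of "V \<union> G" S] unfolding G(1) by blast
    moreover have "Z \<subseteq> W" unfolding G(1) by (rule lin_least[OF assms(2)]) (use assms(3) G(2) in simp)
    ultimately show ?thesis unfolding G(1) by (simp add: lin_submodule)
  qed
  ultimately have "\<exists>Z\<in>?F. \<forall>Y\<in>?F. Z \<subseteq> Y \<longrightarrow> Y = Z"
    by (rule finite_length_maximal[OF assms(1), of ?F])
  then obtain Z where Z: "Z \<in> ?F" "\<forall>Y\<in>?F. Z \<subseteq> Y \<longrightarrow> Y = Z" by (rule bexE)
  from Z(1) obtain G where G: "Z = lin S (V \<union> G)" "G \<subseteq> W" "finite G" by blast
  have "w \<in> Z" if "w \<in> W" for w
  proof -
    have "lin S (V \<union> insert w G) = Z"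
    proof (rule Z(2)[rule_format])
      show "lin S (V \<union> insert w G) \<in> ?F"
        by (rule CollectI, rule exI[of _ "insert w G"]) (use G(2,3) that in simp)
      show "Z \<subseteq> lin S (V \<union> insert w G)" unfolding G(1) by (intro lin_mono) auto
    qed
    then show ?thesis using lin_inc[of w "V \<union> insert w G" S] by simp
  qed
  then have "W \<subseteq> Z" ..
  moreover have "Z \<subseteq> W" unfolding G(1) by (rule lin_least[OF assms(2)]) (use assms(3) G(2) in simp)
  ultimately have "W = lin S (V \<union> G)" unfolding G(1) by (rule subset_antisym)
  then show ?thesis by (rule that[OF G(3,2)])
qed

lemma submodule_colon:
  assumes S: "is_subring S" and V: "submodule_over S V"
  shows "submodule_over S {r \<in> S. r * g \<in> V}"
  unfolding submodule_over_def
proof (intro conjI ballI)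
  show "0 \<in> {r \<in> S. r * g \<in> V}" using subring_zero[OF S] submodule_zero[OF V] by simp
next
  fix v w assume "v \<in> {r \<in> S. r * g \<in> V}" "w \<in> {r \<in> S. r * g \<in> V}"
  then show "v + w \<in> {r \<in> S. r * g \<in> V}"
    using subring_add[OF S] submodule_add[OF V] by (simp add: distrib_right)
next
  fix s v assume "s \<in> S" "v \<in> {r \<in> S. r * g \<in> V}"
  then show "s * v \<in> {r \<in> S. r * g \<in> V}"
    using subring_mult[OF S] submodule_scale[OF V] by (simp add: mult.assoc)
qed

text \<open>The quotient of the larger module by V is cyclic, and is S modulo the annihilator of the class of g.\<close>

lemma finite_length_cyclic:
  assumes S: "is_subring S" and V: "submodule_over S V"
    and fl: "finite_length S {r \<in> S. r * g \<in> V} S"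
  shows "finite_length S V (lin S (insert g V))"
proof (rule finite_length_embed[OF fl, where \<phi> = "\<lambda>Z. {r \<in> S. r * g \<in> Z}"])
  fix Z assume Z: "submodule_over S Z" "V \<subseteq> Z"
  show "submodule_over S {r \<in> S. r * g \<in> Z} \<and> {r \<in> S. r * g \<in> V} \<subseteq> {r \<in> S. r * g \<in> Z}
    \<and> {r \<in> S. r * g \<in> Z} \<subseteq> S"
    using submodule_colon[OF S Z(1)] Z(2) by blast
next
  fix Z Y assume Z: "submodule_over S Z" "V \<subseteq> Z" "Z \<subseteq> lin S (insert g V)"
    and Y: "submodule_over S Y" "V \<subseteq> Y" "Y \<subseteq> lin S (insert g V)"
    and eq: "{r \<in> S. r * g \<in> Z} = {r \<in> S. r * g \<in> Y}"
  have sub: "A \<subseteq> B" if A: "submodule_over S A" "V \<subseteq> A" "A \<subseteq> lin S (insert g V)"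
    and B: "submodule_over S B" "V \<subseteq> B"
    and AB: "{r \<in> S. r * g \<in> A} = {r \<in> S. r * g \<in> B}" for A B
  proof
    fix x assume x: "x \<in> A"
    then obtain v s where *: "x = v + s * g" "v \<in> V" "s \<in> S"
      using A(3) lin_insert[OF S] lin_submodule_eq[OF V] by auto
    have "x - v \<in> A" by (rule submodule_diff[OF A(1) S x]) (use * A in auto)
    then have "s * g \<in> A" using *(1) by simp
    then have "s * g \<in> B" using AB * by blast
    then show "x \<in> B" using * B submodule_add[OF B(1)] by blast
  qed
  show "Z = Y" using sub[OF Z Y(1,2) eq] sub[OF Y Z(1,2) eq[symmetric]] by blast
qed auto

text \<open>Noetherian domains of dimension at most one, by the maximal condition and the maximality of nonzero primes.\<close>

locale noetherian_dim_one =
  fixes R :: "'k::field set"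
  assumes subring: "is_subring R"
    and maximal_ideal_in_family: "\<And>F. F \<noteq> {} \<Longrightarrow> (\<And>J. J \<in> F \<Longrightarrow> submodule_over R J \<and> J \<subseteq> R) \<Longrightarrow>
      \<exists>J\<in>F. \<forall>J'\<in>F. J \<subseteq> J' \<longrightarrow> J' = J"
    and prime_maximal: "\<And>Q. prime_in R Q \<Longrightarrow> Q \<noteq> {0} \<Longrightarrow> maximal_in R Q"
begin

text \<open>Noetherian induction: let D be largest among the nonzero ideals whose quotient has infinite length. If D is
  prime, then it is maximal and has no proper ideals above it. Otherwise xy lies in D for some x, y outside D;
  the ideals \<open>D + xR\<close> and \<open>D : x\<close>, which contains y, are larger than D, and \<open>(D + xR)/D\<close> is
  \<open>R/(D : x)\<close>.\<close>

lemma finite_length_ideal: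
  assumes "submodule_over R C" "C \<subseteq> R" "C \<noteq> {0}"
  shows "finite_length R C R"
proof (rule ccontr)
  assume nfl: "\<not> finite_length R C R"
  let ?F = "{C. submodule_over R C \<and> C \<subseteq> R \<and> C \<noteq> {0} \<and> \<not> finite_length R C R}"
  have "\<exists>J\<in>?F. \<forall>J'\<in>?F. J \<subseteq> J' \<longrightarrow> J' = J"
    by (rule maximal_ideal_in_family) (use assms nfl in auto)
  then obtain D where DF: "D \<in> ?F" and "\<forall>J\<in>?F. D \<subseteq> J \<longrightarrow> J = D" by (rule bexE)
  then have max: "J = D" if "J \<in> ?F" "D \<subseteq> J" for J using that by blast
  have D: "submodule_over R D" "D \<subseteq> R" "D \<noteq> {0}" "\<not> finite_length R D R" using DF by simp_all
  have bigger: "finite_length R J R" if J: "submodule_over R J" "J \<subseteq> R" "D \<subset> J" for J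
  proof (rule ccontr)
    assume "\<not> ?thesis"
    moreover have "J \<noteq> {0}" using J(3) submodule_zero[OF D(1)] by blast
    ultimately have "J \<in> ?F" using J(1,2) by simp
    then have "J = D" using J(3) by (intro max) auto
    then show False using J(3) by simp
  qed
  have one: "1 \<notin> D"
  proof
    assume "1 \<in> D"
    then have "D = R" using D submodule_scale[OF D(1), of _ 1] by fastforce
    then show False using D(4) finite_length_refl by blast
  qed
  show False
  proof (cases "prime_in R D")
    case True
    then have mx: "maximal_in R D" using prime_maximal D by blast
    have two: "Z = D \<or> Z = R" if Z: "submodule_over R Z" "D \<subseteq> Z" "Z \<subseteq> R" for Z
    proof (cases "Z = D")
      case False
      then obtain x where x: "x \<in> Z" "x \<notin> D" using Z by blast
      then obtain y where y: "y \<in> R" "1 - x * y \<in> D" using maximal_inD(4)[OF mx, of x] Z(3) by blast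
      have "(1 - x * y) + y * x \<in> Z"
        by (rule submodule_add[OF Z(1) subsetD[OF Z(2) y(2)] submodule_scale[OF Z(1) y(1) x(1)]])
      then have "1 \<in> Z" by (simp add: mult.commute)
      then have "R \<subseteq> Z" using submodule_scale[OF Z(1), of _ 1] by fastforce
      then show ?thesis using Z by blast
    qed auto
    have "finite_length R D R"
      unfolding finite_length_def
    proof (intro allI impI)
      fix Z :: "nat \<Rightarrow> 'k set"
      assume Z: "\<forall>n. submodule_over R (Z n) \<and> D \<subseteq> Z n \<and> Z n \<subseteq> R" and mon: "mono Z \<or> antimono Z"
      have two: "Z n = D \<or> Z n = R" for n using Z by (intro two) simp_all
      from mon show "\<exists>m. \<forall>n\<ge>m. Z n = Z m"
      proof
        assume "mono Z"
        show ?thesis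
        proof (cases "\<exists>m. Z m = R")
          case True
          then obtain m where m: "Z m = R" ..
          have "Z n = Z m" if "n \<ge> m" for n
            using monoD[OF \<open>mono Z\<close> that] two[of n] \<open>D \<subseteq> R\<close> m by auto
          then show ?thesis by blast
        next
          case False
          then have "Z n = D" for n using two[of n] by simp
          then show ?thesis by simp
        qed
      next
        assume "antimono Z"
        show ?thesis
        proof (cases "\<exists>m. Z m = D")
          case True
          then obtain m where m: "Z m = D" ..
          have "Z n = Z m" if "n \<ge> m" for n
            using antimonoD[OF \<open>antimono Z\<close> that] two[of n] \<open>D \<subseteq> R\<close> m by auto
          then show ?thesis by blast
        next
          case False
          then have "Z n = R" for n using two[of n] by simp
          then show ?thesis by simp
        qed
      qed
    qed
    then show False using D by blast
  next
    case False
    then obtain x y where xy: "x \<in> R" "y \<in> R" "x * y \<in> D" "x \<notin> D" "y \<notin> D"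
      using D one by (auto simp: prime_in_def)
    let ?C1 = "lin R (insert x D)" and ?C2 = "{r \<in> R. r * x \<in> D}"
    have C2: "submodule_over R ?C2" by (rule submodule_colon[OF subring D(1)])
    have "D \<subseteq> ?C2" using D xy by (auto intro: submodule_scale')
    moreover have "y \<in> ?C2" using xy by (simp add: mult.commute)
    ultimately have "finite_length R ?C2 R" using bigger[OF C2] xy by blast
    then have 1: "finite_length R D ?C1" using finite_length_cyclic[OF subring D(1)] by blast
    have C1: "?C1 \<subseteq> R" using D xy submodule_self[OF subring] by (intro lin_least) auto
    have D1: "insert x D \<subseteq> ?C1" by (rule lin_superset)
    then have "D \<subset> ?C1" using xy by auto
    then have "finite_length R ?C1 R" using bigger[OF lin_submodule C1] by blast
    then have "finite_length R D R"
      using finite_length_trans[OF subring lin_submodule 1 _ _ C1 submodule_self[OF subring]] D1 by auto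
    then show False using D by blast
  qed
qed

text \<open>Adding one generator at a time, each successive quotient is cyclic and annihilated by c, hence a quotient
  of R by an ideal containing c.\<close>

lemma finite_length_finite_module:
  assumes G: "finite G" and c: "c \<in> R" "c \<noteq> 0"
  shows "finite_length R ((*) c ` lin R G) (lin R G)"
proof -
  let ?W = "lin R G" let ?V = "(*) c ` ?W"
  have V: "submodule_over R ?V" by (rule submodule_image_mult[OF lin_submodule])
  have VW: "?V \<subseteq> ?W" using c by (auto intro: submodule_scale[OF lin_submodule])
  have "finite_length R ?V (lin R (?V \<union> H))" if "finite H" "H \<subseteq> G" for H
    using that
  proof (induction H)
    case empty
    then show ?case using lin_submodule_eq[OF V] finite_length_refl by auto
  next
    case (insert g H)
    let ?D = "lin R (?V \<union> H)"
    have VD: "?V \<subseteq> ?D" using lin_superset[of "?V \<union> H" R] by auto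
    let ?J = "{r \<in> R. r * g \<in> ?D}"
    have "c * g \<in> ?V" using insert.prems by (auto intro: lin_inc)
    then have "c \<in> ?J" using c VD by auto
    moreover have "submodule_over R ?J" by (rule submodule_colon[OF subring lin_submodule])
    ultimately have "finite_length R ?J R" using c by (intro finite_length_ideal) auto
    then have fl: "finite_length R ?D (lin R (insert g ?D))"
      using finite_length_cyclic[OF subring lin_submodule] by blast
    have DD: "?D \<subseteq> lin R (insert g ?D)" using lin_superset[of "insert g ?D" R] by auto
    have "finite_length R ?V (lin R (insert g ?D))"
      by (rule finite_length_trans[OF subring lin_submodule insert.IH fl VD DD lin_submodule])
        (use insert.prems in auto)
    moreover have "lin R (insert g ?D) = lin R (?V \<union> insert g H)"
      using lin_insert[OF subring, of g ?D] lin_insert[OF subring, of g "?V \<union> H"]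
        lin_submodule_eq[OF lin_submodule, of R "?V \<union> H"] by simp
    ultimately show ?case by simp
  qed
  from this[OF G order_refl] have "finite_length R ?V (lin R (?V \<union> G))" .
  moreover have "lin R (?V \<union> G) = ?W"
  proof
    show "lin R (?V \<union> G) \<subseteq> ?W"
      by (rule lin_least[OF lin_submodule]) (use VW lin_superset[of G R] in blast)
    show "?W \<subseteq> lin R (?V \<union> G)" by (intro lin_mono) auto
  qed
  ultimately show ?thesis by simp
qed

text \<open>For x in C with denominator c the ideals generated by \<open>a ^ h\<close> and c become stationary, whence
  \<open>a ^ h * x\<close> lies in \<open>A + a ^ Suc h C\<close> for some h. The intersections of A with \<open>a ^ h C + aA\<close>
  become stationary as well, say at m; while h exceeds m this permits division of the relation by a. So
  \<open>a ^ m * x\<close> lies in \<open>A + a ^ Suc m C\<close> for all x in C, with m independent of x. A module V between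
  aC and C is therefore determined by the intersection of A with \<open>a ^ m V\<close>, which contains
  \<open>a ^ Suc m A\<close>; and A modulo the latter has finite length.\<close>

lemma Krull_Akizuki:
  assumes A: "is_subring A" "R \<subseteq> A" "A = lin R G" "finite G"
    and C: "is_subring C" "A \<subseteq> C" and denom: "\<And>x. x \<in> C \<Longrightarrow> \<exists>c\<in>R. c \<noteq> 0 \<and> c * x \<in> A"
    and a: "a \<in> R" "a \<noteq> 0"
  shows "finite_length R ((*) a ` C) C"
proof -
  have aA: "a \<in> A" "a \<in> C" using a(1) A(2) C(2) by blast+
  have flA: "finite_length R ((*) c ` A) A" if "c \<in> R" "c \<noteq> 0" for c
    unfolding A(3) by (rule finite_length_finite_module[OF A(4) that])
  have step1: "\<exists>h. \<exists>\<alpha>\<in>A. \<exists>y\<in>C. a ^ h * x = \<alpha> + a ^ Suc h * y" if x: "x \<in> C" for x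
  proof -
    obtain c where c: "c \<in> R" "c \<noteq> 0" "c * x \<in> A" using denom[OF x] by blast
    define Z where "Z h = lin A {a ^ h, c}" for h
    have Zform: "Z h = {v * c + u * a ^ h | u v. u \<in> A \<and> v \<in> A}" for h
    proof -
      have "lin A {} = {0}" using lin_finite[OF A(1), of "{}"] by auto
      then show ?thesis unfolding Z_def lin_insert[OF A(1)] by simp blast
    qed
    have cA: "c \<in> A" using c(1) A(2) by blast
    obtain h where h: "\<And>n. n \<ge> h \<Longrightarrow> Z n = Z h"
    proof (rule finite_lengthD[OF flA[OF c(1,2)], of Z])
      show "submodule_over R (Z n)" for n
        unfolding Z_def using submodule_restrict[OF lin_submodule A(2)] .
      show "(*) c ` A \<subseteq> Z n" for n
      proof
        fix x assume "x \<in> (*) c ` A"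
        then obtain u where u: "x = c * u" "u \<in> A" by blast
        show "x \<in> Z n" unfolding Z_def u(1) by (rule submodule_scale'[OF lin_submodule u(2) lin_inc]) simp
      qed
      show "Z n \<subseteq> A" for n
        unfolding Z_def using cA subring_power[OF A(1) aA(1)]
        by (intro lin_least submodule_self[OF A(1)]) simp
      have "Z (Suc n) \<subseteq> Z n" for n
      proof -
        have "a * a ^ n \<in> lin A {a ^ n, c}"
          by (rule submodule_scale[OF lin_submodule aA(1) lin_inc]) simp
        then show ?thesis unfolding Z_def by (intro lin_least lin_submodule) (simp add: lin_inc)
      qed
      then show "mono Z \<or> antimono Z" by (simp add: decseq_SucI)
    qed (rule that, assumption)
    have "a ^ h \<in> Z (Suc h)" using h[of "Suc h"] unfolding Z_def by (auto intro: lin_inc)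
    then obtain u v where uv: "u \<in> A" "v \<in> A" "a ^ h = v * c + u * a ^ Suc h" unfolding Zform by blast
    have "a ^ h * x = (v * c + u * a ^ Suc h) * x" using uv(3) by simp
    also have "\<dots> = v * (c * x) + a ^ Suc h * (u * x)" by (simp add: algebra_simps)
    finally have "a ^ h * x = v * (c * x) + a ^ Suc h * (u * x)" .
    moreover have "v * (c * x) \<in> A" "u * x \<in> C"
      using subring_mult[OF A(1) uv(2) c(3)] subring_mult[OF C(1) subsetD[OF C(2) uv(1)] x] by simp_all
    ultimately show ?thesis by blast
  qed
  define Y where "Y m = A \<inter> {y + u | y u. y \<in> (*) (a ^ m) ` C \<and> u \<in> (*) a ` A}" for m
  have Y_iff: "\<alpha> \<in> Y m \<longleftrightarrow> \<alpha> \<in> A \<and> (\<exists>y\<in>C. \<exists>u\<in>A. \<alpha> = a ^ m * y + a * u)" for \<alpha> m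
    unfolding Y_def by blast
  obtain m where m: "\<And>n. n \<ge> m \<Longrightarrow> Y n = Y m"
  proof (rule finite_lengthD[OF flA[OF a], of Y])
    have RC: "R \<subseteq> C" using A(2) C(2) by (rule order_trans)
    show "submodule_over R (Y n)" for n
      unfolding Y_def
      by (intro submodule_Int submodule_plus submodule_image_mult submodule_restrict[OF submodule_self RC]
          submodule_restrict[OF submodule_self A(2)] A(1) C(1))
    show "(*) a ` A \<subseteq> Y n" for n
    proof
      fix x assume "x \<in> (*) a ` A"
      then obtain u where u: "x = a * u" "u \<in> A" by blast
      then have "x = a ^ n * 0 + a * u" "x \<in> A" using subring_mult[OF A(1) aA(1)] by auto
      then show "x \<in> Y n" unfolding Y_iff using u(2) subring_zero[OF C(1)] by blast
    qed
    show "Y n \<subseteq> A" for n unfolding Y_def by auto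
    have "Y (Suc n) \<subseteq> Y n" for n
    proof
      fix x assume "x \<in> Y (Suc n)"
      then obtain y u where *: "x \<in> A" "y \<in> C" "u \<in> A" "x = a ^ Suc n * y + a * u"
        unfolding Y_iff by blast
      have "x = a ^ n * (a * y) + a * u" using *(4) by simp
      then show "x \<in> Y n" unfolding Y_iff using *(1,3) subring_mult[OF C(1) aA(2) *(2)] by blast
    qed
    then show "mono Y \<or> antimono Y" by (simp add: decseq_SucI)
  qed (rule that, assumption)
  have step2: "\<exists>\<alpha>\<in>A. \<exists>y\<in>C. a ^ m * x = \<alpha> + a ^ Suc m * y"
    if "x \<in> C" "\<alpha> \<in> A" "y \<in> C" "a ^ h * x = \<alpha> + a ^ Suc h * y" for x h \<alpha> y
    using that(2,3,4)
  proof (induction h arbitrary: \<alpha> y)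
    case 0
    have "a ^ m * x = a ^ m * \<alpha> + a ^ Suc m * y" using 0(3) by (simp add: algebra_simps)
    moreover have "a ^ m * \<alpha> \<in> A" by (intro subring_mult[OF A(1)] subring_power[OF A(1)] aA(1) 0)
    ultimately show ?case using 0(2) by blast
  next
    case (Suc k)
    show ?case
    proof (cases "Suc k \<le> m")
      case True
      then obtain d where d: "m = Suc k + d" using le_Suc_ex by blast
      have "a ^ m * x = a ^ d * (a ^ Suc k * x)" by (simp add: d power_add)
      also have "\<dots> = a ^ d * (\<alpha> + a ^ Suc (Suc k) * y)" by (simp only: Suc.prems(3))
      also have "\<dots> = a ^ d * \<alpha> + a ^ Suc m * y" by (simp add: d power_add distrib_left)
      finally have "a ^ m * x = a ^ d * \<alpha> + a ^ Suc m * y" .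
      moreover have "a ^ d * \<alpha> \<in> A"
        by (intro subring_mult[OF A(1)] subring_power[OF A(1)] aA(1) Suc.prems(1))
      ultimately show ?thesis using Suc.prems(2) by blast
    next
      case False
      have "\<alpha> = a ^ Suc k * (x - a * y) + a * 0"
        using Suc.prems(3) by (simp add: right_diff_distrib mult.assoc power_commutes)
      moreover have "x - a * y \<in> C"
        by (intro subring_diff[OF C(1)] subring_mult[OF C(1)] aA(2) \<open>x \<in> C\<close> Suc.prems(2))
      ultimately have "\<alpha> \<in> Y (Suc k)" unfolding Y_iff using Suc.prems(1) subring_zero[OF A(1)] by blast
      also have "Y (Suc k) = Y (Suc (Suc k))" using m[of "Suc k"] m[of "Suc (Suc k)"] False by simp
      finally obtain y' u where yu: "y' \<in> C" "u \<in> A" "\<alpha> = a ^ Suc (Suc k) * y' + a * u"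
        unfolding Y_iff by blast
      have "a * (a ^ k * x) = a * (u + a ^ Suc k * (y' + y))"
        using Suc.prems(3) by (simp add: yu(3) distrib_left mult.assoc)
      then have "a ^ k * x = u + a ^ Suc k * (y' + y)" using a by simp
      then show ?thesis
        by (rule Suc.IH[OF yu(2) subring_add[OF C(1) yu(1) Suc.prems(2)]])
    qed
  qed
  have step: "\<exists>\<alpha>\<in>A. \<exists>y\<in>C. a ^ m * x = \<alpha> + a ^ Suc m * y" if x: "x \<in> C" for x
  proof -
    obtain h \<alpha> y where "\<alpha> \<in> A" "y \<in> C" "a ^ h * x = \<alpha> + a ^ Suc h * y" using step1[OF x] by blast
    then show ?thesis by (rule step2[OF x])
  qed
  have am: "a ^ Suc m \<in> R" "a ^ Suc m \<noteq> 0"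
    using subring_power[OF subring a(1), of "Suc m"] a(2) by simp_all
  define \<phi> where "\<phi> V = A \<inter> (*) (a ^ m) ` V" for V
  have sub: "V \<subseteq> V'" if V: "submodule_over R V" "(*) a ` C \<subseteq> V" "V \<subseteq> C"
    and V': "submodule_over R V'" "(*) a ` C \<subseteq> V'" and e: "\<phi> V = \<phi> V'" for V V'
  proof
    fix x assume x: "x \<in> V"
    from step[OF subsetD[OF V(3) x]]
    obtain \<alpha> y where *: "\<alpha> \<in> A" "y \<in> C" "a ^ m * x = \<alpha> + a ^ Suc m * y" by blast
    have "\<alpha> = a ^ m * (x - a * y)" using *(3) by (simp add: algebra_simps)
    moreover have "x - a * y \<in> V" using V(2) *(2) by (intro submodule_diff[OF V(1) subring x]) blast
    ultimately have "\<alpha> \<in> \<phi> V" using *(1) unfolding \<phi>_def by blast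
    then have "\<alpha> \<in> \<phi> V'" by (simp only: e)
    then obtain z where z: "z \<in> V'" "\<alpha> = a ^ m * z" by (auto simp: \<phi>_def)
    have "a ^ m * x = a ^ m * (z + a * y)" using *(3) z(2) by (simp add: algebra_simps)
    then have "x = z + a * y" using a(2) by simp
    moreover have "a * y \<in> V'" using V'(2) *(2) by blast
    ultimately show "x \<in> V'" using submodule_add[OF V'(1) z(1)] by simp
  qed
  show ?thesis
  proof (rule finite_length_embed[OF flA[OF am], where \<phi> = \<phi>])
    fix V assume V: "submodule_over R V" "(*) a ` C \<subseteq> V" "V \<subseteq> C"
    have 1: "submodule_over R (\<phi> V)" unfolding \<phi>_def
      by (intro submodule_Int submodule_image_mult V(1) submodule_restrict[OF submodule_self A(2)] A(1))
    have 2: "(*) (a ^ Suc m) ` A \<subseteq> \<phi> V"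
    proof
      fix x assume "x \<in> (*) (a ^ Suc m) ` A"
      then obtain \<alpha> where \<alpha>: "x = a ^ Suc m * \<alpha>" "\<alpha> \<in> A" by blast
      have "a * \<alpha> \<in> V" using V(2) \<alpha>(2) C(2) by blast
      moreover have "x = a ^ m * (a * \<alpha>)" using \<alpha>(1) by simp
      moreover have "x \<in> A"
        unfolding \<alpha>(1) by (intro subring_mult[OF A(1)] subring_power[OF A(1)] aA(1) \<alpha>(2))
      ultimately show "x \<in> \<phi> V" unfolding \<phi>_def by blast
    qed
    show "submodule_over R (\<phi> V) \<and> (*) (a ^ Suc m) ` A \<subseteq> \<phi> V \<and> \<phi> V \<subseteq> A"
      using 1 2 by (simp add: \<phi>_def)
  next
    fix V V' assume V: "submodule_over R V" "(*) a ` C \<subseteq> V" "V \<subseteq> C"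
      and V': "submodule_over R V'" "(*) a ` C \<subseteq> V'" "V' \<subseteq> C" and e: "\<phi> V = \<phi> V'"
    show "V = V'" using sub[OF V V'(1,2) e] sub[OF V' V(1,2) e[symmetric]] by (rule subset_antisym)
  qed (auto simp: \<phi>_def)
qed

end

section \<open>Polynomials with coefficients in a submodule\<close>

definition coeffs_in :: "'k::field set \<Rightarrow> 'k poly \<Rightarrow> bool" where
  "coeffs_in V p \<longleftrightarrow> (\<forall>i. coeff p i \<in> V)"

lemma coeffs_inD: "coeffs_in V p \<Longrightarrow> coeff p i \<in> V"
  by (simp add: coeffs_in_def)

lemma coeffs_in_mono: "coeffs_in V p \<Longrightarrow> V \<subseteq> W \<Longrightarrow> coeffs_in W p"
  by (auto simp: coeffs_in_def)

lemma coeffs_in_0: "submodule_over S V \<Longrightarrow> coeffs_in V 0"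
  by (simp add: coeffs_in_def submodule_zero)

lemma coeffs_in_add: "submodule_over S V \<Longrightarrow> coeffs_in V p \<Longrightarrow> coeffs_in V q \<Longrightarrow> coeffs_in V (p + q)"
  by (simp add: coeffs_in_def submodule_add)

lemma coeffs_in_diff:
  "submodule_over S V \<Longrightarrow> is_subring S \<Longrightarrow> coeffs_in V p \<Longrightarrow> coeffs_in V q \<Longrightarrow> coeffs_in V (p - q)"
  by (simp add: coeffs_in_def submodule_diff)

lemma coeffs_in_smult: "submodule_over S V \<Longrightarrow> s \<in> S \<Longrightarrow> coeffs_in V p \<Longrightarrow> coeffs_in V (smult s p)"
  by (simp add: coeffs_in_def submodule_scale)

lemma coeffs_in_monom: "submodule_over S V \<Longrightarrow> v \<in> V \<Longrightarrow> coeffs_in V (monom v m)"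
  by (simp add: coeffs_in_def submodule_zero)

lemma coeffs_in_const: "submodule_over S V \<Longrightarrow> v \<in> V \<Longrightarrow> coeffs_in V [:v:]"
  using coeffs_in_monom[of S V v 0] by (simp add: monom_0)

lemma coeffs_in_mult:
  assumes V: "submodule_over S V" and p: "coeffs_in S p" and q: "coeffs_in V q"
  shows "coeffs_in V (p * q)"
  unfolding coeffs_in_def coeff_mult
  by (intro allI submodule_sum[OF V] submodule_scale[OF V] coeffs_inD[OF p] coeffs_inD[OF q])

lemma coeffs_in_1: "is_subring S \<Longrightarrow> coeffs_in S 1"
  using coeffs_in_const[OF submodule_self subring_one, of S] by (simp add: one_pCons)

lemma coeffs_in_power: "is_subring S \<Longrightarrow> coeffs_in S p \<Longrightarrow> coeffs_in S (p ^ m)"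
proof (induction m)
  case 0
  then show ?case by (simp add: coeffs_in_1)
next
  case (Suc m)
  then show ?case using coeffs_in_mult[OF submodule_self[of S], of p "p ^ m"] by simp
qed

lemma coeffs_in_sum:
  "submodule_over S V \<Longrightarrow> (\<And>i. i \<in> F \<Longrightarrow> coeffs_in V (f i)) \<Longrightarrow> coeffs_in V (sum f F)"
  by (induction F rule: infinite_finite_induct) (simp_all add: coeffs_in_0 coeffs_in_add)

lemma coeffs_in_pderiv: "is_subring S \<Longrightarrow> submodule_over S V \<Longrightarrow> coeffs_in V p \<Longrightarrow> coeffs_in V (pderiv p)"
  unfolding coeffs_in_def coeff_pderiv by (intro allI submodule_scale subring_of_nat) simp_all

lemma poly_in:
  assumes V: "submodule_over S V" and "is_subring S" "coeffs_in V p" "x \<in> S"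
  shows "poly p x \<in> V"
  unfolding poly_altdef
  by (intro submodule_sum[OF V] submodule_scale'[OF V] subring_power coeffs_inD assms)

lemma poly_in_subring: "is_subring S \<Longrightarrow> coeffs_in S p \<Longrightarrow> x \<in> S \<Longrightarrow> poly p x \<in> S"
  by (rule poly_in[OF submodule_self])

definition adjoin :: "'k::field set \<Rightarrow> 'k \<Rightarrow> 'k set" where
  "adjoin S x = {poly p x | p. coeffs_in S p}"

lemma adjoin_least: "is_subring C \<Longrightarrow> S \<subseteq> C \<Longrightarrow> x \<in> C \<Longrightarrow> adjoin S x \<subseteq> C"
  unfolding adjoin_def using poly_in_subring coeffs_in_mono by blast

lemma adjoin_superset: "is_subring S \<Longrightarrow> S \<subseteq> adjoin S x"
proof
  fix s assume S: "is_subring S" and s: "s \<in> S"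
  have "s = poly [:s:] x" "coeffs_in S [:s:]"
    using coeffs_in_const[OF submodule_self[OF S] s] by simp_all
  then show "s \<in> adjoin S x" unfolding adjoin_def by blast
qed

lemma adjoin_self: "is_subring S \<Longrightarrow> x \<in> adjoin S x"
proof -
  assume S: "is_subring S"
  have "x = poly (monom 1 1) x" by (simp add: poly_monom)
  moreover have "coeffs_in S (monom 1 1)" by (rule coeffs_in_monom[OF submodule_self[OF S] subring_one[OF S]])
  ultimately show ?thesis unfolding adjoin_def by blast
qed

lemma adjoin_subring:
  assumes S: "is_subring S"
  shows "is_subring (adjoin S x)"
  unfolding is_subring_def
proof (intro conjI ballI)
  show "1 \<in> adjoin S x" using adjoin_superset[OF S] subring_one[OF S] by blast
next
  fix y assume "y \<in> adjoin S x"
  then obtain p where p: "y = poly p x" "coeffs_in S p" unfolding adjoin_def by blast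
  have "- y = poly (0 - p) x" by (simp add: p(1))
  moreover have "coeffs_in S (0 - p)"
    by (rule coeffs_in_diff[OF submodule_self[OF S] S coeffs_in_0[OF submodule_self[OF S]] p(2)])
  ultimately show "- y \<in> adjoin S x" unfolding adjoin_def by blast
next
  fix y z assume "y \<in> adjoin S x" "z \<in> adjoin S x"
  then obtain p q where p: "y = poly p x" "coeffs_in S p" and q: "z = poly q x" "coeffs_in S q"
    unfolding adjoin_def by blast
  have "y + z = poly (p + q) x" "y * z = poly (p * q) x" by (simp_all add: p(1) q(1))
  then show "y + z \<in> adjoin S x" "y * z \<in> adjoin S x"
    using coeffs_in_add[OF submodule_self[OF S] p(2) q(2)] coeffs_in_mult[OF submodule_self[OF S] p(2) q(2)]
    unfolding adjoin_def by blast+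
qed

section \<open>The determinant trick\<close>

text \<open>The characteristic polynomial is homogeneous of degree h when the entries of the matrix have degree 1. The
  family P is meant to be the powers of an ideal, or constantly a ring.\<close>

lemma char_poly_coeff_graded:
  fixes A :: "'k::field mat" and P :: "nat \<Rightarrow> 'k set"
  assumes A: "A \<in> carrier_mat h h" and entries: "\<And>i j. i < h \<Longrightarrow> j < h \<Longrightarrow> A $$ (i, j) \<in> P 1"
    and P0: "\<And>m. 0 \<in> P m" and Pone: "1 \<in> P 0" and Pneg: "\<And>m x. x \<in> P m \<Longrightarrow> - x \<in> P m"
    and Padd: "\<And>m x y. x \<in> P m \<Longrightarrow> y \<in> P m \<Longrightarrow> x + y \<in> P m"
    and Pmult: "\<And>m l x y. x \<in> P m \<Longrightarrow> y \<in> P l \<Longrightarrow> x * y \<in> P (m + l)"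
    and i: "i \<le> h"
  shows "coeff (char_poly A) i \<in> P (h - i)"
proof -
  have Psum: "sum f F \<in> P m" if "\<And>i. i \<in> F \<Longrightarrow> f i \<in> P m" for f :: "'c \<Rightarrow> 'k" and F m
    using that by (induction F rule: infinite_finite_induct) (auto intro: P0 Padd)
  \<comment> \<open>Every factor of a summand of the determinant has degree at most 1, with coefficient of
    degree i in the (1 - i)-th piece, and this property is additive in products.\<close>
  define homog where
    "homog d p \<longleftrightarrow> (\<forall>i. (i \<le> d \<longrightarrow> coeff p i \<in> P (d - i)) \<and> (d < i \<longrightarrow> coeff p i = 0))" for d and p :: "'k poly"
  have homog_mult: "homog (d + d') (p * q)" if p: "homog d p" and q: "homog d' q" for d d' p q
    unfolding homog_def
  proof (intro allI conjI impI)
    fix i assume i: "i \<le> d + d'"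
    show "coeff (p * q) i \<in> P (d + d' - i)" unfolding coeff_mult
    proof (rule Psum)
      fix k assume k: "k \<in> {..i}"
      show "coeff p k * coeff q (i - k) \<in> P (d + d' - i)"
      proof (cases "k \<le> d \<and> i - k \<le> d'")
        case True
        then have "coeff p k * coeff q (i - k) \<in> P ((d - k) + (d' - (i - k)))"
          using p q by (intro Pmult) (simp_all add: homog_def)
        moreover have "(d - k) + (d' - (i - k)) = d + d' - i" using True k by auto
        ultimately show ?thesis by simp
      next
        case False
        then have zero: "coeff p k * coeff q (i - k) = 0" using p q by (auto simp: homog_def not_le)
        show ?thesis unfolding zero by (rule P0)
      qed
    qed
  next
    fix i assume i: "d + d' < i"
    show "coeff (p * q) i = 0" unfolding coeff_mult
    proof (intro sum.neutral ballI)
      fix k assume "k \<in> {..i}"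
      then have "d < k \<or> d' < i - k" using i by auto
      then show "coeff p k * coeff q (i - k) = 0" using p q by (auto simp: homog_def)
    qed
  qed
  have homog_one: "homog 0 1" using Pone by (auto simp: homog_def coeff_eq_0)
  have homog_prod: "homog m (\<Prod>i = 0..<m. f i)" if "\<And>i. i < m \<Longrightarrow> homog 1 (f i)" for m f
    using that
  proof (induction m)
    case 0
    then show ?case using homog_one by simp
  next
    case (Suc m)
    have 1: "homog m (\<Prod>i = 0..<m. f i)" by (rule Suc.IH) (rule Suc.prems, simp)
    have 2: "homog 1 (f m)" by (rule Suc.prems) simp
    from homog_mult[OF 1 2] show ?case by simp
  qed
  have entry: "homog 1 (char_poly_matrix A $$ (i, j))" if "i < h" "j < h" for i j
  proof -
    have "char_poly_matrix A $$ (i, j) = (if i = j then [:- (A $$ (i, j)), 1:] else [:- (A $$ (i, j)):])"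
      using A that by (auto simp: char_poly_matrix_def)
    moreover have "coeff [:- (A $$ (i, j)), 1:] k = (if k = 0 then - (A $$ (i, j)) else if k = 1 then 1 else 0)"
      for k by (auto simp: coeff_pCons split: nat.splits)
    moreover have "coeff [:- (A $$ (i, j)):] k = (if k = 0 then - (A $$ (i, j)) else 0)" for k
      by (auto simp: coeff_pCons split: nat.splits)
    ultimately show ?thesis using entries[OF that] Pone P0 Pneg by (auto simp: homog_def)
  qed
  have summand: "homog h (signof p * (\<Prod>i = 0..<h. char_poly_matrix A $$ (i, p i)))"
    if p: "p permutes {0..<h}" for p
  proof -
    have "homog h (\<Prod>i = 0..<h. char_poly_matrix A $$ (i, p i))" (is "homog h ?q")
    proof (rule homog_prod)
      fix i assume "i < h"
      moreover from this have "p i < h" using permutes_in_image[OF p, of i] by simp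
      ultimately show "homog 1 (char_poly_matrix A $$ (i, p i))" by (rule entry)
    qed
    then have "homog h ?q" "homog h (- ?q)" using Pneg by (simp_all add: homog_def)
    then show ?thesis by (cases "evenperm p") (simp_all add: sign_def)
  qed
  have "char_poly A = (\<Sum>p\<in>{p. p permutes {0..<h}}. signof p * (\<Prod>i = 0..<h. char_poly_matrix A $$ (i, p i)))"
    unfolding char_poly_def using A by (intro det_def') simp
  then have "coeff (char_poly A) i
      = (\<Sum>p\<in>{p. p permutes {0..<h}}. coeff (signof p * (\<Prod>i = 0..<h. char_poly_matrix A $$ (i, p i))) i)"
    by (simp only: coeff_sum)
  also have "\<dots> \<in> P (h - i)"
    using summand i by (intro Psum) (simp add: homog_def)
  finally show ?thesis .
qed

text \<open>Multiplication by x maps the tuple of generators to its product with a matrix over \<open>P 1\<close>; so x is an eigenvalue,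
  and the characteristic polynomial is the required equation. The powers of an ideal as P give integral dependence on
  the ideal, a constant P integral dependence on a ring.\<close>

lemma determinant_trick:
  fixes P :: "nat \<Rightarrow> 'k::field set"
  assumes G: "finite G" "g0 \<in> G" "g0 \<noteq> 0"
    and x: "\<And>g. g \<in> G \<Longrightarrow> \<exists>c. (\<forall>g'\<in>G. c g' \<in> P 1) \<and> x * g = (\<Sum>g'\<in>G. c g' * g')"
    and P0: "\<And>m. 0 \<in> P m" and Pone: "1 \<in> P 0" and Pneg: "\<And>m x. x \<in> P m \<Longrightarrow> - x \<in> P m"
    and Padd: "\<And>m x y. x \<in> P m \<Longrightarrow> y \<in> P m \<Longrightarrow> x + y \<in> P m"
    and Pmult: "\<And>m l x y. x \<in> P m \<Longrightarrow> y \<in> P l \<Longrightarrow> x * y \<in> P (m + l)"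
  shows "\<exists>h\<ge>1. \<exists>k. (\<forall>j\<in>{1..h}. k j \<in> P j) \<and> x ^ h + (\<Sum>j=1..h. k j * x ^ (h - j)) = 0"
proof -
  define h where "h = card G"
  obtain b where b: "bij_betw b {0..<h} G"
    using ex_bij_betw_nat_finite[OF G(1)] unfolding h_def by blast
  have bG: "b i \<in> G" if "i < h" for i using bij_betwE[OF b] that by auto
  from x have "\<forall>g. \<exists>c. g \<in> G \<longrightarrow> (\<forall>g'\<in>G. c g' \<in> P 1) \<and> x * g = (\<Sum>g'\<in>G. c g' * g')" by blast
  then obtain c where c: "\<And>g. g \<in> G \<Longrightarrow> (\<forall>g'\<in>G. c g g' \<in> P 1) \<and> x * g = (\<Sum>g'\<in>G. c g g' * g')"
    by metis
  define A where "A = mat h h (\<lambda>(i, j). c (b i) (b j))"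
  have A: "A \<in> carrier_mat h h" by (simp add: A_def)
  let ?v = "vec h b"
  have "A *\<^sub>v ?v = x \<cdot>\<^sub>v ?v"
  proof (rule eq_vecI)
    fix i assume "i < dim_vec (x \<cdot>\<^sub>v ?v)"
    then have i: "i < h" by simp
    have "(A *\<^sub>v ?v) $ i = (\<Sum>j = 0..<h. c (b i) (b j) * b j)"
      using i by (simp add: A_def scalar_prod_def)
    also have "\<dots> = (\<Sum>g'\<in>G. c (b i) g' * g')" by (rule sum.reindex_bij_betw[OF b])
    also have "\<dots> = x * b i" using c[OF bG[OF i]] by simp
    finally show "(A *\<^sub>v ?v) $ i = (x \<cdot>\<^sub>v ?v) $ i" using i by simp
  qed (simp add: A_def)
  moreover have "?v \<noteq> 0\<^sub>v h"
  proof
    assume v0: "?v = 0\<^sub>v h"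
    obtain i where i: "i < h" "b i = g0" using bij_betw_imp_surj_on[OF b] G(2) by force
    then have "?v $ i = 0" using v0 by simp
    then show False using i G(3) by simp
  qed
  ultimately have "eigenvalue A x" unfolding eigenvalue_def eigenvector_def using carrier_matD(1)[OF A]
    by (intro exI[of _ ?v]) simp
  then have root: "poly (char_poly A) x = 0" using eigenvalue_root_char_poly[OF A] by simp
  have deg: "degree (char_poly A) = h" "coeff (char_poly A) h = 1" using degree_monic_char_poly[OF A] by auto
  have "card G > 0" using G(1,2) by (auto simp: card_gt_0_iff)
  then have "h \<ge> 1" by (simp add: h_def)
  have Aent: "A $$ (i, j) \<in> P 1" if "i < h" "j < h" for i j
    using c[OF bG[OF that(1)]] bG[OF that(2)] that by (simp add: A_def)
  define k where "k j = coeff (char_poly A) (h - j)" for j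
  have "k j \<in> P j" if "j \<in> {1..h}" for j
  proof -
    have "k j \<in> P (h - (h - j))" unfolding k_def
      by (rule char_poly_coeff_graded[where P = P, OF A Aent P0 Pone Pneg Padd Pmult]) auto
    then show ?thesis using that by simp
  qed
  moreover have "x ^ h + (\<Sum>j=1..h. k j * x ^ (h - j)) = 0"
  proof -
    have "(\<Sum>j=1..h. k j * x ^ (h - j)) = (\<Sum>i<h. coeff (char_poly A) i * x ^ i)"
      unfolding k_def by (rule sum.reindex_bij_witness[of _ "\<lambda>i. h - i" "\<lambda>j. h - j"]) auto
    moreover have "poly (char_poly A) x = (\<Sum>i<h. coeff (char_poly A) i * x ^ i) + x ^ h"
      unfolding poly_altdef deg(1) lessThan_Suc_atMost[symmetric] by (simp add: deg(2))
    ultimately show ?thesis using root by (simp add: add.commute)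
  qed
  ultimately show ?thesis using \<open>h \<ge> 1\<close> by blast
qed

section \<open>Integral elements\<close>

lemma integral_over_iff:
  "integral_over S x \<longleftrightarrow> (\<exists>p. lead_coeff p = 1 \<and> coeffs_in S p \<and> poly p x = 0)"
  by (simp add: integral_over_def coeffs_in_def)

lemma integral_over_mono: "integral_over S x \<Longrightarrow> S \<subseteq> S' \<Longrightarrow> integral_over S' x"
  unfolding integral_over_iff using coeffs_in_mono by blast

lemma integral_over_self:
  assumes "is_subring S" "x \<in> S" shows "integral_over S x"
  unfolding integral_over_iff
proof (intro exI conjI)
  have "[:- x, 1:] = monom 1 1 + [:- x:]" by (simp add: monom_altdef)
  then show "coeffs_in S [:- x, 1:]"
    using assms coeffs_in_monom[OF submodule_self subring_one, of S 1]
      coeffs_in_const[OF submodule_self subring_uminus, of S x] coeffs_in_add[OF submodule_self, of S] by metis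
qed auto

lemma integral_overI:
  assumes S: "is_subring S" and k: "\<And>j. j \<in> {1..h} \<Longrightarrow> k j \<in> S"
    and eq: "x ^ h + (\<Sum>j=1..h. k j * x ^ (h - j)) = 0"
  shows "integral_over S x"
  unfolding integral_over_iff
proof (intro exI conjI)
  let ?q = "\<Sum>j=1..h. monom (k j) (h - j)"
  let ?p = "monom 1 h + ?q"
  have q: "coeff ?q i = 0" if "i \<ge> h" for i using that by (auto simp: coeff_sum intro!: sum.neutral)
  have deg: "degree ?p = h"
  proof (rule antisym)
    show "degree ?p \<le> h" using q by (intro degree_le) auto
    show "h \<le> degree ?p" using q[of h] by (intro le_degree) simp
  qed
  show "lead_coeff ?p = 1" unfolding deg using q[of h] by simp
  show "coeffs_in S ?p"
    by (intro coeffs_in_add[OF submodule_self[OF S]] coeffs_in_sum[OF submodule_self[OF S]]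
        coeffs_in_monom[OF submodule_self[OF S]] subring_one[OF S] k)
  show "poly ?p x = 0" using eq by (simp add: poly_sum poly_monom)
qed

definition finite_extension :: "'k::field set \<Rightarrow> 'k set \<Rightarrow> bool" where
  "finite_extension R A \<longleftrightarrow> is_subring A \<and> R \<subseteq> A \<and> (\<exists>G. finite G \<and> A = lin R G)"

lemma finite_extensionE:
  assumes "finite_extension R A"
  obtains G where "is_subring A" "R \<subseteq> A" "finite G" "A = lin R G"
  using assms unfolding finite_extension_def by (elim conjE exE) (rule that)

lemma finite_extensionD:
  assumes "finite_extension R A"
  shows "is_subring A" "R \<subseteq> A"
  using assms by (simp_all add: finite_extension_def)

lemma finite_extension_refl:
  assumes R: "is_subring R" shows "finite_extension R R"
  unfolding finite_extension_def
proof (intro conjI exI)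
  show "R = lin R {1}"
  proof
    show "lin R {1} \<subseteq> R" using subring_one[OF R] by (intro lin_least submodule_self[OF R]) simp
    show "R \<subseteq> lin R {1}"
    proof
      fix x assume "x \<in> R"
      from submodule_scale[OF lin_submodule this lin_inc[of 1 "{1}" R]] show "x \<in> lin R {1}" by simp
    qed
  qed
qed (use R in auto)

lemma finite_extension_generators:
  assumes "A = lin R G" "is_subring A"
  obtains g where "g \<in> G" "g \<noteq> 0"
proof -
  have "\<not> G \<subseteq> {0}"
  proof
    assume "G \<subseteq> {0}"
    then have "lin R G \<subseteq> {0}" by (intro lin_least) (simp_all add: submodule_over_def)
    then show False using assms subring_one by fastforce
  qed
  then show ?thesis using that by blast
qed

lemma finite_module_integral:
  assumes R: "is_subring R" and G: "finite G" "g0 \<in> G" "g0 \<noteq> 0"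
    and x: "\<And>g. g \<in> G \<Longrightarrow> x * g \<in> lin R G"
  shows "integral_over R x"
proof -
  have "\<exists>h\<ge>1. \<exists>k. (\<forall>j\<in>{1..h}. k j \<in> R) \<and> x ^ h + (\<Sum>j=1..h. k j * x ^ (h - j)) = 0"
  proof (rule determinant_trick[where P = "\<lambda>_. R", OF G])
    fix g assume "g \<in> G"
    from x[OF this] obtain c where "x * g = (\<Sum>g'\<in>G. c g' * g')" "\<forall>g'\<in>G. c g' \<in> R"
      unfolding lin_finite[OF R G(1)] by (elim CollectE exE conjE) (rule that)
    then show "\<exists>c. (\<forall>g'\<in>G. c g' \<in> R) \<and> x * g = (\<Sum>g'\<in>G. c g' * g')" by (intro exI[of _ c] conjI)
  qed (use R in \<open>simp_all add: subring_closed\<close>)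
  then obtain h k where "\<forall>j\<in>{1..h}. k j \<in> R" "x ^ h + (\<Sum>j=1..h. k j * x ^ (h - j)) = 0"
    by (elim exE conjE) (rule that)
  then show ?thesis by (intro integral_overI[OF R, where k = k and h = h]) simp_all
qed

lemma finite_extension_integral:
  assumes R: "is_subring R" and A: "finite_extension R A" and x: "x \<in> A"
  shows "integral_over R x"
proof -
  obtain G where A': "is_subring A" and G: "finite G" "A = lin R G"
    using A by (rule finite_extensionE)
  obtain g where g: "g \<in> G" "g \<noteq> 0" using finite_extension_generators[OF G(2) A'] .
  show ?thesis
  proof (rule finite_module_integral[OF R G(1) g])
    fix g assume "g \<in> G"
    then have "g \<in> A" unfolding G(2) by (rule lin_inc)
    then show "x * g \<in> lin R G" unfolding G(2)[symmetric] by (rule subring_mult[OF A' x])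
  qed
qed

text \<open>The equation of x reduces its powers to those below its degree d, so products of generators of A with
  \<open>x ^ i\<close> for \<open>i < d\<close> generate.\<close>

lemma finite_extension_adjoin:
  assumes R: "is_subring R" and A: "finite_extension R A" and x: "integral_over A x"
  shows "finite_extension R (adjoin A x)"
proof -
  obtain G where A': "is_subring A" and RA: "R \<subseteq> A" and G: "finite G" "A = lin R G"
    using A by (rule finite_extensionE)
  obtain f where f: "lead_coeff f = 1" "coeffs_in A f" "poly f x = 0" using x unfolding integral_over_iff by blast
  let ?d = "degree f"
  let ?H = "(\<lambda>(g, i). g * x ^ i) ` (G \<times> {..<?d})"
  note sub = lin_submodule[of R ?H]
  have xd: "x ^ ?d = (\<Sum>i<?d. - (coeff f i * x ^ i))"
  proof -
    have "poly f x = (\<Sum>i<?d. coeff f i * x ^ i) + x ^ ?d"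
      unfolding poly_altdef lessThan_Suc_atMost[symmetric] by (simp add: f(1))
    then show ?thesis using f(3) by (simp add: sum_negf eq_neg_iff_add_eq_0 add.commute)
  qed
  have pow: "a * x ^ m \<in> lin R ?H" if "a \<in> A" for a m
    using that
  proof (induction m arbitrary: a rule: less_induct)
    case (less m)
    show ?case
    proof (cases "m < ?d")
      case True
      from less.prems have "a \<in> lin R G" using G(2) by simp
      then show ?thesis
      proof (induction rule: lin_induct)
        case zero then show ?case using submodule_zero[OF sub] by simp
      next
        case (add v w) then show ?case using submodule_add[OF sub] by (simp add: distrib_right)
      next
        case (scale s v) then show ?case using submodule_scale[OF sub] by (simp add: mult.assoc)
      next
        case (gen g)
        then show ?case using True by (intro lin_inc) force
      qed
    next
      case False
      then have m: "m = ?d + (m - ?d)" by simp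
      have "a * x ^ m = a * (x ^ ?d * x ^ (m - ?d))" by (subst m) (simp add: power_add)
      also have "\<dots> = (\<Sum>i<?d. (- (a * coeff f i)) * x ^ (i + (m - ?d)))"
        unfolding xd by (simp add: sum_distrib_left sum_distrib_right power_add mult.assoc)
      also have "\<dots> \<in> lin R ?H"
      proof (rule submodule_sum[OF sub])
        fix i assume i: "i \<in> {..<?d}"
        show "- (a * coeff f i) * x ^ (i + (m - ?d)) \<in> lin R ?H"
        proof (rule less.IH)
          show "i + (m - ?d) < m" using i False by auto
          show "- (a * coeff f i) \<in> A"
            by (intro subring_uminus[OF A'] subring_mult[OF A'] less.prems coeffs_inD[OF f(2)])
        qed
      qed
      finally show ?thesis .
    qed
  qed
  have E: "is_subring (adjoin A x)" by (rule adjoin_subring[OF A'])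
  have AE: "A \<subseteq> adjoin A x" by (rule adjoin_superset[OF A'])
  have "adjoin A x = lin R ?H"
  proof
    show "adjoin A x \<subseteq> lin R ?H"
    proof
      fix y assume "y \<in> adjoin A x"
      then obtain p where p: "y = poly p x" "coeffs_in A p" unfolding adjoin_def by blast
      show "y \<in> lin R ?H" unfolding p(1) poly_altdef by (intro submodule_sum[OF sub] pow coeffs_inD[OF p(2)])
    qed
    show "lin R ?H \<subseteq> adjoin A x"
    proof (rule lin_least)
      show "submodule_over R (adjoin A x)"
        using submodule_restrict[OF submodule_self[OF E]] RA AE by blast
      show "?H \<subseteq> adjoin A x"
      proof
        fix y assume "y \<in> ?H"
        then obtain g i where gi: "y = g * x ^ i" "g \<in> G" by auto
        have "g \<in> adjoin A x" using AE lin_inc[OF gi(2), of R] G(2) by blast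
        then show "y \<in> adjoin A x" unfolding gi(1)
          by (intro subring_mult[OF E] subring_power[OF E] adjoin_self[OF A'])
      qed
    qed
  qed
  then show ?thesis unfolding finite_extension_def using E RA AE G(1) by (intro conjI exI[of _ ?H]) auto
qed

lemma finite_extension_adjoin_set:
  assumes R: "is_subring R" and "finite B" "\<And>x. x \<in> B \<Longrightarrow> integral_over R x" and A0: "finite_extension R A0"
  shows "\<exists>A. finite_extension R A \<and> A0 \<subseteq> A \<and> B \<subseteq> A \<and>
    (\<forall>C. is_subring C \<longrightarrow> A0 \<subseteq> C \<longrightarrow> B \<subseteq> C \<longrightarrow> A \<subseteq> C)"
  using assms(2,3)
proof (induction B)
  case empty
  then show ?case using A0 by (intro exI[of _ A0]) simp
next
  case (insert x B)
  then obtain A where A: "finite_extension R A" "A0 \<subseteq> A" "B \<subseteq> A"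
    and least: "\<And>C. is_subring C \<Longrightarrow> A0 \<subseteq> C \<Longrightarrow> B \<subseteq> C \<Longrightarrow> A \<subseteq> C" by auto
  have A': "is_subring A" "R \<subseteq> A" using finite_extensionD[OF A(1)] by auto
  have "integral_over A x" using insert.prems[of x] A'(2) integral_over_mono by blast
  then have "finite_extension R (adjoin A x)" by (rule finite_extension_adjoin[OF R A(1)])
  moreover have "A \<subseteq> adjoin A x" "x \<in> adjoin A x"
    using adjoin_superset[OF A'(1)] adjoin_self[OF A'(1)] by auto
  moreover have "adjoin A x \<subseteq> C" if "is_subring C" "A0 \<subseteq> C" "insert x B \<subseteq> C" for C
    using that least[of C] by (intro adjoin_least) auto
  ultimately show ?case using A(2,3) by (intro exI[of _ "adjoin A x"]) auto
qed

lemma integral_over_closed: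
  assumes R: "is_subring R" and xy: "integral_over R x" "integral_over R y"
  shows "integral_over R (x + y)" "integral_over R (x * y)" "integral_over R (- x)"
proof -
  have "\<exists>A. finite_extension R A \<and> R \<subseteq> A \<and> {x, y} \<subseteq> A \<and>
    (\<forall>C. is_subring C \<longrightarrow> R \<subseteq> C \<longrightarrow> {x, y} \<subseteq> C \<longrightarrow> A \<subseteq> C)"
    by (rule finite_extension_adjoin_set[OF R _ _ finite_extension_refl[OF R]]) (use xy in auto)
  then obtain A where A: "finite_extension R A" "{x, y} \<subseteq> A" by blast
  have A': "is_subring A" by (rule finite_extensionD[OF A(1)])
  show "integral_over R (x + y)" "integral_over R (x * y)" "integral_over R (- x)"
    by (rule finite_extension_integral[OF R A(1)], use A(2) in \<open>auto intro: subring_closed[OF A']\<close>)+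
qed

text \<open>The coefficients of an equation of x over A, being finite in number, lie in a finite extension of R.\<close>

lemma integral_over_trans:
  assumes R: "is_subring R" and A: "\<And>a. a \<in> A \<Longrightarrow> integral_over R a" and x: "integral_over A x"
  shows "integral_over R x"
proof -
  obtain f where f: "lead_coeff f = 1" "coeffs_in A f" "poly f x = 0" using x unfolding integral_over_iff by blast
  have "\<exists>B. finite_extension R B \<and> R \<subseteq> B \<and> coeff f ` {..degree f} \<subseteq> B \<and>
    (\<forall>C. is_subring C \<longrightarrow> R \<subseteq> C \<longrightarrow> coeff f ` {..degree f} \<subseteq> C \<longrightarrow> B \<subseteq> C)"
    by (rule finite_extension_adjoin_set[OF R _ _ finite_extension_refl[OF R]])
      (use A coeffs_inD[OF f(2)] in auto)
  then obtain B where B: "finite_extension R B" "coeff f ` {..degree f} \<subseteq> B" by blast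
  have B': "is_subring B" by (rule finite_extensionD[OF B(1)])
  have "coeff f i \<in> B" for i
    using B(2) subring_zero[OF B'] by (cases "i \<le> degree f") (auto simp: coeff_eq_0)
  then have "integral_over B x" unfolding integral_over_iff coeffs_in_def using f by blast
  then have "finite_extension R (adjoin B x)" by (rule finite_extension_adjoin[OF R B(1)])
  then show ?thesis by (rule finite_extension_integral[OF R _ adjoin_self[OF B']])
qed

text \<open>The constant term of an equation of x is a multiple of x. While it vanishes, the equation can be divided
  by x.\<close>

lemma integral_over_multiple:
  assumes S: "is_subring S" and C: "is_subring C" "S \<subseteq> C" "x \<in> C" and x: "integral_over S x" "x \<noteq> 0"
  shows "\<exists>y\<in>C. x * y \<in> S \<and> x * y \<noteq> 0"
proof -
  obtain f where "lead_coeff f = 1" "coeffs_in S f" "poly f x = 0" using x(1) unfolding integral_over_iff by blast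
  then show ?thesis
  proof (induction f)
    case 0
    then show ?case by simp
  next
    case (pCons a q)
    have q: "coeffs_in S q" using pCons.prems(2) by (auto simp: coeffs_in_def coeff_pCons split: nat.splits)
    have a: "a \<in> S" using coeffs_inD[OF pCons.prems(2), of 0] by simp
    have eq: "a + x * poly q x = 0" using pCons.prems(3) by simp
    show ?case
    proof (cases "q = 0")
      case True
      then have "a = 1" "a = 0" using pCons.prems(1) eq by simp_all
      then show ?thesis by simp
    next
      case False
      show ?thesis
      proof (cases "a = 0")
        case True
        then have "poly q x = 0" using eq x(2) by simp
        moreover have "lead_coeff q = 1" using pCons.prems(1) False by simp
        ultimately show ?thesis using pCons.IH q by blast
      next
        case False
        have "x * poly q x = - a" using eq by (simp add: add_eq_0_iff)
        moreover have "poly q x \<in> C" using poly_in_subring[OF C(1) coeffs_in_mono[OF q C(2)] C(3)] .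
        ultimately show ?thesis using False subring_uminus[OF S a] by (intro bexI[of _ "poly q x"]) simp_all
      qed
    qed
  qed
qed

section \<open>Fields of fractions and normalizations\<close>

definition is_subfield :: "'k::field set \<Rightarrow> bool" where
  "is_subfield K \<longleftrightarrow> is_subring K \<and> (\<forall>x\<in>K. inverse x \<in> K)"

lemma subfield_subring: "is_subfield K \<Longrightarrow> is_subring K"
  and subfield_inverse: "is_subfield K \<Longrightarrow> x \<in> K \<Longrightarrow> inverse x \<in> K"
  by (auto simp: is_subfield_def)

lemma subfield_divide: "is_subfield K \<Longrightarrow> x \<in> K \<Longrightarrow> y \<in> K \<Longrightarrow> x / y \<in> K"
  by (simp add: divide_inverse subfield_subring subfield_inverse subring_mult)

lemma quotient_fieldI: "a \<in> S \<Longrightarrow> b \<in> S \<Longrightarrow> b \<noteq> 0 \<Longrightarrow> a / b \<in> quotient_field S"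
  unfolding quotient_field_def by blast

lemma quotient_fieldE:
  assumes "x \<in> quotient_field S"
  obtains a b where "a \<in> S" "b \<in> S" "b \<noteq> 0" "x = a / b"
  using assms unfolding quotient_field_def by blast

lemma quotient_field_superset: "is_subring S \<Longrightarrow> S \<subseteq> quotient_field S"
  using quotient_fieldI[OF _ subring_one] by fastforce

lemma quotient_field_subfield:
  assumes S: "is_subring S"
  shows "is_subfield (quotient_field S)"
  unfolding is_subfield_def is_subring_def
proof (intro conjI ballI)
  show "1 \<in> quotient_field S" using quotient_field_superset[OF S] subring_one[OF S] by blast
next
  fix x assume "x \<in> quotient_field S"
  then obtain a b where x: "a \<in> S" "b \<in> S" "b \<noteq> 0" "x = a / b" by (rule quotient_fieldE)
  have "- x = (- a) / b" by (simp add: x(4))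
  then show "- x \<in> quotient_field S"
    using quotient_fieldI[OF subring_uminus[OF S x(1)] x(2,3)] by simp
  show "inverse x \<in> quotient_field S"
  proof (cases "a = 0")
    case True
    then show ?thesis using quotient_field_superset[OF S] subring_zero[OF S] x(4) by auto
  next
    case False
    then show ?thesis using quotient_fieldI[OF x(2,1) False] x(4) by simp
  qed
next
  fix x y assume "x \<in> quotient_field S" "y \<in> quotient_field S"
  then obtain a b a' b' where x: "a \<in> S" "b \<in> S" "b \<noteq> 0" "x = a / b"
    and y: "a' \<in> S" "b' \<in> S" "b' \<noteq> 0" "y = a' / b'" by (elim quotient_fieldE)
  have "x + y = (a * b' + a' * b) / (b * b')" "x * y = (a * a') / (b * b')"
    unfolding x(4) y(4) using x(3) y(3) by (simp_all add: field_simps)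
  moreover have "a * b' + a' * b \<in> S" "a * a' \<in> S" "b * b' \<in> S" "b * b' \<noteq> 0"
    using x(1-3) y(1-3) S by (simp_all add: subring_closed)
  ultimately show "x + y \<in> quotient_field S" "x * y \<in> quotient_field S" by (simp_all add: quotient_fieldI)
qed

lemma quotient_field_least: "is_subfield F \<Longrightarrow> S \<subseteq> F \<Longrightarrow> quotient_field S \<subseteq> F"
  unfolding quotient_field_def using subfield_divide by blast

lemma quotient_field_mono: "S \<subseteq> T \<Longrightarrow> quotient_field S \<subseteq> quotient_field T"
  unfolding quotient_field_def by blast

lemma quotient_field_idem:
  assumes "is_subring S" "S \<subseteq> T" "T \<subseteq> quotient_field S"
  shows "quotient_field T = quotient_field S"
  by (rule subset_antisym[OF quotient_field_least[OF quotient_field_subfield[OF assms(1)] assms(3)]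
        quotient_field_mono[OF assms(2)]])

lemma adjoin_subfield:
  assumes K: "is_subfield K" and x: "integral_over K x"
  shows "is_subfield (adjoin K x)"
  unfolding is_subfield_def
proof (intro conjI ballI)
  note K' = subfield_subring[OF K]
  show E: "is_subring (adjoin K x)" by (rule adjoin_subring[OF K'])
  fix z assume z: "z \<in> adjoin K x"
  show "inverse z \<in> adjoin K x"
  proof (cases "z = 0")
    case True
    then show ?thesis using z by simp
  next
    case False
    have "integral_over K z"
      by (rule finite_extension_integral[OF K' finite_extension_adjoin[OF K' finite_extension_refl[OF K'] x] z])
    then obtain y where y: "y \<in> adjoin K x" "z * y \<in> K" "z * y \<noteq> 0"
      using integral_over_multiple[OF K' E adjoin_superset[OF K'] z _ False] by blast
    have eq: "inverse z = y * inverse (z * y)" using y(3) by (auto simp: field_simps)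
    have "inverse (z * y) \<in> adjoin K x"
      using subfield_inverse[OF K y(2)] adjoin_superset[OF K'] by blast
    then show ?thesis unfolding eq by (rule subring_mult[OF E y(1)])
  qed
qed

lemma normalization_superset: "is_subring S \<Longrightarrow> S \<subseteq> normalization S"
  unfolding normalization_def using quotient_field_superset integral_over_self by blast

lemma normalization_quotient: "normalization S \<subseteq> quotient_field S"
  unfolding normalization_def by blast

lemma normalization_integral: "x \<in> normalization S \<Longrightarrow> integral_over S x"
  unfolding normalization_def by blast

lemma normalization_subring:
  assumes S: "is_subring S"
  shows "is_subring (normalization S)"
proof -
  have K: "is_subring (quotient_field S)" by (rule subfield_subring[OF quotient_field_subfield[OF S]])
  have "1 \<in> normalization S" using normalization_superset[OF S] subring_one[OF S] by blast
  then show ?thesis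
    unfolding is_subring_def normalization_def
    by (auto intro: integral_over_closed[OF S] subring_add[OF K] subring_mult[OF K] subring_uminus[OF K])
qed

lemma normalization_closed:
  assumes S: "is_subring S" and x: "x \<in> quotient_field S" "integral_over (normalization S) x"
  shows "x \<in> normalization S"
  unfolding normalization_def
  using x integral_over_trans[OF S normalization_integral x(2)] by blast

lemma normalization_integral_extension:
  assumes A: "is_subring A" "A0 \<subseteq> A" "is_subring A0" and int: "\<And>a. a \<in> A \<Longrightarrow> integral_over A0 a"
    and q: "A \<subseteq> quotient_field A0"
  shows "normalization A = normalization A0"
proof -
  have "quotient_field A = quotient_field A0" by (rule quotient_field_idem[OF A(3,2) q])
  moreover have "integral_over A x \<longleftrightarrow> integral_over A0 x" for x
    using integral_over_trans[OF A(3) int] integral_over_mono[OF _ A(2)] by blast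
  ultimately show ?thesis unfolding normalization_def by simp
qed

section \<open>Local uniformizers\<close>

text \<open>The residue ring of C at Q is a domain which is integral over the field \<open>R/(Q \<inter> R)\<close>, hence it is a
  field.\<close>

lemma (in noetherian_dim_one) prime_over_maximal:
  assumes C: "is_subring C" "R \<subseteq> C" and int: "\<And>x. x \<in> C \<Longrightarrow> integral_over R x"
    and Q: "prime_in C Q" and a: "a \<in> Q" "a \<in> R" "a \<noteq> 0"
  shows "maximal_in C Q"
proof -
  note Q' = prime_inD[OF Q]
  have "prime_in R (Q \<inter> R)" by (rule prime_in_contract[OF Q subring C(2)])
  moreover have "Q \<inter> R \<noteq> {0}" using a by blast
  ultimately have mx: "maximal_in R (Q \<inter> R)" by (rule prime_maximal)
  have "\<exists>y\<in>C. 1 - x * y \<in> Q" if x: "x \<in> C" "x \<notin> Q" for x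
  proof -
    obtain p where "lead_coeff p = 1" "coeffs_in R p" "poly p x = 0"
      using int[OF x(1)] unfolding integral_over_iff by blast
    then have "lead_coeff p = 1" "coeffs_in R p" "poly p x \<in> Q" using submodule_zero[OF Q'(1)] by simp_all
    then show ?thesis
    proof (induction p)
      case 0
      then show ?case by simp
    next
      case (pCons c q)
      have q: "coeffs_in R q" using pCons.prems(2) by (auto simp: coeffs_in_def coeff_pCons split: nat.splits)
      have c: "c \<in> R" using coeffs_inD[OF pCons.prems(2), of 0] by simp
      have eq: "c + x * poly q x \<in> Q" using pCons.prems(3) by simp
      have qx: "poly q x \<in> C" by (rule poly_in_subring[OF C(1) coeffs_in_mono[OF q C(2)] x(1)])
      show ?case
      proof (cases "q = 0")
        case True
        then have "1 \<in> Q" using pCons.prems(1) eq by simp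
        then show ?thesis using Q'(3) by simp
      next
        case False
        show ?thesis
        proof (cases "c \<in> Q")
          case True
          have "c + x * poly q x - c \<in> Q" by (rule submodule_diff[OF Q'(1) C(1) eq True])
          then have "x * poly q x \<in> Q" by simp
          then have "poly q x \<in> Q" using Q'(4)[OF x(1) qx] x(2) by blast
          moreover have "lead_coeff q = 1" using pCons.prems(1) False by simp
          ultimately show ?thesis using pCons.IH q by blast
        next
          case False
          then obtain r where r: "r \<in> R" "1 - c * r \<in> Q" using maximal_inD(4)[OF mx c] by blast
          have rC: "r \<in> C" using r(1) C(2) by blast
          have "(1 - c * r) + r * (c + x * poly q x) \<in> Q"
            by (rule submodule_add[OF Q'(1) r(2) submodule_scale[OF Q'(1) rC eq]])
          then have "1 - x * (- (poly q x * r)) \<in> Q" by (simp add: algebra_simps)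
          moreover have "- (poly q x * r) \<in> C" by (rule subring_uminus[OF C(1) subring_mult[OF C(1) qx rC]])
          ultimately show ?thesis by blast
        qed
      qed
    qed
  qed
  then show ?thesis unfolding maximal_in_def using Q' by blast
qed

text \<open>The localisation of S at Q is a discrete valuation ring with maximal ideal generated by \<open>\<tau>\<close>, and i is the
  order of p.\<close>

definition uniformizer :: "'k::field set \<Rightarrow> 'k set \<Rightarrow> 'k \<Rightarrow> bool" where
  "uniformizer S Q \<tau> \<longleftrightarrow> \<tau> \<in> Q \<and> \<tau> \<noteq> 0 \<and>
     (\<forall>p\<in>S. p \<noteq> 0 \<longrightarrow> (\<exists>i. \<exists>s\<in>S - Q. \<exists>u\<in>S - Q. s * p = \<tau> ^ i * u))"

lemma uniformizerE:
  assumes "uniformizer S Q \<tau>" "p \<in> S" "p \<noteq> 0"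
  obtains i s u where "s \<in> S - Q" "u \<in> S - Q" "s * p = \<tau> ^ i * u"
  using assms unfolding uniformizer_def by blast

lemma uniformizer_generates:
  assumes \<tau>: "uniformizer S Q \<tau>" and S: "is_subring S" and Q: "prime_in S Q" and x: "x \<in> Q"
  shows "\<exists>s\<in>S - Q. \<exists>y\<in>S. s * x = \<tau> * y"
proof (cases "x = 0")
  case True
  then have "1 * x = \<tau> * 0" by simp
  then show ?thesis using prime_in_compl_one[OF Q S] subring_zero[OF S] by blast
next
  case False
  note Q' = prime_inD[OF Q]
  obtain i s u where u: "s \<in> S - Q" "u \<in> S - Q" "s * x = \<tau> ^ i * u"
    using uniformizerE[OF \<tau> subsetD[OF Q'(2) x] False] .
  have "i \<noteq> 0"
  proof
    assume "i = 0"
    then have "u = s * x" using u(3) by simp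
    then have "u \<in> Q" using submodule_scale[OF Q'(1) _ x, of s] u(1) by simp
    then show False using u(2) by simp
  qed
  then obtain j where "i = Suc j" using not0_implies_Suc by blast
  then have "s * x = \<tau> * (\<tau> ^ j * u)" using u(3) by simp
  moreover have "\<tau> \<in> S" using \<tau> Q'(2) unfolding uniformizer_def by blast
  then have "\<tau> ^ j * u \<in> S" using u(2) by (intro subring_mult[OF S] subring_power[OF S]) simp_all
  ultimately show ?thesis using u(1) by blast
qed

text \<open>If a multiple of p has order m, then factors \<open>\<tau>\<close> can be split off from p at most m times until an element
  outside Q is left.\<close>

lemma uniformizerI:
  assumes S: "is_subring S" and Q: "prime_in S Q" and \<tau>: "\<tau> \<in> Q" "\<tau> \<noteq> 0"
    and gen: "\<And>x. x \<in> Q \<Longrightarrow> \<exists>s\<in>S - Q. \<exists>y\<in>S. s * x = \<tau> * y"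
    and mult: "\<And>p. p \<in> S \<Longrightarrow> p \<noteq> 0 \<Longrightarrow> \<exists>q\<in>S. \<exists>w\<in>S - Q. \<exists>m. p * q = \<tau> ^ m * w"
  shows "uniformizer S Q \<tau>"
proof -
  note Q' = prime_inD[OF Q]
  have *: "\<exists>i. \<exists>s\<in>S - Q. \<exists>u\<in>S - Q. s * p = \<tau> ^ i * u"
    if "p \<in> S" "q \<in> S" "w \<in> S - Q" "p * q = \<tau> ^ m * w" for p q w m
    using that
  proof (induction m arbitrary: p w)
    case 0
    have "p \<notin> Q"
    proof
      assume "p \<in> Q"
      then have "p * q \<in> Q" by (rule submodule_scale'[OF Q'(1) 0(2)])
      then show False using 0(3,4) by simp
    qed
    moreover have "1 * p = \<tau> ^ 0 * p" by simp
    ultimately show ?case using 0(1) prime_in_compl_one[OF Q S] by blast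
  next
    case (Suc m)
    show ?case
    proof (cases "p \<in> Q")
      case False
      have "1 * p = \<tau> ^ 0 * p" by simp
      then show ?thesis using False Suc.prems(1) prime_in_compl_one[OF Q S] by blast
    next
      case True
      then obtain s p1 where s: "s \<in> S - Q" "p1 \<in> S" "s * p = \<tau> * p1" using gen by blast
      have "\<tau> * (p1 * q) = s * (p * q)" using s(3) by (simp add: mult.assoc[symmetric])
      also have "\<dots> = \<tau> * (\<tau> ^ m * (s * w))" using Suc.prems(4) by (simp add: algebra_simps)
      finally have "p1 * q = \<tau> ^ m * (s * w)" using \<tau>(2) by simp
      then obtain i s' u where u: "s' \<in> S - Q" "u \<in> S - Q" "s' * p1 = \<tau> ^ i * u"
        using Suc.IH[OF s(2) Suc.prems(2) prime_in_compl_mult[OF Q S s(1) Suc.prems(3)]] by blast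
      have "(s' * s) * p = s' * (\<tau> * p1)" using s(3) by (simp add: mult.assoc)
      also have "\<dots> = \<tau> ^ Suc i * u" using u(3) by (simp add: algebra_simps)
      finally show ?thesis using prime_in_compl_mult[OF Q S u(1) s(1)] u(2) by blast
    qed
  qed
  show ?thesis unfolding uniformizer_def
  proof (intro conjI ballI impI \<tau>)
    fix p assume p: "p \<in> S" "p \<noteq> 0"
    from mult[OF p] obtain q w m where "q \<in> S" "w \<in> S - Q" "p * q = \<tau> ^ m * w" by blast
    then show "\<exists>i. \<exists>s\<in>S - Q. \<exists>u\<in>S - Q. s * p = \<tau> ^ i * u" by (rule *[OF p(1)])
  qed
qed

text \<open>An element of C is a fraction, so has an order at Q which is possibly negative. It is not: otherwise a
  multiple of \<open>\<tau>\<close> in C would lie outside N.\<close>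

lemma uniformizer_overring:
  assumes \<tau>: "uniformizer S Q \<tau>" and S: "is_subring S" and C: "is_subring C" "S \<subseteq> C" "C \<subseteq> quotient_field S"
    and N: "prime_in C N" "N \<inter> S = Q"
  shows "uniformizer C N \<tau>"
  unfolding uniformizer_def
proof (intro conjI ballI impI)
  show \<tau>0: "\<tau> \<noteq> 0" using \<tau> unfolding uniformizer_def by blast
  show \<tau>N: "\<tau> \<in> N" using \<tau> N(2) unfolding uniformizer_def by blast
  note N' = prime_inD[OF N(1)]
  have compl: "s \<in> C - N" if "s \<in> S - Q" for s using that C(2) N(2) by blast
  have mult: "s * t \<in> C - N" if "s \<in> S - Q" "t \<in> S - Q" for s t
    by (rule prime_in_compl_mult[OF N(1) C(1) compl[OF that(1)] compl[OF that(2)]])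
  fix x assume x: "x \<in> C" "x \<noteq> 0"
  obtain p q where pq: "p \<in> S" "q \<in> S" "q \<noteq> 0" "x = p / q" using subsetD[OF C(3) x(1)] by (rule quotient_fieldE)
  have p0: "p \<noteq> 0" using pq(4) x(2) by auto
  have xq: "x * q = p" using pq by simp
  obtain i s u where u: "s \<in> S - Q" "u \<in> S - Q" "s * p = \<tau> ^ i * u" using uniformizerE[OF \<tau> pq(1) p0] .
  obtain j s' u' where u': "s' \<in> S - Q" "u' \<in> S - Q" "s' * q = \<tau> ^ j * u'" using uniformizerE[OF \<tau> pq(2,3)] .
  have "\<tau> ^ j * ((s * u') * x) = s * x * (s' * q)" unfolding u'(3) by (simp only: mult_ac)
  also have "\<dots> = s' * (s * p)" unfolding xq[symmetric] by (simp only: mult_ac)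
  also have "\<dots> = \<tau> ^ i * (u * s')" unfolding u(3) by (simp only: mult_ac)
  finally have eq: "\<tau> ^ j * ((s * u') * x) = \<tau> ^ i * (u * s')" .
  show "\<exists>i. \<exists>s\<in>C - N. \<exists>u\<in>C - N. s * x = \<tau> ^ i * u"
  proof (cases "j \<le> i")
    case True
    then obtain k where k: "i = j + k" using le_Suc_ex by blast
    have "\<tau> ^ j * ((s * u') * x) = \<tau> ^ j * (\<tau> ^ k * (u * s'))"
      unfolding eq k by (simp only: power_add mult.assoc)
    then have eq': "(s * u') * x = \<tau> ^ k * (u * s')"
      by (rule mult_left_cancel[OF power_not_zero[OF \<tau>0], THEN iffD1])
    show ?thesis
      by (rule exI[of _ k], rule bexI[OF _ mult[OF u(1) u'(2)]], rule bexI[OF _ mult[OF u(2) u'(1)]], rule eq')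
  next
    case False
    then obtain k where k: "j = i + Suc k" using less_imp_Suc_add[of i j] by (auto simp: not_le)
    have "\<tau> ^ i * (\<tau> * (\<tau> ^ k * ((s * u') * x))) = \<tau> ^ i * (u * s')"
      unfolding eq[symmetric] k by (simp only: power_add power_Suc mult.assoc)
    then have us: "\<tau> * (\<tau> ^ k * ((s * u') * x)) = u * s'"
      by (rule mult_left_cancel[OF power_not_zero[OF \<tau>0], THEN iffD1])
    have "\<tau> ^ k * ((s * u') * x) \<in> C"
      by (rule subring_mult[OF C(1) subring_power[OF C(1) subsetD[OF N'(2) \<tau>N]]
            subring_mult[OF C(1) DiffD1[OF mult[OF u(1) u'(2)]] x(1)]])
    then have "u * s' \<in> N" unfolding us[symmetric] by (rule submodule_scale'[OF N'(1) _ \<tau>N])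
    then show ?thesis using mult[OF u(2) u'(1)] by simp
  qed
qed

text \<open>After localisation at a prime Q of S this is, for \<open>V = S\<close>, the principal ideal generated by
  \<open>\<pi>\<close>, and for \<open>V = Q\<close>, when \<open>\<pi>\<close> is a uniformizer, the square of the maximal ideal.\<close>

definition local_multiples :: "'k::field set \<Rightarrow> 'k set \<Rightarrow> 'k \<Rightarrow> 'k set \<Rightarrow> 'k set" where
  "local_multiples S Q \<pi> V = {x \<in> S. \<exists>s\<in>S - Q. \<exists>y\<in>V. s * x = \<pi> * y}"

lemma local_multiplesI:
  "x \<in> S \<Longrightarrow> s \<in> S - Q \<Longrightarrow> y \<in> V \<Longrightarrow> s * x = \<pi> * y \<Longrightarrow> x \<in> local_multiples S Q \<pi> V"
  unfolding local_multiples_def by blast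

lemma local_multiplesE:
  assumes "x \<in> local_multiples S Q \<pi> V"
  obtains s y where "x \<in> S" "s \<in> S - Q" "y \<in> V" "s * x = \<pi> * y"
  using assms unfolding local_multiples_def by blast

lemma local_multiples_submodule:
  assumes S: "is_subring S" and Q: "prime_in S Q" and V: "submodule_over S V"
  shows "submodule_over S (local_multiples S Q \<pi> V)"
  unfolding submodule_over_def
proof (intro conjI ballI)
  show "0 \<in> local_multiples S Q \<pi> V"
    by (rule local_multiplesI[OF subring_zero[OF S] prime_in_compl_one[OF Q S] submodule_zero[OF V]]) simp
next
  fix v w assume "v \<in> local_multiples S Q \<pi> V" "w \<in> local_multiples S Q \<pi> V"
  then obtain s y t z where v: "v \<in> S" "s \<in> S - Q" "y \<in> V" "s * v = \<pi> * y"
    and w: "w \<in> S" "t \<in> S - Q" "z \<in> V" "t * w = \<pi> * z" by (elim local_multiplesE)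
  have "(s * t) * (v + w) = t * (s * v) + s * (t * w)" by (simp add: algebra_simps)
  also have "\<dots> = \<pi> * (t * y + s * z)" unfolding v(4) w(4) by (simp add: algebra_simps)
  finally have eq: "(s * t) * (v + w) = \<pi> * (t * y + s * z)" .
  have "t * y + s * z \<in> V"
    by (rule submodule_add[OF V submodule_scale[OF V DiffD1[OF w(2)] v(3)] submodule_scale[OF V DiffD1[OF v(2)] w(3)]])
  from local_multiplesI[OF subring_add[OF S v(1) w(1)] prime_in_compl_mult[OF Q S v(2) w(2)] this eq]
  show "v + w \<in> local_multiples S Q \<pi> V" .
next
  fix r v assume r: "r \<in> S" and "v \<in> local_multiples S Q \<pi> V"
  then obtain s y where v: "v \<in> S" "s \<in> S - Q" "y \<in> V" "s * v = \<pi> * y" by (elim local_multiplesE)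
  have eq: "s * (r * v) = \<pi> * (r * y)" using v(4) by (simp add: algebra_simps)
  from local_multiplesI[OF subring_mult[OF S r v(1)] v(2) submodule_scale[OF V r v(3)] eq]
  show "r * v \<in> local_multiples S Q \<pi> V" .
qed

lemma local_multiples_mono:
  assumes "S \<subseteq> S'" "Q' \<inter> S = Q" "V \<subseteq> V'"
  shows "local_multiples S Q \<pi> V \<subseteq> local_multiples S' Q' \<pi> V'"
proof
  fix x assume "x \<in> local_multiples S Q \<pi> V"
  then obtain s y where x: "x \<in> S" "s \<in> S - Q" "y \<in> V" "s * x = \<pi> * y" by (rule local_multiplesE)
  have "s \<in> S' - Q'" using x(2) assms(1,2) by blast
  from local_multiplesI[OF subsetD[OF assms(1) x(1)] this subsetD[OF assms(3) x(3)] x(4)]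
  show "x \<in> local_multiples S' Q' \<pi> V'" .
qed

text \<open>The argument for discrete valuation rings: an element c outside the localised ideal aC
  whose annihilator modulo this ideal is largest has annihilator M, so that y = c / a up to units is an
  element outside C with yM contained in C; as C is integrally closed, yM is not contained in M. The uniformizer is
  an element of M whose product with y lies outside M.\<close>

lemma (in noetherian_dim_one) uniformizer_exists:
  assumes C: "is_subring C" "R \<subseteq> C" and int: "\<And>x. x \<in> C \<Longrightarrow> integral_over R x"
    and closed: "\<And>x. x \<in> quotient_field C \<Longrightarrow> integral_over C x \<Longrightarrow> x \<in> C"
    and fl: "\<And>r. r \<in> R \<Longrightarrow> r \<noteq> 0 \<Longrightarrow> finite_length R ((*) r ` C) C"
    and M: "maximal_in C M" and a: "a \<in> M" "a \<in> R" "a \<noteq> 0"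
  shows "\<exists>\<pi>. uniformizer C M \<pi>"
proof -
  note M' = maximal_inD[OF M]
  have pM: "prime_in C M" by (rule maximal_in_prime_in[OF M])
  have aC: "a \<in> C" using a(2) C(2) by blast
  define T where "T = local_multiples C M a C"
  have TI: "x \<in> T" if "x \<in> C" "s \<in> C - M" "z \<in> C" "s * x = a * z" for x s z
    unfolding T_def using that by (rule local_multiplesI)
  have TE: "\<exists>s\<in>C - M. \<exists>z\<in>C. s * x = a * z" if "x \<in> T" for x
    using that unfolding T_def local_multiples_def by blast
  have T: "submodule_over C T"
    unfolding T_def by (rule local_multiples_submodule[OF C(1) pM submodule_self[OF C(1)]])
  have aT: "a * z \<in> T" if "z \<in> C" for z
    by (rule TI[OF subring_mult[OF C(1) aC that] prime_in_compl_one[OF pM C(1)] that]) simp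
  have oneT: "1 \<notin> T"
  proof
    assume "1 \<in> T"
    then obtain s z where s: "s \<in> C - M" "z \<in> C" "s * 1 = a * z" using TE by blast
    have "a * z \<in> M" by (rule submodule_scale'[OF M'(1) s(2) a(1)])
    then show False using s(1,3) by simp
  qed
  define ann where "ann c = {r \<in> C. r * c \<in> T}" for c
  have ann_sub: "submodule_over C (ann c)" for c unfolding ann_def by (rule submodule_colon[OF C(1) T])
  let ?F = "ann ` (C - T)"
  have "\<exists>Z\<in>?F. \<forall>Y\<in>?F. Z \<subseteq> Y \<longrightarrow> Y = Z"
  proof (rule finite_length_maximal[OF fl[OF a(2,3)]])
    show "?F \<noteq> {}" using oneT subring_one[OF C(1)] by blast
    fix Z assume "Z \<in> ?F"
    then obtain c where c: "c \<in> C" "Z = ann c" by blast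
    have "(*) a ` C \<subseteq> ann c"
    proof
      fix x assume "x \<in> (*) a ` C"
      then obtain z where z: "x = a * z" "z \<in> C" by blast
      have "x \<in> C" unfolding z(1) by (rule subring_mult[OF C(1) aC z(2)])
      moreover have "x * c \<in> T" unfolding z(1) mult.assoc by (rule aT[OF subring_mult[OF C(1) z(2) c(1)]])
      ultimately show "x \<in> ann c" unfolding ann_def by simp
    qed
    moreover have "submodule_over R (ann c)" by (rule submodule_restrict[OF ann_sub C(2)])
    moreover have "ann c \<subseteq> C" unfolding ann_def by blast
    ultimately show "submodule_over R Z \<and> (*) a ` C \<subseteq> Z \<and> Z \<subseteq> C" unfolding c(2) by simp
  qed
  then obtain c where c: "c \<in> C" "c \<notin> T" and max: "\<forall>Y\<in>?F. ann c \<subseteq> Y \<longrightarrow> Y = ann c" by auto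
  have "prime_in C (ann c)"
    unfolding prime_in_def
  proof (intro conjI ballI impI)
    show "submodule_over C (ann c)" by (rule ann_sub)
    show "ann c \<subseteq> C" unfolding ann_def by blast
    show "1 \<notin> ann c" unfolding ann_def using c by simp
    fix x y assume xy: "x \<in> C" "y \<in> C" "x * y \<in> ann c"
    show "x \<in> ann c \<or> y \<in> ann c"
    proof (rule disjCI)
      assume "y \<notin> ann c"
      then have "y * c \<in> C - T" using xy(2) subring_mult[OF C(1) xy(2) c(1)] unfolding ann_def by blast
      then have "ann (y * c) \<in> ?F" by (rule imageI)
      moreover have "ann c \<subseteq> ann (y * c)"
      proof
        fix r assume "r \<in> ann c"
        then have r: "r \<in> C" "r * c \<in> T" unfolding ann_def by simp_all
        have "y * (r * c) \<in> T" by (rule submodule_scale[OF T xy(2) r(2)])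
        then show "r \<in> ann (y * c)" unfolding ann_def using r(1) by (simp add: algebra_simps)
      qed
      ultimately have eq: "ann (y * c) = ann c" using max by blast
      have "x * (y * c) \<in> T" using xy(3) unfolding ann_def by (simp add: mult.assoc)
      then have "x \<in> ann (y * c)" unfolding ann_def using xy(1) by simp
      then show "x \<in> ann c" unfolding eq .
    qed
  qed
  moreover have "a \<in> ann c" unfolding ann_def using aT[OF c(1)] aC by simp
  ultimately have mxc: "maximal_in C (ann c)" using prime_over_maximal[OF C int _ _ a(2,3)] by blast
  have annM: "ann c \<subseteq> M"
  proof
    fix q assume "q \<in> ann c"
    then have q: "q \<in> C" "q * c \<in> T" unfolding ann_def by simp_all
    obtain s z where s: "s \<in> C - M" "z \<in> C" "s * (q * c) = a * z" using TE[OF q(2)] by blast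
    show "q \<in> M"
    proof (rule ccontr)
      assume "q \<notin> M"
      then have "s * q \<in> C - M" using q(1) by (intro prime_in_compl_mult[OF pM C(1) s(1)]) simp
      moreover have "(s * q) * c = a * z" using s(3) by (simp add: mult.assoc)
      ultimately have "c \<in> T" using s(2) by (intro TI[OF c(1)])
      then show False using c(2) by simp
    qed
  qed
  have Mann: "M \<subseteq> ann c"
  proof
    fix m assume m: "m \<in> M"
    show "m \<in> ann c"
    proof (rule ccontr)
      assume "m \<notin> ann c"
      then obtain y where y: "y \<in> C" "1 - m * y \<in> ann c" using maximal_inD(4)[OF mxc subsetD[OF M'(2) m]] by blast
      have "(1 - m * y) + m * y \<in> M"
        by (rule submodule_add[OF M'(1) subsetD[OF annM y(2)] submodule_scale'[OF M'(1) y(1) m]])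
      then show False using M'(3) by simp
    qed
  qed
  have aCM: "(*) a ` C \<subseteq> M" using submodule_scale'[OF M'(1) _ a(1)] by blast
  have "finite_length R ((*) a ` C) M" by (rule finite_length_subinterval[OF fl[OF a(2,3)] order_refl M'(2)])
  then obtain G where G: "finite G" "G \<subseteq> M" "M = lin R ((*) a ` C \<union> G)"
    using finite_length_finitely_generated[OF _ submodule_restrict[OF M'(1) C(2)] aCM] by metis
  have "\<forall>g\<in>G. \<exists>s. s \<in> C - M \<and> (\<exists>z\<in>C. s * (g * c) = a * z)"
  proof
    fix g assume "g \<in> G"
    then have "g \<in> ann c" using G(2) Mann by blast
    then have "g * c \<in> T" unfolding ann_def by simp
    from TE[OF this] show "\<exists>s. s \<in> C - M \<and> (\<exists>z\<in>C. s * (g * c) = a * z)" by blast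
  qed
  then obtain sg where sg: "\<forall>g\<in>G. sg g \<in> C - M \<and> (\<exists>z\<in>C. sg g * (g * c) = a * z)" by (rule bchoice[THEN exE])
  define s where "s = (\<Prod>g\<in>G. sg g)"
  have sM: "s \<in> C - M" unfolding s_def using sg by (intro prime_in_compl_prod[OF pM C(1)]) simp
  have sC: "s \<in> C" using sM by simp
  have sMc: "\<exists>z\<in>C. s * (x * c) = a * z" if "x \<in> M" for x
  proof -
    have "x \<in> lin R ((*) a ` C \<union> G)" using that by (simp only: G(3)[symmetric])
    then show ?thesis
    proof (induction rule: lin_induct)
      case zero
      then show ?case using subring_zero[OF C(1)] by (intro bexI[of _ 0]) simp_all
    next
      case (add v w)
      then obtain z z' where z: "z \<in> C" "z' \<in> C" "s * (v * c) = a * z" "s * (w * c) = a * z'" by blast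
      have "s * ((v + w) * c) = a * (z + z')" using z(3,4) by (simp add: algebra_simps)
      then show ?case using subring_add[OF C(1) z(1,2)] by blast
    next
      case (scale r v)
      then obtain z where z: "z \<in> C" "s * (v * c) = a * z" by blast
      have "s * ((r * v) * c) = a * (r * z)" using z(2) by (simp add: algebra_simps)
      moreover have "r * z \<in> C" using subring_mult[OF C(1) _ z(1)] scale(1) C(2) by blast
      ultimately show ?case by blast
    next
      case (gen g)
      show ?case
      proof (cases "g \<in> G")
        case True
        then obtain z where z: "z \<in> C" "sg g * (g * c) = a * z" using sg by blast
        let ?t = "\<Prod>h\<in>G - {g}. sg h"
        have "s = sg g * ?t" unfolding s_def by (rule prod.remove[OF G(1) True])
        then have "s * (g * c) = ?t * (sg g * (g * c))" by (simp add: algebra_simps)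
        also have "\<dots> = a * (?t * z)" unfolding z(2) by (simp add: algebra_simps)
        finally have "s * (g * c) = a * (?t * z)" .
        moreover have "?t \<in> C" using sg by (intro subring_prod[OF C(1)]) simp
        ultimately show ?thesis using subring_mult[OF C(1) _ z(1)] by blast
      next
        case False
        then obtain z where z: "g = a * z" "z \<in> C" using gen by blast
        have "s * (g * c) = a * (s * z * c)" by (simp add: z(1) algebra_simps)
        moreover have "s * z * c \<in> C" by (intro subring_mult[OF C(1)] sC z(2) c(1))
        ultimately show ?thesis by blast
      qed
    qed
  qed
  \<comment> \<open>The factor s clears the denominators of the finitely many generators of M, so that \<open>y M\<close> is contained in C.\<close>
  define y where "y = s * c / a"
  have yM: "y * x \<in> C" if "x \<in> M" for x
  proof -
    obtain z where z: "z \<in> C" "s * (x * c) = a * z" using sMc[OF \<open>x \<in> M\<close>] by blast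
    have "y * x = (s * (x * c)) / a" by (simp add: y_def algebra_simps)
    also have "\<dots> = z" using z(2) a(3) by simp
    finally show ?thesis using z(1) by simp
  qed
  have yC: "y \<notin> C"
  proof
    assume "y \<in> C"
    moreover have "s * c = a * y" using a(3) by (simp add: y_def)
    ultimately have "c \<in> T" using c(1) sM by (intro TI)
    then show False using c(2) by simp
  qed
  have "\<exists>x\<in>M. y * x \<notin> M"
  proof (rule ccontr)
    assume "\<not> ?thesis"
    then have yMM: "y * x \<in> M" if "x \<in> M" for x using that by blast
    have Mlin: "M = lin C (insert a G)"
    proof
      show "lin C (insert a G) \<subseteq> M" by (rule lin_least[OF M'(1)]) (use a(1) G(2) in simp)
      have "a * z \<in> lin C (insert a G)" if "z \<in> C" for z
        by (rule submodule_scale'[OF lin_submodule that]) (simp add: lin_inc)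
      then have "(*) a ` C \<union> G \<subseteq> lin C (insert a G)" using lin_superset[of "insert a G" C] by blast
      then have "lin R ((*) a ` C \<union> G) \<subseteq> lin C (insert a G)"
        by (rule lin_least[OF submodule_restrict[OF lin_submodule C(2)]])
      then show "M \<subseteq> lin C (insert a G)" by (simp only: G(3)[symmetric])
    qed
    have "integral_over C y"
    proof (rule finite_module_integral[OF C(1)])
      show "finite (insert a G)" using G(1) by simp
      show "a \<in> insert a G" by simp
      show "a \<noteq> 0" by (rule a(3))
      fix g assume "g \<in> insert a G"
      then have "g \<in> M" using a(1) G(2) by blast
      then show "y * g \<in> lin C (insert a G)" using yMM unfolding Mlin[symmetric] by blast
    qed
    moreover have "y \<in> quotient_field C"
      unfolding y_def by (rule quotient_fieldI[OF subring_mult[OF C(1) sC c(1)] aC a(3)])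
    ultimately show False using closed yC by blast
  qed
  then obtain \<pi> where \<pi>: "\<pi> \<in> M" "y * \<pi> \<notin> M" by blast
  have unit: "y * \<pi> \<in> C - M" using yM[OF \<pi>(1)] \<pi>(2) by simp
  have \<pi>0: "\<pi> \<noteq> 0" using \<pi>(2) submodule_zero[OF M'(1)] by auto
  have \<pi>C: "\<pi> \<in> C" using \<pi>(1) M'(2) by blast
  have "uniformizer C M \<pi>"
  proof (rule uniformizerI[OF C(1) pM \<pi>(1) \<pi>0])
    fix x assume x: "x \<in> M"
    have "(y * \<pi>) * x = \<pi> * (y * x)" by (simp add: algebra_simps)
    then show "\<exists>s\<in>C - M. \<exists>z\<in>C. s * x = \<pi> * z" using unit yM[OF x] by blast
  next
    fix p assume p: "p \<in> C" "p \<noteq> 0"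
    obtain q where q: "q \<in> C" "p * q \<in> R" "p * q \<noteq> 0"
      using integral_over_multiple[OF subring C p(1) int[OF p(1)] p(2)] by blast
    define Z where "Z k = {v + w | v w. v \<in> (*) (\<pi> ^ k) ` C \<and> w \<in> (*) (p * q) ` C}" for k
    obtain k where k: "\<And>m. m \<ge> k \<Longrightarrow> Z m = Z k"
    proof (rule finite_lengthD[OF fl[OF q(2,3)], of Z])
      show "submodule_over R (Z n)" for n unfolding Z_def
        by (intro submodule_plus submodule_image_mult submodule_restrict[OF submodule_self[OF C(1)] C(2)])
      show "(*) (p * q) ` C \<subseteq> Z n" for n
      proof
        fix w assume w: "w \<in> (*) (p * q) ` C"
        have "w = \<pi> ^ n * 0 + w" by simp
        then show "w \<in> Z n" unfolding Z_def using w subring_zero[OF C(1)] by blast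
      qed
      show "Z n \<subseteq> C" for n
      proof
        fix x assume "x \<in> Z n"
        then obtain v w where "x = \<pi> ^ n * v + p * q * w" "v \<in> C" "w \<in> C" unfolding Z_def by blast
        then show "x \<in> C"
          using p(1) q(1) \<pi>C by (simp add: subring_add[OF C(1)] subring_mult[OF C(1)] subring_power[OF C(1)])
      qed
      have "Z (Suc n) \<subseteq> Z n" for n
      proof
        fix x assume "x \<in> Z (Suc n)"
        then obtain v w where x: "x = \<pi> ^ Suc n * v + w" "v \<in> C" "w \<in> (*) (p * q) ` C" unfolding Z_def by blast
        have "x = \<pi> ^ n * (\<pi> * v) + w" using x(1) by simp
        then show "x \<in> Z n" unfolding Z_def using x(3) subring_mult[OF C(1) \<pi>C x(2)] by blast
      qed
      then show "mono Z \<or> antimono Z" by (simp add: decseq_SucI)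
    qed (rule that, assumption)
    have "\<pi> ^ k = \<pi> ^ k * 1 + p * q * 0" by simp
    then have "\<pi> ^ k \<in> Z k" unfolding Z_def using subring_one[OF C(1)] subring_zero[OF C(1)] by blast
    then have "\<pi> ^ k \<in> Z (Suc k)" using k[of "Suc k"] by simp
    then obtain v w where vw: "\<pi> ^ k = \<pi> ^ Suc k * v + p * q * w" "v \<in> C" "w \<in> C" unfolding Z_def by blast
    have "p * (q * w) = p * q * w" by (simp add: mult.assoc)
    also have "\<dots> = \<pi> ^ k - \<pi> ^ Suc k * v" using vw(1) by (simp add: algebra_simps)
    also have "\<dots> = \<pi> ^ k * (1 - \<pi> * v)" by (simp add: algebra_simps)
    finally have eq: "p * (q * w) = \<pi> ^ k * (1 - \<pi> * v)" .
    have "1 - \<pi> * v \<in> C - M"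
    proof
      show "1 - \<pi> * v \<in> C" by (intro subring_diff[OF C(1)] subring_mult[OF C(1)] subring_one[OF C(1)] \<pi>C vw(2))
      show "1 - \<pi> * v \<notin> M"
      proof
        assume *: "1 - \<pi> * v \<in> M"
        have "(1 - \<pi> * v) + \<pi> * v \<in> M"
          by (rule submodule_add[OF M'(1) * submodule_scale'[OF M'(1) vw(2) \<pi>(1)]])
        then show False using M'(3) by simp
      qed
    qed
    then show "\<exists>q\<in>C. \<exists>w\<in>C - M. \<exists>m. p * q = \<pi> ^ m * w" using eq subring_mult[OF C(1) q(1) vw(3)] by blast
  qed
  then show ?thesis ..
qed

section \<open>Separability of simple extensions\<close>

lemma monic_division:
  assumes S: "is_subring S" and g: "coeffs_in S g" "lead_coeff g = 1" and p: "coeffs_in S p"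
  shows "\<exists>q r. coeffs_in S q \<and> coeffs_in S r \<and> p = g * q + r \<and> (\<forall>i\<ge>degree g. coeff r i = 0)"
  using p
proof (induction p)
  case 0
  have "coeffs_in S 0" by (rule coeffs_in_0[OF submodule_self[OF S]])
  then show ?case by (intro exI[of _ 0]) simp
next
  case (pCons a p)
  note S' = submodule_self[OF S]
  have "coeffs_in S p" using pCons.prems by (auto simp: coeffs_in_def coeff_pCons split: nat.splits)
  then obtain q r where qr: "coeffs_in S q" "coeffs_in S r" "p = g * q + r" "\<forall>i\<ge>degree g. coeff r i = 0"
    using pCons.IH by blast
  have a: "a \<in> S" using coeffs_inD[OF pCons.prems, of 0] by simp
  have shift: "coeffs_in S (pCons b h)" if "b \<in> S" "coeffs_in S h" for b h
    using that by (auto simp: coeffs_in_def coeff_pCons split: nat.splits)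
  let ?s = "pCons a r" let ?c = "coeff ?s (degree g)"
  have c: "?c \<in> S" by (rule coeffs_inD[OF shift[OF a qr(2)]])
  have "coeffs_in S (pCons ?c q)" by (rule shift[OF c qr(1)])
  moreover have "coeffs_in S (?s - smult ?c g)"
    by (rule coeffs_in_diff[OF S' S shift[OF a qr(2)] coeffs_in_smult[OF S' c g(1)]])
  moreover have "pCons a p = g * pCons ?c q + (?s - smult ?c g)" using qr(3) by simp
  moreover have "\<forall>i\<ge>degree g. coeff (?s - smult ?c g) i = 0"
  proof (intro allI impI)
    fix i assume i: "i \<ge> degree g"
    show "coeff (?s - smult ?c g) i = 0"
    proof (cases "i = degree g")
      case True
      then show ?thesis using g(2) by simp
    next
      case False
      then have "i > degree g" using i by simp
      then obtain j where "i = Suc j" "j \<ge> degree g" by (cases i) auto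
      then show ?thesis using qr(4) \<open>i > degree g\<close> by (simp add: coeff_eq_0)
    qed
  qed
  ultimately show ?case by blast
qed

lemma poly_pderiv_linear_mult:
  fixes q :: "'a::field poly"
  shows "poly (pderiv ([:- a, 1:] * q)) a = poly q a"
  unfolding pderiv_mult poly_add poly_mult by (simp add: pderiv_pCons)

lemma rsquarefree_pderiv:
  fixes p :: "'a::field poly"
  assumes p: "rsquarefree p" and a: "poly p a = 0"
  shows "poly (pderiv p) a \<noteq> 0"
proof -
  have "p \<noteq> 0" using p by (simp add: rsquarefree_def)
  then have "order a p = 1" using rsquarefree_root_order[OF p a] by simp
  then obtain q where q: "p = [:- a, 1:] * q" "\<not> [:- a, 1:] dvd q" using order_decomp[OF \<open>p \<noteq> 0\<close>, of a] by auto
  have "poly (pderiv p) a = poly q a" unfolding q(1) by (rule poly_pderiv_linear_mult)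
  then show ?thesis using q(2) by (simp add: poly_eq_0_iff_dvd)
qed

lemma rsquarefreeI:
  fixes p :: "'a::field poly"
  assumes p: "p \<noteq> 0" and *: "\<And>a. poly p a = 0 \<Longrightarrow> poly (pderiv p) a \<noteq> 0"
  shows "rsquarefree p"
  unfolding rsquarefree_def
proof (intro conjI allI p)
  fix a
  show "order a p = 0 \<or> order a p = 1"
  proof (rule ccontr)
    assume "\<not> ?thesis"
    then have "2 \<le> order a p" by simp
    then have "[:- a, 1:] ^ 2 dvd p" by (simp add: order_divides)
    then obtain q where "p = [:- a, 1:] ^ 2 * q" by (rule dvdE)
    then have q: "p = [:- a, 1:] * ([:- a, 1:] * q)" by (simp only: power2_eq_square mult.assoc)
    have "poly p a = 0" unfolding q poly_mult by simp
    moreover have "poly (pderiv p) a = 0" unfolding q poly_pderiv_linear_mult poly_mult by simp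
    ultimately have "poly p a = 0" "poly (pderiv p) a = 0" .
    then show False using * by blast
  qed
qed

lemma rsquarefree_factor:
  fixes p :: "'a::field poly"
  assumes "rsquarefree (p * w)" shows "rsquarefree p"
proof (rule rsquarefreeI)
  show "p \<noteq> 0"
  proof
    assume "p = 0"
    then show False using assms by (simp add: rsquarefree_def)
  qed
  fix a assume a: "poly p a = 0"
  then have "poly (p * w) a = 0" by simp
  then have "poly (pderiv (p * w)) a \<noteq> 0" by (rule rsquarefree_pderiv[OF assms])
  then show "poly (pderiv p) a \<noteq> 0" unfolding pderiv_mult poly_add poly_mult using a by auto
qed

lemma card_roots_rsquarefree:
  fixes q :: "'k::alg_closed_field poly"
  assumes "rsquarefree q"
  shows "card {x. poly q x = 0} = degree q"
  using assms
proof (induction "degree q" arbitrary: q)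
  case 0
  then have "degree q = 0" by simp
  then obtain c where "q = [:c:]" by (rule degree_eq_zeroE)
  moreover have "q \<noteq> 0" using 0 by (simp add: rsquarefree_def)
  ultimately show ?case using 0 by simp
next
  case (Suc m)
  then obtain a where a: "poly q a = 0" using alg_closed_imp_poly_has_root[of q] by auto
  then obtain p where p: "q = [:- a, 1:] * p" by (auto simp: poly_eq_0_iff_dvd)
  have "q \<noteq> 0" using Suc.prems by (simp add: rsquarefree_def)
  then have "p \<noteq> 0" using p by auto
  then have deg: "degree q = Suc (degree p)" unfolding p by (subst degree_mult_eq) simp_all
  have "rsquarefree (p * [:- a, 1:])" using Suc.prems unfolding p by (simp only: mult.commute)
  then have "rsquarefree p" by (rule rsquarefree_factor)
  then have "card {x. poly p x = 0} = degree p" using Suc.hyps deg by simp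
  moreover have "poly p a \<noteq> 0"
    using rsquarefree_pderiv[OF Suc.prems a] unfolding p poly_pderiv_linear_mult .
  moreover have "{x. poly q x = 0} = insert a {x. poly p x = 0}" unfolding p poly_mult by auto
  ultimately show ?case using deg poly_roots_finite[OF \<open>p \<noteq> 0\<close>] by simp
qed

lemma minimal_polynomial_exists:
  assumes K: "is_subfield K" and p: "p \<noteq> 0" "coeffs_in K p" "poly p x = 0"
  shows "\<exists>q. minimal_polynomial K x q"
proof -
  let ?P = "\<lambda>q. q \<noteq> 0 \<and> coeffs_in K q \<and> poly q x = 0"
  have "?P p" using p by simp
  from ex_has_least_nat[of ?P, OF this, of degree]
  obtain q where q: "q \<noteq> 0" "coeffs_in K q" "poly q x = 0" and min: "\<And>q'. ?P q' \<Longrightarrow> degree q \<le> degree q'" by blast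
  let ?c = "inverse (lead_coeff q)"
  have c0: "?c \<noteq> 0" using q(1) by simp
  have cK: "?c \<in> K" by (rule subfield_inverse[OF K coeffs_inD[OF q(2)]])
  have "minimal_polynomial K x (smult ?c q)"
    unfolding minimal_polynomial_def
  proof (intro conjI allI impI)
    show "lead_coeff (smult ?c q) = 1" using q(1) by simp
    show "coeff (smult ?c q) i \<in> K" for i
      using coeffs_in_smult[OF submodule_self[OF subfield_subring[OF K]] cK q(2)] by (rule coeffs_inD)
    show "poly (smult ?c q) x = 0" using q(3) by simp
    show "degree (smult ?c q) \<le> degree q'" if "q' \<noteq> 0 \<and> (\<forall>i. coeff q' i \<in> K) \<and> poly q' x = 0" for q'
      using min[of q'] that c0 by (simp add: coeffs_in_def)
  qed
  then show ?thesis ..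
qed

lemma minimal_polynomialD:
  assumes "minimal_polynomial K x p"
  shows "lead_coeff p = 1" "coeffs_in K p" "poly p x = 0" "p \<noteq> 0"
    "\<And>q. q \<noteq> 0 \<Longrightarrow> coeffs_in K q \<Longrightarrow> poly q x = 0 \<Longrightarrow> degree p \<le> degree q"
  using assms unfolding minimal_polynomial_def coeffs_in_def by auto

lemma minimal_polynomial_divides:
  assumes K: "is_subring K" and p: "minimal_polynomial K x p" and f: "coeffs_in K f" "poly f x = 0"
  shows "\<exists>w. coeffs_in K w \<and> f = p * w"
proof -
  note p' = minimal_polynomialD[OF p]
  obtain q r where qr: "coeffs_in K q" "coeffs_in K r" "f = p * q + r" "\<forall>i\<ge>degree p. coeff r i = 0"
    using monic_division[OF K p'(2,1) f(1)] by blast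
  have "poly r x = 0" using f(2) p'(3) unfolding qr(3) by simp
  have "r = 0"
  proof (rule ccontr)
    assume "r \<noteq> 0"
    then have "degree p \<le> degree r" using p'(5) qr(2) \<open>poly r x = 0\<close> by blast
    then have "lead_coeff r = 0" using qr(4) by blast
    then show False using \<open>r \<noteq> 0\<close> by simp
  qed
  then show ?thesis using qr by auto
qed

text \<open>The minimal polynomial q of a common root of g and its derivative divides g, and as y is a root of q or of the
  cofactor it has the same degree as g; but q divides the nonzero derivative, whose degree is smaller.\<close>

lemma minimal_polynomial_rsquarefree:
  assumes K: "is_subfield K" and g: "minimal_polynomial K y g" and g': "pderiv g \<noteq> 0"
  shows "rsquarefree g"
proof (rule rsquarefreeI)
  note gD = minimal_polynomialD[OF g]
  note K' = subfield_subring[OF K]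
  show "g \<noteq> 0" by (rule gD(4))
  fix a assume a: "poly g a = 0"
  show "poly (pderiv g) a \<noteq> 0"
  proof
    assume a': "poly (pderiv g) a = 0"
    obtain q where q: "minimal_polynomial K a q" using minimal_polynomial_exists[OF K gD(4,2) a] ..
    note qD = minimal_polynomialD[OF q]
    obtain w where w: "coeffs_in K w" "g = q * w" using minimal_polynomial_divides[OF K' q gD(2) a] by blast
    have w0: "w \<noteq> 0" using gD(4) w(2) by auto
    have deg: "degree g = degree q + degree w" unfolding w(2) by (rule degree_mult_eq[OF qD(4) w0])
    have "degree q \<noteq> 0"
    proof
      assume "degree q = 0"
      then obtain c where "q = [:c:]" by (rule degree_eq_zeroE)
      then show False using qD(1,3) by simp
    qed
    have "poly q y = 0 \<or> poly w y = 0" using gD(3) unfolding w(2) by simp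
    moreover have "poly w y \<noteq> 0" using gD(5)[OF w0 w(1)] deg \<open>degree q \<noteq> 0\<close> by auto
    ultimately have "degree g \<le> degree q" using gD(5)[OF qD(4,2)] by blast
    moreover have "degree q \<le> degree (pderiv g)"
      by (rule qD(5)[OF g' coeffs_in_pderiv[OF K' submodule_self[OF K'] gD(2)] a'])
    moreover have "degree (pderiv g) \<le> degree g - 1"
      by (rule degree_le) (auto simp: coeff_pderiv coeff_eq_0)
    ultimately show False using \<open>degree q \<noteq> 0\<close> deg by simp
  qed
qed

lemma coeffs_in_pcompose:
  assumes S: "is_subring S" and "coeffs_in S p" "coeffs_in S q"
  shows "coeffs_in S (pcompose p q)"
  using assms(2)
proof (induction p)
  case 0
  then show ?case by simp
next
  case (pCons a p)
  note S' = submodule_self[OF S]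
  have "coeffs_in S p" using pCons.prems by (auto simp: coeffs_in_def coeff_pCons split: nat.splits)
  then have "coeffs_in S (q * pcompose p q)" using pCons.IH coeffs_in_mult[OF S' assms(3)] by blast
  moreover have "coeffs_in S [:a:]" using coeffs_inD[OF pCons.prems, of 0] by (intro coeffs_in_const[OF S']) simp
  ultimately show ?case unfolding pcompose_pCons by (rule coeffs_in_add[OF S', rotated])
qed

lemma frobenius_inj:
  fixes x y :: "'k::field"
  assumes p: "Factorial_Ring.prime CHAR('k)" and eq: "x ^ CHAR('k) = y ^ CHAR('k)"
  shows "x = y"
proof -
  have "((x - y) + y) ^ CHAR('k) = (x - y) ^ CHAR('k) + y ^ CHAR('k)" by (rule freshmans_dream[OF p refl])
  then have "(x - y) ^ CHAR('k) = 0" using eq by simp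
  then show ?thesis by simp
qed

lemma poly_frobenius:
  fixes q :: "'k::field poly"
  assumes p: "Factorial_Ring.prime CHAR('k)"
  shows "poly (map_poly (\<lambda>c. c ^ CHAR('k)) q) (x ^ CHAR('k)) = poly q x ^ CHAR('k)"
proof -
  have pos: "CHAR('k) \<noteq> 0" using p by (metis not_prime_0)
  have deg: "degree (map_poly (\<lambda>c. c ^ CHAR('k)) q) = degree q" by (rule Polynomial.degree_map_poly) simp
  have cf: "coeff (map_poly (\<lambda>c. c ^ CHAR('k)) q) i = coeff q i ^ CHAR('k)" for i
    by (rule Polynomial.coeff_map_poly) (use pos in simp)
  have "poly q x ^ CHAR('k) = (\<Sum>i\<le>degree q. (coeff q i * x ^ i) ^ CHAR('k))"
    unfolding poly_altdef by (rule freshmans_dream_sum[OF p refl])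
  also have "\<dots> = (\<Sum>i\<le>degree q. coeff q i ^ CHAR('k) * (x ^ CHAR('k)) ^ i)"
    by (simp add: power_mult_distrib power_mult[symmetric] mult.commute)
  finally show ?thesis unfolding poly_altdef deg cf ..
qed

text \<open>In characteristic p an element y is separable over K when it is a polynomial in \<open>y ^ p\<close> over K. The
  generator t has this property, and passes it on to the elements of K(t).\<close>

context
  fixes K :: "'k::alg_closed_field set" and f :: "'k poly" and t :: 'k
  assumes K: "is_subfield K" and f: "coeffs_in K f" "rsquarefree f" "poly f t = 0"
begin

lemma generator_integral: "integral_over K t"
proof -
  have "f \<noteq> 0" using f(2) by (simp add: rsquarefree_def)
  then obtain q where "minimal_polynomial K t q" using minimal_polynomial_exists[OF K _ f(1,3)] by blast
  then show ?thesis unfolding integral_over_iff using minimal_polynomialD by blast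
qed

lemma adjoin_integral: "y \<in> adjoin K t \<Longrightarrow> integral_over K y"
  by (rule finite_extension_integral[OF subfield_subring[OF K]
        finite_extension_adjoin[OF subfield_subring[OF K] finite_extension_refl[OF subfield_subring[OF K]]
          generator_integral]])

lemma minimal_polynomial_over_extension:
  assumes E: "is_subfield E" "K \<subseteq> E"
  obtains q where "minimal_polynomial E t q" "rsquarefree q"
proof -
  have fE: "coeffs_in E f" by (rule coeffs_in_mono[OF f(1) E(2)])
  have "f \<noteq> 0" using f(2) by (simp add: rsquarefree_def)
  then obtain q where q: "minimal_polynomial E t q" using minimal_polynomial_exists[OF E(1) _ fE f(3)] by blast
  obtain w where "f = q * w" using minimal_polynomial_divides[OF subfield_subring[OF E(1)] q fE f(3)] by blast
  then have "rsquarefree q" using f(2) rsquarefree_factor by metis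
  then show ?thesis using that q by blast
qed

text \<open>Over the field generated by \<open>t ^ p\<close> the element t is a root of \<open>(X - t) ^ p\<close> and of a
  polynomial without multiple roots, hence its minimal polynomial is \<open>X - t\<close>.\<close>

lemma generator_in_power_adjoin:
  assumes p: "Factorial_Ring.prime CHAR('k)"
  shows "t \<in> adjoin K (t ^ CHAR('k))"
proof -
  let ?p = "CHAR('k)" let ?E = "adjoin K (t ^ CHAR('k))"
  note K' = subfield_subring[OF K]
  have "t ^ ?p \<in> adjoin K t" by (intro subring_power[OF adjoin_subring[OF K']] adjoin_self[OF K'])
  then have E: "is_subfield ?E" by (intro adjoin_subfield[OF K] adjoin_integral)
  note E' = subfield_subring[OF E]
  obtain q where q: "minimal_polynomial ?E t q" "rsquarefree q"
    using minimal_polynomial_over_extension[OF E adjoin_superset[OF K']] .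
  note qD = minimal_polynomialD[OF q(1)]
  let ?u = "monom 1 ?p - [:t ^ ?p:]"
  have "coeffs_in ?E ?u"
    by (intro coeffs_in_diff[OF submodule_self[OF E'] E'] coeffs_in_monom[OF submodule_self[OF E']]
        coeffs_in_const[OF submodule_self[OF E']] subring_one[OF E'] adjoin_self[OF K'])
  moreover have "poly ?u t = 0" by (simp add: poly_monom)
  ultimately obtain w where w: "?u = q * w" using minimal_polynomial_divides[OF E' q(1)] by blast
  have only: "s = t" if "poly q s = 0" for s
  proof (rule frobenius_inj[OF p])
    have "poly ?u s = 0" unfolding w using that by simp
    then show "s ^ ?p = t ^ ?p" by (simp add: poly_monom)
  qed
  have "{x. poly q x = 0} = {t}" using only qD(3) by blast
  then have deg: "degree q = 1" using card_roots_rsquarefree[OF q(2)] by simp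
  have "poly q t = coeff q 0 + t" using qD(1) unfolding poly_altdef deg by simp
  then have eq: "- coeff q 0 = t" using qD(3) by (simp add: add_eq_0_iff)
  have "- coeff q 0 \<in> ?E" by (rule subring_uminus[OF E' coeffs_inD[OF qD(2)]])
  then show ?thesis unfolding eq .
qed

text \<open>If t has degree m over \<open>E = K(y)\<close>, its m conjugates have distinct p-th powers, so
  the powers of \<open>t ^ p\<close> below m are independent over E; writing y in these powers with coefficients
  in the smaller field \<open>K(y ^ p)\<close> shows that y is the constant coefficient.\<close>

lemma element_in_power_adjoin:
  assumes p: "Factorial_Ring.prime CHAR('k)" and y: "y \<in> adjoin K t"
  shows "y \<in> adjoin K (y ^ CHAR('k))"
proof -
  let ?p = "CHAR('k)" let ?E = "adjoin K y" let ?F = "adjoin K (y ^ CHAR('k))"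
  let ?fr = "map_poly (\<lambda>c. c ^ CHAR('k))"
  have pos: "?p \<noteq> 0" using p by (metis not_prime_0)
  have cf: "coeff (?fr q) i = coeff q i ^ ?p" for q :: "'k poly" and i by (rule Polynomial.coeff_map_poly) (use pos in simp)
  note K' = subfield_subring[OF K]
  have E: "is_subfield ?E" by (rule adjoin_subfield[OF K adjoin_integral[OF y]])
  note E' = subfield_subring[OF E]
  have E0': "is_subring ?F" by (rule adjoin_subring[OF K'])
  have "y ^ ?p \<in> ?E" by (intro subring_power[OF E'] adjoin_self[OF K'])
  then have E0E: "?F \<subseteq> ?E" by (rule adjoin_least[OF E' adjoin_superset[OF K']])
  obtain q where q: "minimal_polynomial ?E t q" "rsquarefree q"
    using minimal_polynomial_over_extension[OF E adjoin_superset[OF K']] .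
  note qD = minimal_polynomialD[OF q(1)]
  \<comment> \<open>The p-th powers of the coefficients of q lie in K(y ^ p) and give a monic equation for t ^ p.\<close>
  have degfr: "degree (?fr q) = degree q" by (rule Polynomial.degree_map_poly) simp
  have fr: "coeffs_in ?F (?fr q)"
    unfolding coeffs_in_def cf
  proof
    fix i
    have "coeff q i \<in> ?E" by (rule coeffs_inD[OF qD(2)])
    then obtain v where v: "coeff q i = poly v y" "coeffs_in K v" unfolding adjoin_def by blast
    have "coeff q i ^ ?p = poly (?fr v) (y ^ ?p)" unfolding v(1) by (rule poly_frobenius[OF p, symmetric])
    moreover have "coeffs_in K (?fr v)" unfolding coeffs_in_def cf
      by (intro allI subring_power[OF K'] coeffs_inD[OF v(2)])
    ultimately show "coeff q i ^ ?p \<in> ?F" unfolding adjoin_def by blast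
  qed
  have frlead: "lead_coeff (?fr q) = 1" unfolding degfr cf using qD(1) by simp
  have frt: "poly (?fr q) (t ^ ?p) = 0" unfolding poly_frobenius[OF p] using qD(3) pos by simp
  have "adjoin K t \<subseteq> adjoin K (t ^ ?p)"
    by (rule adjoin_least[OF adjoin_subring[OF K'] adjoin_superset[OF K'] generator_in_power_adjoin[OF p]])
  then obtain v where v: "y = poly v (t ^ ?p)" "coeffs_in K v" using y unfolding adjoin_def[of K "t ^ ?p"] by blast
  have vE0: "coeffs_in ?F v" by (rule coeffs_in_mono[OF v(2) adjoin_superset[OF K']])
  obtain q1 r where r: "coeffs_in ?F r" "v = ?fr q * q1 + r" "\<forall>i\<ge>degree (?fr q). coeff r i = 0"
    using monic_division[OF E0' fr frlead vE0] by blast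
  have yr: "y = poly r (t ^ ?p)" unfolding v(1) r(2) by (simp add: frt)
  let ?s = "r - [:y:]"
  have degq: "degree q \<noteq> 0"
  proof
    assume "degree q = 0"
    then obtain c where "q = [:c:]" by (rule degree_eq_zeroE)
    then show False using qD(1,3) by simp
  qed
  have sE: "coeffs_in ?E ?s"
    by (intro coeffs_in_diff[OF submodule_self[OF E'] E'] coeffs_in_mono[OF r(1) E0E]
        coeffs_in_const[OF submodule_self[OF E']] adjoin_self[OF K'])
  have "?s = 0"
  proof (rule ccontr)
    assume s0: "?s \<noteq> 0"
    let ?sp = "pcompose ?s (monom 1 ?p)"
    have "coeffs_in ?E ?sp"
      by (rule coeffs_in_pcompose[OF E' sE coeffs_in_monom[OF submodule_self[OF E'] subring_one[OF E']]])
    moreover have "poly ?sp t = 0" using yr by (simp add: poly_pcompose poly_monom)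
    ultimately obtain w where w: "?sp = q * w" using minimal_polynomial_divides[OF E' q(1)] by blast
    have "(\<lambda>x. x ^ ?p) ` {x. poly q x = 0} \<subseteq> {x. poly ?s x = 0}"
    proof
      fix z assume "z \<in> (\<lambda>x. x ^ ?p) ` {x. poly q x = 0}"
      then obtain x where x: "z = x ^ ?p" "poly q x = 0" by blast
      have "poly ?sp x = 0" unfolding w using x(2) by simp
      then show "z \<in> {x. poly ?s x = 0}" by (simp add: x(1) poly_pcompose poly_monom)
    qed
    then have "card ((\<lambda>x. x ^ ?p) ` {x. poly q x = 0}) \<le> card {x. poly ?s x = 0}"
      by (rule card_mono[OF poly_roots_finite[OF s0]])
    moreover have "card ((\<lambda>x. x ^ ?p) ` {x. poly q x = 0}) = card {x. poly q x = 0}"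
      by (rule card_image) (auto intro!: inj_onI frobenius_inj[OF p])
    moreover have "card {x. poly ?s x = 0} \<le> degree ?s" by (rule card_poly_roots_bound[OF s0])
    ultimately have "degree q \<le> degree ?s" using card_roots_rsquarefree[OF q(2)] by simp
    moreover have "coeff ?s i = 0" if "i \<ge> degree q" for i
      using r(3) that degq unfolding degfr by (cases i) simp_all
    ultimately have "lead_coeff ?s = 0" by blast
    then show False using s0 by (simp only: leading_coeff_0_iff)
  qed
  then have "r = [:y:]" by simp
  then show ?thesis using coeffs_inD[OF r(1), of 0] by simp
qed

text \<open>If the minimal polynomial g of y had derivative zero, then the characteristic would be a prime p and
  \<open>y = v (y ^ p)\<close> for some v over K. Then g divides \<open>X - v (X ^ p)\<close>, whose derivative is 1, while the
  derivative of every multiple of g is a multiple of g.\<close>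

lemma separable_adjoin:
  assumes y: "y \<in> adjoin K t"
  shows "separable_over K y"
proof -
  note K' = subfield_subring[OF K]
  obtain h0 where "lead_coeff h0 = 1" "coeffs_in K h0" "poly h0 y = 0"
    using adjoin_integral[OF y] unfolding integral_over_iff by blast
  moreover from this have "h0 \<noteq> 0" by auto
  ultimately obtain g where g: "minimal_polynomial K y g" using minimal_polynomial_exists[OF K] by blast
  note gD = minimal_polynomialD[OF g]
  have "pderiv g \<noteq> 0"
  proof
    assume g': "pderiv g = 0"
    have "degree g \<noteq> 0"
    proof
      assume "degree g = 0"
      then obtain c where "g = [:c:]" by (rule degree_eq_zeroE)
      then show False using gD(1,3) by simp
    qed
    then obtain d where d: "degree g = Suc d" using not0_implies_Suc by blast
    have "coeff (pderiv g) d = of_nat (Suc d) * lead_coeff g" unfolding d by (rule coeff_pderiv)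
    then have "(of_nat (Suc d) :: 'k) = 0" using g' gD(1) by simp
    then have "CHAR('k) dvd Suc d" by (simp only: of_nat_eq_0_iff_char_dvd)
    then have "CHAR('k) \<noteq> 0" using dvd_pos_nat[of "Suc d"] by simp
    then have p: "Factorial_Ring.prime CHAR('k)" by (intro prime_CHAR_semidom) simp
    obtain h where h: "y = poly h (y ^ CHAR('k))" "coeffs_in K h"
      using element_in_power_adjoin[OF p y] unfolding adjoin_def[of K "y ^ CHAR('k)"] by blast
    let ?u = "monom 1 1 - pcompose h (monom 1 CHAR('k))"
    have "coeffs_in K ?u"
      by (intro coeffs_in_diff[OF submodule_self[OF K'] K'] coeffs_in_pcompose[OF K' h(2)]
          coeffs_in_monom[OF submodule_self[OF K']] subring_one[OF K'])
    moreover have "poly ?u y = 0" using h(1) by (simp add: poly_pcompose poly_monom)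
    ultimately obtain w where w: "?u = g * w" using minimal_polynomial_divides[OF K' g] by blast
    have "pderiv (monom (1::'k) CHAR('k)) = 0" by (simp add: pderiv_monom)
    then have "pderiv ?u = 1" by (simp add: pderiv_diff pderiv_pcompose pderiv_monom)
    moreover have "pderiv ?u = g * pderiv w" unfolding w pderiv_mult using g' by simp
    ultimately have "g * pderiv w = 1" by simp
    then have "poly (g * pderiv w) y = poly 1 y" by (simp only:)
    then show False using gD(3) by simp
  qed
  then have "rsquarefree g" by (rule minimal_polynomial_rsquarefree[OF K g])
  then show ?thesis unfolding separable_over_def using g by blast
qed

end

section \<open>A polynomial with prescribed ramification\<close>

lemma mult_in_local_square:
  assumes \<pi>: "uniformizer S Q \<pi>" and S: "is_subring S" and Q: "prime_in S Q" and xy: "x \<in> Q" "y \<in> Q"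
  shows "x * y \<in> local_multiples S Q \<pi> Q"
proof -
  note Q' = prime_inD[OF Q]
  obtain s z where s: "s \<in> S - Q" "z \<in> S" "s * x = \<pi> * z" using uniformizer_generates[OF \<pi> S Q xy(1)] by blast
  have "s * (x * y) = \<pi> * (z * y)" using s(3) by (simp add: mult.assoc[symmetric])
  then show ?thesis
    using local_multiplesI[OF subring_mult[OF S subsetD[OF Q'(2) xy(1)] subsetD[OF Q'(2) xy(2)]] s(1)
        submodule_scale[OF Q'(1) s(2) xy(2)]] by blast
qed

text \<open>From \<open>1 = \<alpha> + \<beta>\<close> with \<open>\<alpha>\<close> in one and \<open>\<beta>\<close> in the other maximal ideal,
  expanding the cube separates the squares of the two ideals.\<close>

lemma local_squares_comaximal:
  assumes C: "is_subring C" and M: "maximal_in C M" "uniformizer C M \<pi>"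
    and M': "maximal_in C M'" "uniformizer C M' \<pi>'" and ne: "M \<noteq> M'"
  shows "\<exists>\<epsilon>\<in>C. 1 - \<epsilon> \<in> local_multiples C M \<pi> M \<and> \<epsilon> \<in> local_multiples C M' \<pi>' M'"
proof -
  note mD = maximal_inD[OF M(1)] and mD' = maximal_inD[OF M'(1)]
  have "\<not> M \<subseteq> M'"
  proof
    assume sub: "M \<subseteq> M'"
    then obtain x where x: "x \<in> M'" "x \<notin> M" using ne by blast
    then obtain y where y: "y \<in> C" "1 - x * y \<in> M" using mD(4)[OF subsetD[OF mD'(2) x(1)] x(2)] by blast
    have "(1 - x * y) + x * y \<in> M'"
      by (rule submodule_add[OF mD'(1) subsetD[OF sub y(2)] submodule_scale'[OF mD'(1) y(1) x(1)]])
    then show False using mD'(3) by simp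
  qed
  then obtain x where x: "x \<in> M" "x \<notin> M'" by blast
  then obtain y where y: "y \<in> C" "1 - x * y \<in> M'" using mD'(4)[OF subsetD[OF mD(2) x(1)] x(2)] by blast
  define \<alpha> where "\<alpha> = x * y"
  define \<beta> where "\<beta> = 1 - \<alpha>"
  have \<alpha>: "\<alpha> \<in> M" unfolding \<alpha>_def by (rule submodule_scale'[OF mD(1) y(1) x(1)])
  have \<beta>: "\<beta> \<in> M'" using y(2) unfolding \<beta>_def \<alpha>_def .
  have inC: "\<alpha> \<in> C" "\<beta> \<in> C" using \<alpha> \<beta> mD(2) mD'(2) by blast+
  have unit: "1 + \<alpha> + \<alpha> \<in> C" "1 + \<beta> + \<beta> \<in> C"
    by (rule subring_add[OF C subring_add[OF C subring_one[OF C] inC(1)] inC(1)],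
        rule subring_add[OF C subring_add[OF C subring_one[OF C] inC(2)] inC(2)])
  let ?e = "\<beta> * \<beta> * (1 + \<alpha> + \<alpha>)"
  have "1 - ?e = \<alpha> * \<alpha> * (1 + \<beta> + \<beta>)" unfolding \<beta>_def by (simp add: algebra_simps)
  moreover have "\<alpha> * \<alpha> * (1 + \<beta> + \<beta>) \<in> local_multiples C M \<pi> M"
    by (rule submodule_scale'[OF local_multiples_submodule[OF C maximal_in_prime_in[OF M(1)] mD(1)] unit(2)
          mult_in_local_square[OF M(2) C maximal_in_prime_in[OF M(1)] \<alpha> \<alpha>]])
  moreover have "?e \<in> local_multiples C M' \<pi>' M'"
    by (rule submodule_scale'[OF local_multiples_submodule[OF C maximal_in_prime_in[OF M'(1)] mD'(1)] unit(1)
          mult_in_local_square[OF M'(2) C maximal_in_prime_in[OF M'(1)] \<beta> \<beta>]])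
  moreover have "?e \<in> C" by (rule subring_mult[OF C subring_mult[OF C inC(2) inC(2)] unit(1)])
  ultimately show ?thesis by (intro bexI[of _ ?e]) simp_all
qed

text \<open>The product of elements which separate M from each single ideal of the family separates M from all of them.\<close>

lemma local_squares_idempotent:
  assumes C: "is_subring C" and "finite J" and M: "maximal_in C M" "uniformizer C M \<pi>"
    and MJ: "\<And>j. j \<in> J \<Longrightarrow> maximal_in C (MM j) \<and> uniformizer C (MM j) (\<pi>\<pi> j) \<and> M \<noteq> MM j"
  shows "\<exists>\<epsilon>\<in>C. 1 - \<epsilon> \<in> local_multiples C M \<pi> M \<and> (\<forall>j\<in>J. \<epsilon> \<in> local_multiples C (MM j) (\<pi>\<pi> j) (MM j))"
  using assms(2) MJ
proof (induction J)
  case empty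
  have "1 - 1 \<in> local_multiples C M \<pi> M"
    using submodule_zero[OF local_multiples_submodule[OF C maximal_in_prime_in[OF M(1)] maximal_inD(1)[OF M(1)]]] by simp
  then show ?case using subring_one[OF C] by (intro bexI[of _ 1]) simp_all
next
  case (insert j J)
  have "\<exists>\<epsilon>\<in>C. 1 - \<epsilon> \<in> local_multiples C M \<pi> M \<and> (\<forall>j\<in>J. \<epsilon> \<in> local_multiples C (MM j) (\<pi>\<pi> j) (MM j))"
    by (rule insert.IH) (rule insert.prems, simp)
  then obtain \<epsilon> where e: "\<epsilon> \<in> C" "1 - \<epsilon> \<in> local_multiples C M \<pi> M"
    "\<forall>j\<in>J. \<epsilon> \<in> local_multiples C (MM j) (\<pi>\<pi> j) (MM j)" by blast
  have j: "maximal_in C (MM j)" "uniformizer C (MM j) (\<pi>\<pi> j)" "M \<noteq> MM j" using insert.prems[of j] by auto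
  obtain \<delta> where d: "\<delta> \<in> C" "1 - \<delta> \<in> local_multiples C M \<pi> M" "\<delta> \<in> local_multiples C (MM j) (\<pi>\<pi> j) (MM j)"
    using local_squares_comaximal[OF C M j] by blast
  have sub: "submodule_over C (local_multiples C M \<pi> M)"
    by (rule local_multiples_submodule[OF C maximal_in_prime_in[OF M(1)] maximal_inD(1)[OF M(1)]])
  have subj: "submodule_over C (local_multiples C (MM i) (\<pi>\<pi> i) (MM i))" if "i \<in> insert j J" for i
  proof -
    have mi: "maximal_in C (MM i)" using insert.prems[OF that] by simp
    show ?thesis by (rule local_multiples_submodule[OF C maximal_in_prime_in[OF mi] maximal_inD(1)[OF mi]])
  qed
  have "(1 - \<epsilon>) + \<epsilon> * (1 - \<delta>) \<in> local_multiples C M \<pi> M"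
    by (rule submodule_add[OF sub e(2) submodule_scale[OF sub e(1) d(2)]])
  then have "1 - \<epsilon> * \<delta> \<in> local_multiples C M \<pi> M" by (simp add: algebra_simps)
  moreover have "\<epsilon> * \<delta> \<in> local_multiples C (MM i) (\<pi>\<pi> i) (MM i)" if i: "i \<in> insert j J" for i
  proof (cases "i = j")
    case True
    show ?thesis unfolding True by (rule submodule_scale[OF subj e(1) d(3)]) simp
  next
    case False
    then have "\<epsilon> \<in> local_multiples C (MM i) (\<pi>\<pi> i) (MM i)" using i e(3) by simp
    then show ?thesis by (rule submodule_scale'[OF subj[OF i] d(1)])
  qed
  ultimately show ?case using subring_mult[OF C e(1) d(1)] by (intro bexI[of _ "\<epsilon> * \<delta>"]) simp_all
qed

text \<open>A monic polynomial of degree e over C whose reduction modulo M is separable, whatever the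
  characteristic of the residue field is.\<close>

definition separable_poly :: "'k::field set \<Rightarrow> nat \<Rightarrow> 'k poly" where
  "separable_poly M e = (if of_nat e \<in> M then monom 1 e - monom 1 1 else monom 1 e - 1)"

lemma separable_poly_coeffs: "is_subring C \<Longrightarrow> coeffs_in C (separable_poly M e)"
  unfolding separable_poly_def
  by (auto intro!: coeffs_in_diff[OF submodule_self] coeffs_in_monom[OF submodule_self] coeffs_in_1 subring_one)

lemma separable_poly_monic:
  assumes "1 \<notin> M" "e > 0"
  shows "degree (separable_poly M e) = e" "lead_coeff (separable_poly M e) = 1"
proof -
  have c: "coeff (separable_poly M e) i = (if i = e then 1 else 0)" if "i \<ge> e" for i
  proof (cases "of_nat e \<in> M")
    case True
    then have "e \<noteq> 1" using assms(1) by auto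
    then show ?thesis using that assms(2) True by (auto simp: separable_poly_def)
  next
    case False
    then show ?thesis using that assms(2) by (auto simp: separable_poly_def)
  qed
  show deg: "degree (separable_poly M e) = e"
  proof (rule antisym)
    show "degree (separable_poly M e) \<le> e" using c by (intro degree_le) auto
    show "e \<le> degree (separable_poly M e)" using c[of e] by (intro le_degree) simp
  qed
  show "lead_coeff (separable_poly M e) = 1" unfolding deg using c[of e] by simp
qed

lemma separable_poly_pderiv:
  assumes S: "is_subring S" and Q: "prime_in S Q" and t: "t \<in> S" and M: "Q \<inter> C = M" "is_subring C"
    and e: "e > 0" and root: "poly (separable_poly M e) t \<in> Q"
  shows "poly (pderiv (separable_poly M e)) t \<notin> Q"
proof
  assume d: "poly (pderiv (separable_poly M e)) t \<in> Q"
  note Q' = prime_inD[OF Q]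
  have tp: "t ^ k \<in> S" for k by (rule subring_power[OF S t])
  show False
  proof (cases "of_nat e \<in> M")
    case True
    then have "of_nat e \<in> Q" using M(1) by blast
    then have "of_nat e * t ^ (e - 1) \<in> Q" by (rule submodule_scale'[OF Q'(1) tp])
    moreover have "of_nat e * t ^ (e - 1) - 1 \<in> Q"
      using d True by (simp add: separable_poly_def pderiv_diff pderiv_monom poly_monom)
    ultimately have "of_nat e * t ^ (e - 1) - (of_nat e * t ^ (e - 1) - 1) \<in> Q" by (rule submodule_diff[OF Q'(1) S])
    then show False using Q'(3) by simp
  next
    case False
    then have "of_nat e \<notin> Q" using M(1) subring_of_nat[OF M(2), of e] by blast
    moreover have "of_nat e * t ^ (e - 1) \<in> Q"
      using d False by (simp add: separable_poly_def pderiv_diff pderiv_monom poly_monom)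
    ultimately have "t ^ (e - 1) \<in> Q" using Q'(4)[OF subring_of_nat[OF S] tp] by blast
    then have "t ^ (e - 1) * t \<in> Q" by (rule submodule_scale'[OF Q'(1) t])
    then have "t ^ e \<in> Q" using e by (simp flip: power_Suc2)
    moreover have "t ^ e - 1 \<in> Q" using root False by (simp add: separable_poly_def poly_monom)
    ultimately have "t ^ e - (t ^ e - 1) \<in> Q" by (rule submodule_diff[OF Q'(1) S])
    then show False using Q'(3) by simp
  qed
qed

text \<open>The prescribed polynomials are monic of the same degree D, so they can be glued by a partition of unity
  without changing the leading term. The powers of a from the second on are negligible at all places; there are infinitely
  many of them, which leaves room for making the polynomial squarefree.\<close>

lemma ramified_polynomial_exists:
  fixes C :: "'k::field set" and M :: "'i \<Rightarrow> 'k set" and e d :: "'i \<Rightarrow> nat"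
  assumes C: "is_subring C" and J: "finite J" "inj_on M J"
    and M: "\<And>j. j \<in> J \<Longrightarrow> maximal_in C (M j) \<and> uniformizer C (M j) (\<pi> j)"
    and e: "\<And>j. j \<in> J \<Longrightarrow> 0 < e j \<and> 0 < d j \<and> e j * d j = D" and D: "D > 0"
    and a: "\<And>j. j \<in> J \<Longrightarrow> a \<in> M j" "a \<in> C" "a \<noteq> 0" "\<And>m. m > 0 \<Longrightarrow> a ^ m \<noteq> 1"
  shows "\<exists>f. coeffs_in C f \<and> degree f = D \<and> lead_coeff f = 1 \<and> rsquarefree f \<and>
    (\<forall>j\<in>J. coeffs_in (local_multiples C (M j) (\<pi> j) (M j)) (f - (separable_poly (M j) (e j) ^ d j + [:\<pi> j:])))"
proof -
  let ?L = "\<lambda>j. local_multiples C (M j) (\<pi> j) (M j)"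
  note C' = submodule_self[OF C]
  have mx: "maximal_in C (M j)" and un: "uniformizer C (M j) (\<pi> j)" if "j \<in> J" for j using M[OF that] by auto
  have L: "submodule_over C (?L j)" if "j \<in> J" for j
    by (rule local_multiples_submodule[OF C maximal_in_prime_in[OF mx[OF that]] maximal_inD(1)[OF mx[OF that]]])
  have "\<forall>j\<in>J. \<exists>\<epsilon>. \<epsilon> \<in> C \<and> 1 - \<epsilon> \<in> ?L j \<and> (\<forall>i\<in>J - {j}. \<epsilon> \<in> ?L i)"
  proof
    fix j assume j: "j \<in> J"
    have "\<exists>\<epsilon>\<in>C. 1 - \<epsilon> \<in> ?L j \<and> (\<forall>i\<in>J - {j}. \<epsilon> \<in> ?L i)"
      by (rule local_squares_idempotent[OF C _ mx[OF j] un[OF j]])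
        (use J j mx un in \<open>auto dest: inj_onD\<close>)
    then show "\<exists>\<epsilon>. \<epsilon> \<in> C \<and> 1 - \<epsilon> \<in> ?L j \<and> (\<forall>i\<in>J - {j}. \<epsilon> \<in> ?L i)" by blast
  qed
  then obtain \<epsilon> where \<epsilon>: "\<forall>j\<in>J. \<epsilon> j \<in> C \<and> 1 - \<epsilon> j \<in> ?L j \<and> (\<forall>i\<in>J - {j}. \<epsilon> j \<in> ?L i)" by (rule bchoice[THEN exE])
  define F where "F j = separable_poly (M j) (e j) ^ d j + [:\<pi> j:]" for j
  define H where "H j = F j - monom 1 D" for j
  have FC: "coeffs_in C (F j)" if "j \<in> J" for j
  proof -
    have "\<pi> j \<in> C" using un[OF that] maximal_inD(2)[OF mx[OF that]] unfolding uniformizer_def by blast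
    then show ?thesis unfolding F_def
      by (intro coeffs_in_add[OF C'] coeffs_in_power[OF C] separable_poly_coeffs[OF C] coeffs_in_const[OF C'])
  qed
  have HC: "coeffs_in C (H j)" if "j \<in> J" for j
    unfolding H_def by (intro coeffs_in_diff[OF C' C] FC[OF that] coeffs_in_monom[OF C'] subring_one[OF C])
  have Hhigh: "coeff (H j) i = 0" if j: "j \<in> J" and i: "i \<ge> D" for j i
  proof -
    let ?h = "separable_poly (M j) (e j)"
    have h: "degree ?h = e j" "lead_coeff ?h = 1"
      using separable_poly_monic[of "M j" "e j"] maximal_inD(3)[OF mx[OF j]] e[OF j] by auto
    have h0: "?h \<noteq> 0" using h(2) by auto
    have deg: "degree (?h ^ d j) = D" using degree_power_eq[OF h0, of "d j"] h(1) e[OF j] by (simp add: mult.commute)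
    have lead: "coeff (?h ^ d j) D = 1" using lead_coeff_power[of ?h "d j"] h(2) unfolding deg by simp
    show ?thesis
    proof (cases "i = D")
      case True
      then show ?thesis using lead D by (simp add: H_def F_def coeff_pCons split: nat.splits)
    next
      case False
      then have "i > D" using i by simp
      then have "coeff (?h ^ d j) i = 0" using deg by (simp add: coeff_eq_0)
      then show ?thesis using \<open>i > D\<close> by (simp add: H_def F_def coeff_pCons split: nat.splits)
    qed
  qed
  define f0 where "f0 = monom 1 D + (\<Sum>j\<in>J. smult (\<epsilon> j) (H j))"
  have f0C: "coeffs_in C f0"
    unfolding f0_def using \<epsilon>
    by (intro coeffs_in_add[OF C'] coeffs_in_sum[OF C'] coeffs_in_smult[OF C'] HC coeffs_in_monom[OF C'] subring_one[OF C]) auto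
  have f0high: "coeff f0 i = (if i = D then 1 else 0)" if "i \<ge> D" for i
    unfolding f0_def using Hhigh that by (simp add: coeff_sum)
  have f0near: "coeffs_in (?L i) (f0 - F i)" if i: "i \<in> J" for i
  proof -
    have "(\<Sum>j\<in>J. smult (\<epsilon> j) (H j)) = smult (\<epsilon> i) (H i) + (\<Sum>j\<in>J - {i}. smult (\<epsilon> j) (H j))"
      by (rule sum.remove[OF J(1) i])
    then have "f0 - F i = smult (- (1 - \<epsilon> i)) (H i) + (\<Sum>j\<in>J - {i}. smult (\<epsilon> j) (H j))"
      unfolding f0_def by (simp add: H_def algebra_simps smult_diff_left smult_diff_right)
    moreover have smult: "coeffs_in (?L i) (smult x p)" if "x \<in> ?L i" "coeffs_in C p" for x p
      using that submodule_scale'[OF L[OF i]] by (simp add: coeffs_in_def)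
    have "coeffs_in (?L i) (smult (- (1 - \<epsilon> i)) (H i))"
      using \<epsilon> i by (intro smult HC[OF i] submodule_uminus[OF L[OF i] C]) blast
    moreover have "coeffs_in (?L i) (\<Sum>j\<in>J - {i}. smult (\<epsilon> j) (H j))"
      using \<epsilon> i by (intro coeffs_in_sum[OF L[OF i]] smult HC) blast+
    ultimately show ?thesis using coeffs_in_add[OF L[OF i]] by metis
  qed
  have apow: "a ^ k \<in> ?L j" if j: "j \<in> J" and k: "k \<ge> 2" for j k
  proof -
    obtain l where l: "k = 2 + l" using k le_Suc_ex by blast
    have eq: "a ^ k = a * a * a ^ l" by (simp add: l power_add power2_eq_square mult.assoc)
    show ?thesis unfolding eq
      by (rule submodule_scale'[OF L[OF j] subring_power[OF C a(2)]
            mult_in_local_square[OF un[OF j] C maximal_in_prime_in[OF mx[OF j]] a(1)[OF j] a(1)[OF j]]])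
  qed
  \<comment> \<open>Adding a multiple of X makes the derivative nonzero; then only finitely many constants
    produce a multiple root.\<close>
  define f1 where "f1 = (if pderiv f0 = 0 then f0 + monom (a ^ 2) 1 else f0)"
  have f1: "pderiv f1 \<noteq> 0 \<and> coeffs_in C f1 \<and> (\<forall>i\<ge>D. coeff f1 i = (if i = D then 1 else 0)) \<and>
    (\<forall>j\<in>J. coeffs_in (?L j) (f1 - F j))"
  proof (cases "pderiv f0 = 0")
    case False
    then show ?thesis using f0C f0high f0near by (simp add: f1_def)
  next
    case True
    have "D \<noteq> 1"
    proof
      assume "D = 1"
      then have "coeff (pderiv f0) 0 = 1" using f0high[of 1] by (simp add: coeff_pderiv)
      then show False using True by simp
    qed
    then have "D > 1" using D by simp
    then have "\<forall>i\<ge>D. coeff f1 i = (if i = D then 1 else 0)" using f0high True by (simp add: f1_def)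
    moreover have "pderiv f1 = monom (a ^ 2) 0"
      using True by (simp add: f1_def pderiv_add pderiv_monom)
    then have "pderiv f1 \<noteq> 0" using a(3) by simp
    moreover have "coeffs_in C f1"
      using True f0C by (simp add: f1_def coeffs_in_add[OF C'] coeffs_in_monom[OF C'] subring_power[OF C a(2)])
    moreover have "coeffs_in (?L j) (f1 - F j)" if j: "j \<in> J" for j
    proof -
      have eq: "f1 - F j = (f0 - F j) + monom (a ^ 2) 1" using True by (simp add: f1_def)
      show ?thesis unfolding eq
        by (rule coeffs_in_add[OF L[OF j] f0near[OF j] coeffs_in_monom[OF L[OF j] apow[OF j order_refl]]])
    qed
    ultimately show ?thesis by blast
  qed
  define bad where "bad = (\<lambda>x. - poly f1 x) ` {x. poly (pderiv f1) x = 0}"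
  have "finite bad" unfolding bad_def using f1 poly_roots_finite by blast
  moreover have "infinite ((\<lambda>k. a ^ k) ` {2..})"
  proof
    assume fin: "finite ((\<lambda>k. a ^ k) ` {2..})"
    have "inj_on (\<lambda>k. a ^ k) {2..}"
    proof (rule linorder_inj_onI)
      fix k l :: nat assume "k < l"
      then obtain m where m: "l = k + Suc m" using less_imp_Suc_add[of k l] by auto
      show "a ^ k \<noteq> a ^ l"
      proof
        assume "a ^ k = a ^ l"
        then have "a ^ k * 1 = a ^ k * a ^ Suc m" unfolding m power_add by simp
        then have "1 = a ^ Suc m" by (rule mult_left_cancel[OF power_not_zero[OF a(3)], THEN iffD1])
        then show False using a(4)[of "Suc m"] by simp
      qed
    qed (rule linear)
    then have "finite {2::nat..}" using finite_imageD[OF fin] by blast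
    then show False using infinite_Ici by blast
  qed
  ultimately have "\<not> (\<lambda>k. a ^ k) ` {2..} \<subseteq> bad" using finite_subset by blast
  then obtain z where z: "z \<in> (\<lambda>k. a ^ k) ` {2..}" "z \<notin> bad" by (meson subsetI)
  from z(1) obtain k where zk: "z = a ^ k" "k \<in> {2..}" by (rule imageE)
  have k: "k \<ge> 2" and kbad: "a ^ k \<notin> bad" using zk z(2) by simp_all
  define f where "f = f1 + [:a ^ k:]"
  have fhigh: "coeff f i = (if i = D then 1 else 0)" if "i \<ge> D" for i
  proof -
    have "i \<noteq> 0" using that D by auto
    then have "coeff [:a ^ k:] i = 0" by (cases i) simp_all
    moreover have "coeff f1 i = (if i = D then 1 else 0)" using f1 that by blast
    ultimately show ?thesis by (simp add: f_def)
  qed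
  have deg: "degree f = D"
  proof (rule antisym)
    show "degree f \<le> D" using fhigh by (intro degree_le) auto
    show "D \<le> degree f" using fhigh[of D] by (intro le_degree) simp
  qed
  have "rsquarefree f"
  proof (rule rsquarefreeI)
    show "f \<noteq> 0" using deg D by auto
    fix x assume x: "poly f x = 0"
    have "a ^ k = - poly f1 x" using x by (simp add: f_def eq_neg_iff_add_eq_0 add.commute)
    then have "poly (pderiv f1) x \<noteq> 0" using kbad unfolding bad_def by blast
    then show "poly (pderiv f) x \<noteq> 0" by (simp add: f_def pderiv_add)
  qed
  moreover have "coeffs_in C f"
    unfolding f_def using f1 by (intro coeffs_in_add[OF C'] coeffs_in_const[OF C'] subring_power[OF C a(2)]) blast
  moreover have "lead_coeff f = 1" unfolding deg using fhigh[of D] by simp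
  moreover have "coeffs_in (?L j) (f - F j)" if j: "j \<in> J" for j
  proof -
    have eq: "f - F j = (f1 - F j) + [:a ^ k:]" by (simp add: f_def)
    have "coeffs_in (?L j) (f1 - F j)" using f1 j by blast
    then show ?thesis unfolding eq
      by (rule coeffs_in_add[OF L[OF j] _ coeffs_in_const[OF L[OF j] apow[OF j k]]])
  qed
  ultimately show ?thesis using deg unfolding F_def by blast
qed

text \<open>Let g be a monic polynomial of least degree over C with g(t) in Q; modulo M it generates the
  kernel of the map to the residue field of Q. It divides the separable polynomial h modulo M, and
  the cofactor does not vanish at t, so that Q is generated locally by h(t) and M. Since f(t) = 0, the
  uniformizer of M is up to a unit the power \<open>h(t) ^ d\<close>, hence h(t) alone generates.\<close>

lemma uniformizer_adjoin:
  assumes C: "is_subring C" and M: "maximal_in C M" "uniformizer C M \<pi>" and e: "e > 0" and d: "d > 0"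
    and near: "coeffs_in (local_multiples C M \<pi> M) (f - (separable_poly M e ^ d + [:\<pi>:]))" and root: "poly f t = 0"
    and mult: "\<And>x. x \<in> adjoin C t \<Longrightarrow> x \<noteq> 0 \<Longrightarrow> \<exists>y\<in>adjoin C t. x * y \<in> C \<and> x * y \<noteq> 0"
    and Q: "prime_in (adjoin C t) Q" "Q \<inter> C = M"
  shows "uniformizer (adjoin C t) Q (poly (separable_poly M e) t)"
    and "\<exists>u\<in>adjoin C t - Q. \<exists>s\<in>adjoin C t - Q. u * \<pi> = poly (separable_poly M e) t ^ d * s"
proof -
  let ?S = "adjoin C t" let ?h = "separable_poly M e" let ?\<tau> = "poly (separable_poly M e) t"
  have S: "is_subring ?S" and CS: "C \<subseteq> ?S" and tS: "t \<in> ?S"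
    using adjoin_subring[OF C] adjoin_superset[OF C] adjoin_self[OF C] by auto
  note S' = submodule_self[OF S] and C' = submodule_self[OF C]
  note Q' = prime_inD[OF Q(1)] and M' = maximal_inD[OF M(1)]
  have MQ: "M \<subseteq> Q" using Q(2) by blast
  have CM: "s \<in> ?S - Q" if "s \<in> C - M" for s using that CS Q(2) by blast
  have evalC: "poly p t \<in> ?S" if "coeffs_in C p" for p
    by (rule poly_in_subring[OF S coeffs_in_mono[OF that CS] tS])
  have evalM: "poly p t \<in> Q" if "coeffs_in M p" for p
    by (rule poly_in[OF Q'(1) S coeffs_in_mono[OF that MQ] tS])
  have hC: "coeffs_in C ?h" by (rule separable_poly_coeffs[OF C])
  have hmonic: "lead_coeff ?h = 1" by (rule separable_poly_monic(2)[OF M'(3) e])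
  have \<pi>: "\<pi> \<in> M" "\<pi> \<noteq> 0" using M(2) unfolding uniformizer_def by auto
  let ?r = "f - (?h ^ d + [:\<pi>:])"
  have "poly ?r t \<in> local_multiples ?S Q \<pi> Q"
    by (rule poly_in[OF local_multiples_submodule[OF S Q(1) Q'(1)] S
          coeffs_in_mono[OF near local_multiples_mono[OF CS Q(2) MQ]] tS])
  then obtain s m where s: "s \<in> ?S - Q" "m \<in> Q" "s * poly ?r t = \<pi> * m" by (rule local_multiplesE)
  have "poly ?r t = - (?\<tau> ^ d + \<pi>)" using root by simp
  then have sm: "\<pi> * m = s * (- (?\<tau> ^ d + \<pi>))" using s(3) by simp
  have "(- (s + m)) * \<pi> = - (s * \<pi>) - \<pi> * m" by (simp add: algebra_simps)
  also have "\<dots> = ?\<tau> ^ d * s" unfolding sm by (simp add: algebra_simps)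
  finally have eq: "(- (s + m)) * \<pi> = ?\<tau> ^ d * s" .
  have u: "- (s + m) \<in> ?S - Q"
  proof
    show "- (s + m) \<in> ?S"
      by (rule subring_uminus[OF S subring_add[OF S DiffD1[OF s(1)] subsetD[OF Q'(2) s(2)]]])
    show "- (s + m) \<notin> Q"
    proof
      assume "- (s + m) \<in> Q"
      then have "- (- (s + m)) - m \<in> Q" using submodule_diff[OF Q'(1) S submodule_uminus[OF Q'(1) S] s(2)] by blast
      then show False using s(1) by simp
    qed
  qed
  show ramification: "\<exists>u\<in>?S - Q. \<exists>s\<in>?S - Q. u * \<pi> = ?\<tau> ^ d * s"
    by (rule bexI[OF _ u], rule bexI[OF _ s(1)], rule eq)
  have \<tau>S: "?\<tau> \<in> ?S" by (rule evalC[OF hC])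
  have \<tau>Q: "?\<tau> \<in> Q"
  proof (rule ccontr)
    assume "?\<tau> \<notin> Q"
    then have "?\<tau> ^ d * s \<in> ?S - Q"
      using \<tau>S by (intro prime_in_compl_mult[OF Q(1) S prime_in_compl_power[OF Q(1) S] s(1)]) simp
    moreover have "(- (s + m)) * \<pi> \<in> Q"
      by (rule submodule_scale[OF Q'(1) DiffD1[OF u] subsetD[OF MQ \<pi>(1)]])
    ultimately show False unfolding eq by simp
  qed
  have \<tau>0: "?\<tau> \<noteq> 0"
  proof
    assume "?\<tau> = 0"
    then have "(- (s + m)) * \<pi> = 0" unfolding eq using d by simp
    then have "- (s + m) = 0" using \<pi>(2) by (simp only: mult_eq_0_iff simp_thms)
    then show False using u submodule_zero[OF Q'(1)] by simp
  qed
  let ?P = "\<lambda>g. lead_coeff g = 1 \<and> coeffs_in C g \<and> poly g t \<in> Q"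
  have "?P ?h" using hmonic hC \<tau>Q by simp
  from ex_has_least_nat[of ?P, OF this, of degree]
  obtain g where g: "lead_coeff g = 1" "coeffs_in C g" "poly g t \<in> Q" and least: "\<And>g'. ?P g' \<Longrightarrow> degree g \<le> degree g'"
    by blast
  \<comment> \<open>A polynomial over C of degree below that of g which vanishes at t modulo Q has all coefficients in M: a leading
    coefficient outside M would be invertible modulo M, against the choice of g.\<close>
  have residue: "coeffs_in M r" if "coeffs_in C r" "poly r t \<in> Q" "\<forall>i\<ge>N. coeff r i = 0" "N \<le> degree g" for r N
    using that
  proof (induction N arbitrary: r)
    case 0
    then have "r = 0" by (intro poly_eqI) simp
    then show ?case using coeffs_in_0[OF M'(1)] by simp
  next
    case (Suc N)
    let ?l = "coeff r N"
    have lC: "?l \<in> C" by (rule coeffs_inD[OF Suc.prems(1)])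
    have tN: "t ^ N \<in> ?S" by (rule subring_power[OF S tS])
    have "?l \<in> M"
    proof (rule ccontr)
      assume "?l \<notin> M"
      then obtain y where y: "y \<in> C" "1 - ?l * y \<in> M" using M'(4)[OF lC] by blast
      define g' where "g' = smult y r + monom (1 - ?l * y) N"
      have "coeffs_in C g'" unfolding g'_def
        by (intro coeffs_in_add[OF C'] coeffs_in_smult[OF C' y(1) Suc.prems(1)] coeffs_in_monom[OF C'] subsetD[OF M'(2) y(2)])
      moreover have "poly g' t \<in> Q"
      proof -
        have "y * poly r t + (1 - ?l * y) * t ^ N \<in> Q"
          by (rule submodule_add[OF Q'(1) submodule_scale[OF Q'(1) subsetD[OF CS y(1)] Suc.prems(2)]
                submodule_scale'[OF Q'(1) tN subsetD[OF MQ y(2)]]])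
        then show ?thesis by (simp add: g'_def poly_monom)
      qed
      moreover have gN: "coeff g' i = (if i = N then 1 else 0)" if "i \<ge> N" for i
        using that Suc.prems(3) by (auto simp: g'_def algebra_simps)
      have deg: "degree g' = N"
      proof (rule antisym)
        show "degree g' \<le> N" using gN by (intro degree_le) auto
        show "N \<le> degree g'" using gN[of N] by (intro le_degree) simp
      qed
      moreover have "lead_coeff g' = 1" unfolding deg using gN[of N] by simp
      ultimately have "degree g \<le> N" using least[of g'] by simp
      then show False using Suc.prems(4) by simp
    qed
    let ?r' = "r - monom ?l N"
    have 1: "coeffs_in C ?r'" by (intro coeffs_in_diff[OF C' C Suc.prems(1)] coeffs_in_monom[OF C' lC])
    have "poly r t - ?l * t ^ N \<in> Q"
      by (rule submodule_diff[OF Q'(1) S Suc.prems(2) submodule_scale'[OF Q'(1) tN subsetD[OF MQ \<open>?l \<in> M\<close>]]])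
    then have 2: "poly ?r' t \<in> Q" by (simp add: poly_monom)
    have 3: "\<forall>i\<ge>N. coeff ?r' i = 0"
    proof (intro allI impI)
      fix i assume i: "N \<le> i"
      show "coeff ?r' i = 0"
      proof (cases "i = N")
        case False
        then have "coeff r i = 0" using Suc.prems(3) i by simp
        then show ?thesis using False by simp
      qed simp
    qed
    have "coeffs_in M ?r'" by (rule Suc.IH[OF 1 2 3 Suc_leD[OF Suc.prems(4)]])
    from coeffs_in_add[OF M'(1) this coeffs_in_monom[OF M'(1) \<open>?l \<in> M\<close>, of N]] show ?case by simp
  qed
  have division: "\<exists>v r. coeffs_in C v \<and> coeffs_in M r \<and> p = g * v + r" if p: "coeffs_in C p" "poly p t \<in> Q" for p
  proof -
    obtain v r where vr: "coeffs_in C v" "coeffs_in C r" "p = g * v + r" "\<forall>i\<ge>degree g. coeff r i = 0"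
      using monic_division[OF C g(2,1) p(1)] by blast
    have "poly p t - poly g t * poly v t \<in> Q"
      by (rule submodule_diff[OF Q'(1) S p(2) submodule_scale'[OF Q'(1) evalC[OF vr(1)] g(3)]])
    then have "poly r t \<in> Q" by (simp add: vr(3))
    then have "coeffs_in M r" using residue[OF vr(2) _ vr(4)] by simp
    then show ?thesis using vr(1,3) by blast
  qed
  obtain w r0 where w: "coeffs_in C w" "coeffs_in M r0" "?h = g * w + r0" using division[OF hC \<tau>Q] by blast
  have wQ: "poly w t \<notin> Q"
  proof
    assume wt: "poly w t \<in> Q"
    have "poly g t * poly (pderiv w) t + poly w t * poly (pderiv g) t + poly (pderiv r0) t \<in> Q"
      by (intro submodule_add[OF Q'(1)] submodule_scale'[OF Q'(1) evalC[OF coeffs_in_pderiv[OF C C' w(1)]] g(3)]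
          submodule_scale'[OF Q'(1) evalC[OF coeffs_in_pderiv[OF C C' g(2)]] wt] evalM[OF coeffs_in_pderiv[OF C M'(1) w(2)]])
    moreover have "poly (pderiv ?h) t = poly g t * poly (pderiv w) t + poly w t * poly (pderiv g) t + poly (pderiv r0) t"
      unfolding w(3) by (simp add: pderiv_add pderiv_mult)
    ultimately have "poly (pderiv ?h) t \<in> Q" by simp
    then show False using separable_poly_pderiv[OF S Q(1) tS Q(2) C e \<tau>Q] by blast
  qed
  have wS: "poly w t \<in> ?S - Q" using evalC[OF w(1)] wQ by simp
  let ?T = "local_multiples ?S Q ?\<tau> ?S"
  have T: "submodule_over ?S ?T" by (rule local_multiples_submodule[OF S Q(1) S'])
  have MT: "M \<subseteq> ?T"
  proof
    fix x assume x: "x \<in> M"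
    obtain s1 y where y: "s1 \<in> C - M" "y \<in> C" "s1 * x = \<pi> * y"
      using uniformizer_generates[OF M(2) C maximal_in_prime_in[OF M(1)] x] by blast
    obtain d' where d': "d = Suc d'" using d by (cases d) auto
    have "(- (s + m) * s1) * x = (- (s + m) * \<pi>) * y" using y(3) by (simp only: mult.assoc)
    also have "\<dots> = ?\<tau> * (?\<tau> ^ d' * s * y)" unfolding eq d' by (simp only: power_Suc mult.assoc)
    finally have "(- (s + m) * s1) * x = ?\<tau> * (?\<tau> ^ d' * s * y)" .
    moreover have "?\<tau> ^ d' * s * y \<in> ?S"
      by (rule subring_mult[OF S subring_mult[OF S subring_power[OF S \<tau>S] DiffD1[OF s(1)]] subsetD[OF CS y(2)]])
    ultimately show "x \<in> ?T"
      by (rule local_multiplesI[OF subsetD[OF CS subsetD[OF M'(2) x]] prime_in_compl_mult[OF Q(1) S u CM[OF y(1)]], rotated])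
  qed
  have evalT: "poly p t \<in> ?T" if "coeffs_in M p" for p
    by (rule poly_in[OF T S coeffs_in_mono[OF that MT] tS])
  show "uniformizer ?S Q ?\<tau>"
  proof (rule uniformizerI[OF S Q(1) \<tau>Q \<tau>0])
    fix x assume x: "x \<in> Q"
    then obtain p where p: "x = poly p t" "coeffs_in C p" using Q'(2) unfolding adjoin_def by blast
    obtain v r where v: "coeffs_in C v" "coeffs_in M r" "p = g * v + r" using division[OF p(2)] x p(1) by blast
    let ?z = "poly w t * poly r t - poly r0 t * poly v t"
    have "?z \<in> ?T"
      by (rule submodule_diff[OF T S submodule_scale[OF T evalC[OF w(1)] evalT[OF v(2)]]
            submodule_scale'[OF T evalC[OF v(1)] evalT[OF w(2)]]])
    then obtain s2 y where y: "s2 \<in> ?S - Q" "y \<in> ?S" "s2 * ?z = ?\<tau> * y" by (rule local_multiplesE)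
    have "poly w t * x = ?\<tau> * poly v t + ?z" unfolding p(1) v(3) w(3) by (simp add: algebra_simps)
    then have "(s2 * poly w t) * x = s2 * (?\<tau> * poly v t) + s2 * ?z" by (simp only: mult.assoc distrib_left)
    also have "\<dots> = ?\<tau> * (s2 * poly v t + y)" unfolding y(3) by (simp add: algebra_simps)
    finally have "(s2 * poly w t) * x = ?\<tau> * (s2 * poly v t + y)" .
    moreover have "s2 * poly v t + y \<in> ?S"
      by (rule subring_add[OF S subring_mult[OF S DiffD1[OF y(1)] evalC[OF v(1)]] y(2)])
    ultimately show "\<exists>s\<in>?S - Q. \<exists>y\<in>?S. s * x = ?\<tau> * y"
      using prime_in_compl_mult[OF Q(1) S y(1) wS] by blast
  next
    fix x assume x: "x \<in> ?S" "x \<noteq> 0"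
    obtain y where y: "y \<in> ?S" "x * y \<in> C" "x * y \<noteq> 0" using mult[OF x] by blast
    obtain k s1 v where k: "s1 \<in> C - M" "v \<in> C - M" "s1 * (x * y) = \<pi> ^ k * v" using uniformizerE[OF M(2) y(2,3)] .
    let ?u = "- (s + m)"
    have "x * (y * (?u ^ k * s1)) = ?u ^ k * (s1 * (x * y))" by (simp only: mult_ac)
    also have "\<dots> = (?u * \<pi>) ^ k * v" unfolding k(3) power_mult_distrib by (simp only: mult_ac)
    also have "\<dots> = ?\<tau> ^ (d * k) * (s ^ k * v)" unfolding eq power_mult_distrib power_mult by (simp only: mult_ac)
    finally have "x * (y * (?u ^ k * s1)) = ?\<tau> ^ (d * k) * (s ^ k * v)" .
    moreover have "y * (?u ^ k * s1) \<in> ?S"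
      by (rule subring_mult[OF S y(1) subring_mult[OF S subring_power[OF S DiffD1[OF u]] DiffD1[OF CM[OF k(1)]]]])
    moreover have "s ^ k * v \<in> ?S - Q"
      by (rule prime_in_compl_mult[OF Q(1) S prime_in_compl_power[OF Q(1) S s(1)] CM[OF k(2)]])
    ultimately show "\<exists>y\<in>?S. \<exists>w\<in>?S - Q. \<exists>m. x * y = ?\<tau> ^ m * w" by blast
  qed
qed

section \<open>Subrings as rings with carrier\<close>

lemma is_subring_of_domain:
  fixes S :: "'k::field set"
  assumes "domain (ring_on S)"
  shows "is_subring S"
proof -
  interpret domain "ring_on S" by (rule assms)
  have uminus: "- x \<in> S" if x: "x \<in> S" for x
  proof -
    have "\<ominus>\<^bsub>ring_on S\<^esub> x \<in> S" using a_inv_closed[of x] x by simp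
    moreover have "x + \<ominus>\<^bsub>ring_on S\<^esub> x = 0" using r_neg[of x] x by simp
    then have "\<ominus>\<^bsub>ring_on S\<^esub> x = - x" by (simp add: add_eq_0_iff)
    ultimately show ?thesis by simp
  qed
  show ?thesis unfolding is_subring_def
    using one_closed uminus a_closed m_closed by simp
qed

lemma ring_on_domain:
  assumes S: "is_subring (S :: 'k::field set)"
  shows "domain (ring_on S)"
proof (rule domainI)
  show "cring (ring_on S)"
  proof (rule cringI)
    show "abelian_group (ring_on S)"
    proof (rule abelian_groupI)
      fix x assume "x \<in> carrier (ring_on S)"
      then show "\<exists>y\<in>carrier (ring_on S). y \<oplus>\<^bsub>ring_on S\<^esub> x = \<zero>\<^bsub>ring_on S\<^esub>"
        using subring_uminus[OF S] by (intro bexI[of _ "- x"]) simp_all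
    qed (use S in \<open>simp_all add: subring_closed add_ac\<close>)
    show "comm_monoid (ring_on S)"
      by (rule comm_monoidI) (use S in \<open>simp_all add: subring_closed mult_ac\<close>)
  qed (simp add: distrib_right)
qed simp_all

lemma ring_on_cring: "is_subring S \<Longrightarrow> cring (ring_on S)"
  using ring_on_domain by (rule domain.axioms(1))

lemma ring_on_ring: "is_subring S \<Longrightarrow> ring (ring_on S)"
  using ring_on_cring by (rule cring.axioms(1))

lemma ideal_ring_on_iff:
  assumes S: "is_subring (S :: 'k::field set)"
  shows "ideal J (ring_on S) \<longleftrightarrow> submodule_over S J \<and> J \<subseteq> S"
proof
  assume "ideal J (ring_on S)"
  then interpret ideal J "ring_on S" .
  show "submodule_over S J \<and> J \<subseteq> S"
    unfolding submodule_over_def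
    using a_subset additive_subgroup.zero_closed[OF additive_subgroup_axioms]
      additive_subgroup.a_closed[OF additive_subgroup_axioms] I_l_closed by simp
next
  assume J: "submodule_over S J \<and> J \<subseteq> S"
  then have J': "submodule_over S J" "J \<subseteq> S" by simp_all
  show "ideal J (ring_on S)"
  proof (rule idealI[OF ring_on_ring[OF S]])
    have neg: "inv\<^bsub>add_monoid (ring_on S)\<^esub> x = - x" if "x \<in> S" for x
    proof -
      interpret R: ring "ring_on S" by (rule ring_on_ring[OF S])
      have "\<ominus>\<^bsub>ring_on S\<^esub> x = - x"
        by (rule R.minus_equality) (use that subring_uminus[OF S] in simp_all)
      then show ?thesis by (simp add: a_inv_def)
    qed
    show "subgroup J (add_monoid (ring_on S))"
    proof
      show "J \<subseteq> carrier (add_monoid (ring_on S))" using J'(2) by simp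
      show "\<one>\<^bsub>add_monoid (ring_on S)\<^esub> \<in> J" using submodule_zero[OF J'(1)] by simp
      show "x \<otimes>\<^bsub>add_monoid (ring_on S)\<^esub> y \<in> J" if "x \<in> J" "y \<in> J" for x y
        using submodule_add[OF J'(1) that] by simp
      show "inv\<^bsub>add_monoid (ring_on S)\<^esub> x \<in> J" if "x \<in> J" for x
        using submodule_uminus[OF J'(1) S that] neg[OF subsetD[OF J'(2) that]] by simp
    qed
    show "x \<otimes>\<^bsub>ring_on S\<^esub> y \<in> J" if "y \<in> J" "x \<in> carrier (ring_on S)" for x y
      using submodule_scale[OF J'(1)] that by simp
    show "y \<otimes>\<^bsub>ring_on S\<^esub> x \<in> J" if "y \<in> J" "x \<in> carrier (ring_on S)" for x y
      using submodule_scale'[OF J'(1)] that by simp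
  qed
qed

lemma submodule_with_one: "submodule_over S J \<Longrightarrow> 1 \<in> J \<Longrightarrow> S \<subseteq> J"
  using submodule_scale[of S J _ 1] by force

lemma maximalideal_ring_on_iff:
  assumes S: "is_subring (S :: 'k::field set)"
  shows "maximalideal N (ring_on S) \<longleftrightarrow> maximal_in S N"
proof
  assume "maximalideal N (ring_on S)"
  then interpret maximalideal N "ring_on S" .
  have N: "submodule_over S N" "N \<subseteq> S" using ideal_axioms unfolding ideal_ring_on_iff[OF S] by simp_all
  have one: "1 \<notin> N"
  proof
    assume "1 \<in> N"
    then have "S = N" using submodule_with_one[OF N(1)] N(2) by blast
    then show False using I_notcarr by simp
  qed
  have "\<exists>y\<in>S. 1 - x * y \<in> N" if x: "x \<in> S" "x \<notin> N" for x
  proof -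
    let ?J = "lin S (insert x N)"
    have JS: "?J \<subseteq> S" by (rule lin_least[OF submodule_self[OF S]]) (use x N in simp)
    have "ideal ?J (ring_on S)" unfolding ideal_ring_on_iff[OF S] using JS lin_submodule by simp
    moreover have NJ: "insert x N \<subseteq> ?J" by (rule lin_superset)
    ultimately have "?J = N \<or> ?J = S" using I_maximal[of ?J] JS by simp
    then have "?J = S" using NJ x(2) by blast
    then have "1 \<in> ?J" using subring_one[OF S] by simp
    then obtain v s where v: "1 = v + s * x" "v \<in> N" "s \<in> S"
      using lin_insert[OF S, of x N] lin_submodule_eq[OF N(1)] by auto
    have "1 - x * s = v" unfolding v(1) by (simp add: mult.commute)
    then show ?thesis using v(2,3) by (intro bexI[of _ s]) simp_all
  qed
  then show "maximal_in S N" unfolding maximal_in_def using N one by blast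
next
  assume N: "maximal_in S N"
  note N' = maximal_inD[OF N]
  show "maximalideal N (ring_on S)"
  proof (rule maximalidealI)
    show "ideal N (ring_on S)" unfolding ideal_ring_on_iff[OF S] using N' by simp
    show "carrier (ring_on S) \<noteq> N" using N'(3) subring_one[OF S] by auto
    fix J assume J: "ideal J (ring_on S)" "N \<subseteq> J" "J \<subseteq> carrier (ring_on S)"
    then have J': "submodule_over S J" "J \<subseteq> S" unfolding ideal_ring_on_iff[OF S] by simp_all
    show "J = N \<or> J = carrier (ring_on S)"
    proof (cases "J = N")
      case False
      then obtain x where x: "x \<in> J" "x \<notin> N" using J(2) by blast
      then obtain y where y: "y \<in> S" "1 - x * y \<in> N" using N'(4)[OF subsetD[OF J'(2) x(1)] x(2)] by blast
      have "(1 - x * y) + x * y \<in> J"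
        by (rule submodule_add[OF J'(1) subsetD[OF J(2) y(2)] submodule_scale'[OF J'(1) y(1) x(1)]])
      then have "S \<subseteq> J" using submodule_with_one[OF J'(1)] by simp
      then show ?thesis using J'(2) by auto
    qed simp
  qed
qed

lemma primeideal_ring_on:
  assumes S: "is_subring (S :: 'k::field set)" and Q: "prime_in S Q"
  shows "primeideal Q (ring_on S)"
proof (rule primeidealI)
  show "ideal Q (ring_on S)" unfolding ideal_ring_on_iff[OF S] using prime_inD[OF Q] by simp
  show "cring (ring_on S)" by (rule ring_on_cring[OF S])
  show "carrier (ring_on S) \<noteq> Q" using prime_inD(3)[OF Q] subring_one[OF S] by auto
  show "x \<in> Q \<or> y \<in> Q" if "x \<in> carrier (ring_on S)" "y \<in> carrier (ring_on S)" "x \<otimes>\<^bsub>ring_on S\<^esub> y \<in> Q" for x y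
    using prime_inD(4)[OF Q] that by simp
qed

lemma ideal_extension_eq_lin:
  assumes B: "is_subring (B :: 'k::field set)" and K: "K \<subseteq> B"
  shows "ideal_extension K B = lin B K"
proof
  have "ideal (lin B K) (ring_on B)"
    unfolding ideal_ring_on_iff[OF B] using lin_submodule lin_least[OF submodule_self[OF B] K] by blast
  then show "ideal_extension K B \<subseteq> lin B K"
    unfolding ideal_extension_def genideal_def using lin_superset[of K B] by blast
  show "lin B K \<subseteq> ideal_extension K B"
    unfolding ideal_extension_def genideal_def
  proof (rule Inter_greatest)
    fix J assume "J \<in> {I. ideal I (ring_on B) \<and> K \<subseteq> I}"
    then show "lin B K \<subseteq> J" unfolding ideal_ring_on_iff[OF B] using lin_least by blast
  qed
qed

lemma ideal_power_0: "ideal_power B K 0 = B"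
  by (simp add: ideal_power_def ideals_set_def nat_pow_def)

lemma ideal_power_Suc: "ideal_power B K (Suc m) = ideal_prod (ring_on B) (ideal_power B K m) K"
  by (simp add: ideal_power_def ideals_set_def nat_pow_def)

lemma ideal_power_ideal:
  assumes B: "is_subring (B :: 'k::field set)" and K: "ideal K (ring_on B)"
  shows "ideal (ideal_power B K m) (ring_on B)"
proof (induction m)
  case 0
  show ?case unfolding ideal_power_0 ideal_ring_on_iff[OF B] using submodule_self[OF B] by simp
next
  case (Suc m)
  show ?case unfolding ideal_power_Suc by (rule ring.ideal_prod_is_ideal[OF ring_on_ring[OF B] Suc K])
qed

lemma ideal_power_submodule:
  assumes B: "is_subring (B :: 'k::field set)" and K: "ideal K (ring_on B)"
  shows "submodule_over B (ideal_power B K m)" "ideal_power B K m \<subseteq> B"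
  using ideal_power_ideal[OF assms] unfolding ideal_ring_on_iff[OF B] by simp_all

lemma ideal_power_mult:
  assumes B: "is_subring (B :: 'k::field set)" and K: "ideal K (ring_on B)"
    and x: "x \<in> ideal_power B K m" and y: "y \<in> ideal_power B K l"
  shows "x * y \<in> ideal_power B K (m + l)"
  using y
proof (induction l arbitrary: y)
  case 0
  then have "y \<in> B" unfolding ideal_power_0 .
  from submodule_scale'[OF ideal_power_submodule(1)[OF B K] this x] show ?case by simp
next
  case (Suc l)
  from Suc.prems have "y \<in> ideal_prod (ring_on B) (ideal_power B K l) K" unfolding ideal_power_Suc .
  then show ?case
  proof (induction rule: ideal_prod.induct)
    case (prod i j)
    have "x * i \<in> ideal_power B K (m + l)" by (rule Suc.IH[OF prod(1)])
    then have "(x * i) \<otimes>\<^bsub>ring_on B\<^esub> j \<in> ideal_power B K (Suc (m + l))"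
      unfolding ideal_power_Suc using prod(2) by (rule ideal_prod.prod)
    then show ?case by (simp add: mult.assoc)
  next
    case (sum y z)
    then show ?case
      using submodule_add[OF ideal_power_submodule(1)[OF B K]] by (simp add: distrib_left)
  qed
qed

lemma ideal_power_1_superset:
  assumes B: "is_subring (B :: 'k::field set)" and K: "ideal K (ring_on B)"
  shows "K \<subseteq> ideal_power B K 1"
proof
  fix x assume "x \<in> K"
  then have "1 \<otimes>\<^bsub>ring_on B\<^esub> x \<in> ideal_power B K (Suc 0)"
    unfolding ideal_power_Suc ideal_power_0 using subring_one[OF B] by (intro ideal_prod.prod)
  then show "x \<in> ideal_power B K 1" by simp
qed

lemma power_in_ideal_power:
  assumes B: "is_subring (B :: 'k::field set)" and K: "ideal K (ring_on B)" and x: "x \<in> K"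
  shows "x ^ m \<in> ideal_power B K m"
proof (induction m)
  case 0
  then show ?case using subring_one[OF B] by (simp add: ideal_power_0)
next
  case (Suc m)
  have "x ^ m * x \<in> ideal_power B K (m + 1)"
    using ideal_power_mult[OF B K Suc] ideal_power_1_superset[OF B K] x by blast
  then show ?case by (simp add: mult.commute)
qed

lemma ideal_power_local:
  assumes B: "is_subring (B :: 'k::field set)" and C: "is_subring C" "B \<subseteq> C" and Q: "prime_in C Q"
    and K: "\<And>x. x \<in> K \<Longrightarrow> \<exists>s\<in>C - Q. \<exists>y\<in>C. s * x = \<tau> * y" and x: "x \<in> ideal_power B K m"
  shows "\<exists>s\<in>C - Q. \<exists>y\<in>C. s * x = \<tau> ^ m * y"
  using x
proof (induction m arbitrary: x)
  case 0
  then have "x \<in> C" using C(2) unfolding ideal_power_0 by blast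
  moreover have "1 * x = \<tau> ^ 0 * x" by simp
  ultimately show ?case using prime_in_compl_one[OF Q C(1)] by blast
next
  case (Suc m)
  from Suc.prems have "x \<in> ideal_prod (ring_on B) (ideal_power B K m) K" unfolding ideal_power_Suc .
  then show ?case
  proof (induction rule: ideal_prod.induct)
    case (prod i j)
    obtain s y where s: "s \<in> C - Q" "y \<in> C" "s * i = \<tau> ^ m * y" using Suc.IH[OF prod(1)] by blast
    obtain t z where t: "t \<in> C - Q" "z \<in> C" "t * j = \<tau> * z" using K[OF prod(2)] by blast
    have "(s * t) * (i * j) = (s * i) * (t * j)" by (simp only: mult_ac)
    also have "\<dots> = \<tau> ^ Suc m * (y * z)" unfolding s(3) t(3) power_Suc by (simp only: mult_ac)
    finally have "(s * t) * (i \<otimes>\<^bsub>ring_on B\<^esub> j) = \<tau> ^ Suc m * (y * z)" by simp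
    then show ?case using prime_in_compl_mult[OF Q C(1) s(1) t(1)] subring_mult[OF C(1) s(2) t(2)] by blast
  next
    case (sum v w)
    then obtain s y t z where s: "s \<in> C - Q" "y \<in> C" "s * v = \<tau> ^ Suc m * y"
      and t: "t \<in> C - Q" "z \<in> C" "t * w = \<tau> ^ Suc m * z" by blast
    have "(s * t) * (v + w) = t * (s * v) + s * (t * w)" by (simp add: algebra_simps)
    also have "\<dots> = \<tau> ^ Suc m * (t * y + s * z)" unfolding s(3) t(3) distrib_left by (simp only: mult_ac)
    finally have "(s * t) * (v \<oplus>\<^bsub>ring_on B\<^esub> w) = \<tau> ^ Suc m * (t * y + s * z)" by simp
    moreover have "t * y + s * z \<in> C"
      by (rule subring_add[OF C(1) subring_mult[OF C(1) DiffD1[OF t(1)] s(2)] subring_mult[OF C(1) DiffD1[OF s(1)] t(2)]])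
    ultimately show ?case using prime_in_compl_mult[OF Q C(1) s(1) t(1)] by blast
  qed
qed

lemma finprod_ideal_powers:
  assumes B: "is_subring (B :: 'k::field set)" and F: "finite F" and M: "\<And>i. i \<in> F \<Longrightarrow> ideal (M i) (ring_on B)"
  shows "\<And>j. j \<in> F \<Longrightarrow> (\<Otimes>\<^bsub>ideals_set (ring_on B)\<^esub> i \<in> F. ideal_power B (M i) (e i)) \<subseteq> ideal_power B (M j) (e j)"
    and "(\<And>i. i \<in> F \<Longrightarrow> x i \<in> M i) \<Longrightarrow>
      (\<Prod>i\<in>F. x i ^ e i) \<in> (\<Otimes>\<^bsub>ideals_set (ring_on B)\<^esub> i \<in> F. ideal_power B (M i) (e i))"
proof -
  interpret I: comm_monoid "ideals_set (ring_on B)"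
    by (rule cring.ideals_set_is_comm_monoid[OF ring_on_cring[OF B]])
  let ?P = "\<lambda>F. \<Otimes>\<^bsub>ideals_set (ring_on B)\<^esub> i \<in> F. ideal_power B (M i) (e i)"
  have carr: "carrier (ideals_set (ring_on B)) = {I. ideal I (ring_on B)}" by (simp add: ideals_set_def)
  have pow: "ideal (ideal_power B (M i) (e i)) (ring_on B)" if "i \<in> F" for i
    by (rule ideal_power_ideal[OF B M[OF that]])
  have ins: "?P (insert i G) = ideal_prod (ring_on B) (ideal_power B (M i) (e i)) (?P G)"
    if "finite G" "i \<notin> G" "insert i G \<subseteq> F" for i G
  proof -
    have "?P (insert i G) = ideal_power B (M i) (e i) \<otimes>\<^bsub>ideals_set (ring_on B)\<^esub> ?P G"
      by (rule I.finprod_insert[OF that(1,2)]) (use that(3) pow in \<open>auto simp: carr\<close>)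
    then show ?thesis by (simp add: ideals_set_def)
  qed
  have idl: "ideal (?P G) (ring_on B)" if "G \<subseteq> F" for G
  proof -
    have "?P G \<in> carrier (ideals_set (ring_on B))" by (rule I.finprod_closed) (use that pow in \<open>auto simp: carr\<close>)
    then show ?thesis by (simp add: carr)
  qed
  show "?P F \<subseteq> ideal_power B (M j) (e j)" if j: "j \<in> F" for j
  proof -
    have "insert j (F - {j}) = F" using j by blast
    then have "?P F = ideal_prod (ring_on B) (ideal_power B (M j) (e j)) (?P (F - {j}))"
      using ins[of "F - {j}" j] F by simp
    also have "\<dots> \<subseteq> ideal_power B (M j) (e j)"
      using ring.ideal_prod_inter[OF ring_on_ring[OF B] pow[OF j] idl[of "F - {j}"]] by blast
    finally show ?thesis .
  qed
  have "(\<Prod>i\<in>G. x i ^ e i) \<in> ?P G" if "finite G" "G \<subseteq> F" "\<And>i. i \<in> G \<Longrightarrow> x i \<in> M i" for G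
    using that
  proof (induction G)
    case empty
    have "?P {} = \<one>\<^bsub>ideals_set (ring_on B)\<^esub>" by (rule I.finprod_empty)
    also have "\<dots> = B" by (simp add: ideals_set_def)
    finally show ?case using subring_one[OF B] by (simp only: prod.empty)
  next
    case (insert i G)
    have "x i ^ e i \<in> ideal_power B (M i) (e i)"
      using insert.prems by (intro power_in_ideal_power[OF B M]) auto
    moreover have "(\<Prod>i\<in>G. x i ^ e i) \<in> ?P G" using insert by simp
    ultimately have "x i ^ e i \<otimes>\<^bsub>ring_on B\<^esub> (\<Prod>i\<in>G. x i ^ e i) \<in> ?P (insert i G)"
      unfolding ins[OF insert.hyps insert.prems(1)] by (rule ideal_prod.prod)
    then show ?case using insert.hyps by simp
  qed
  then show "(\<And>i. i \<in> F \<Longrightarrow> x i \<in> M i) \<Longrightarrow> (\<Prod>i\<in>F. x i ^ e i) \<in> ?P F" using F by blast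
qed

lemma maximal_in_of_family_maximal:
  assumes S: "is_subring (S :: 'k::field set)"
    and Z: "submodule_over S Z" "J \<subseteq> Z" "Z \<subseteq> S" "1 \<notin> Z"
    and max: "\<And>Y. submodule_over S Y \<Longrightarrow> Z \<subseteq> Y \<Longrightarrow> Y \<subseteq> S \<Longrightarrow> 1 \<notin> Y \<Longrightarrow> Y = Z"
  shows "maximal_in S Z"
  unfolding maximal_in_def
proof (intro conjI ballI Z)
  fix x assume x: "x \<in> S - Z"
  let ?Y = "lin S (insert x Z)"
  have sub: "insert x Z \<subseteq> ?Y" by (rule lin_superset)
  have YS: "?Y \<subseteq> S" by (rule lin_least[OF submodule_self[OF S]]) (use x Z(3) in simp)
  have "1 \<in> ?Y"
  proof (rule ccontr)
    assume "1 \<notin> ?Y"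
    then have "?Y = Z" using sub YS by (intro max[OF lin_submodule]) auto
    then show False using sub x by blast
  qed
  then obtain v s where v: "1 = v + s * x" "v \<in> Z" "s \<in> S"
    using lin_insert[OF S, of x Z] lin_submodule_eq[OF Z(1)] by auto
  have "1 - x * s = v" unfolding v(1) by (simp add: mult.commute)
  then show "\<exists>y\<in>S. 1 - x * y \<in> Z" using v(2,3) by (intro bexI[of _ s]) simp_all
qed

text \<open>A nonzero prime ideal properly below a maximal one would give a chain of length two starting at 0. The maximal
  condition comes from the chain condition by dependent choice.\<close>

lemma noetherian_dim_one_ring_on:
  fixes R :: "'k::field set"
  assumes noeth: "noetherian_domain (ring_on R)" and alt: "altitude (ring_on R) = 1"
  shows "noetherian_dim_one R"
proof
  interpret noetherian_domain "ring_on R" by (rule noeth)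
  show S: "is_subring R" by (rule is_subring_of_domain) unfold_locales
  show max: "\<exists>J\<in>F. \<forall>J'\<in>F. J \<subseteq> J' \<longrightarrow> J' = J"
    if "F \<noteq> {}" and F: "\<And>J. J \<in> F \<Longrightarrow> submodule_over R J \<and> J \<subseteq> R" for F
  proof (rule ccontr)
    assume neg: "\<not> ?thesis"
    have "\<exists>f. \<forall>n. f n \<in> F \<and> f n \<subset> f (Suc n)"
    proof (rule dependent_nat_choice[where P = "\<lambda>_ x. x \<in> F" and Q = "\<lambda>_ x y. x \<subset> y"])
      show "\<exists>x. x \<in> F" using that(1) by blast
      show "\<exists>y. y \<in> F \<and> x \<subset> y" if x: "x \<in> F" for x
      proof -
        have "\<not> (\<forall>Y\<in>F. x \<subseteq> Y \<longrightarrow> Y = x)" using neg x by (simp only: bex_simps) blast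
        then obtain Y where "Y \<in> F" "x \<subseteq> Y" "Y \<noteq> x" by blast
        then show ?thesis by (intro exI[of _ Y]) (simp add: psubset_eq)
      qed
    qed
    then obtain f where "\<forall>n. f n \<in> F \<and> f n \<subset> f (Suc n)" ..
    then have f: "\<And>n. f n \<in> F" "\<And>n. f n \<subset> f (Suc n)" by simp_all
    have mono: "mono f" by (rule incseq_SucI) (rule psubset_imp_subset[OF f(2)])
    have "\<Union>(range f) \<in> range f"
    proof (rule ideal_chain_is_trivial)
      show "subset.chain {I. ideal I (ring_on R)} (range f)"
        unfolding subset_chain_def
      proof (intro conjI ballI)
        show "range f \<subseteq> {I. ideal I (ring_on R)}" unfolding ideal_ring_on_iff[OF S] using F f(1) by blast
        fix A B assume "A \<in> range f" "B \<in> range f"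
        then obtain i j where "A = f i" "B = f j" by blast
        then show "A \<subseteq> B \<or> B \<subseteq> A" using monoD[OF mono, of i j] monoD[OF mono, of j i] nat_le_linear[of i j] by blast
      qed
    qed simp
    then obtain m where "\<Union>(range f) = f m" by blast
    then have "f (Suc m) \<subseteq> f m" by blast
    then show False using f(2)[of m] by blast
  qed
  show "maximal_in R Q" if Q: "prime_in R Q" "Q \<noteq> {0}" for Q
  proof -
    note Q' = prime_inD[OF Q(1)]
    let ?F = "{J. submodule_over R J \<and> Q \<subseteq> J \<and> J \<subseteq> R \<and> 1 \<notin> J}"
    have "\<exists>J\<in>?F. \<forall>J'\<in>?F. J \<subseteq> J' \<longrightarrow> J' = J"
      by (rule max) (use Q' in auto)
    then obtain N where NF: "N \<in> ?F" and all: "\<forall>J'\<in>?F. N \<subseteq> J' \<longrightarrow> J' = N" by (rule bexE)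
    have N: "submodule_over R N" "Q \<subseteq> N" "N \<subseteq> R" "1 \<notin> N" using NF by simp_all
    have Nmax: "Y = N" if "submodule_over R Y" "N \<subseteq> Y" "Y \<subseteq> R" "1 \<notin> Y" for Y
    proof -
      have "Y \<in> ?F" using that order_trans[OF N(2) that(2)] by simp
      then show ?thesis using all that(2) by blast
    qed
    have mN: "maximal_in R N" by (rule maximal_in_of_family_maximal[OF S N(1,2,3,4) Nmax])
    have "Q = N"
    proof (rule ccontr)
      assume "Q \<noteq> N"
      then have QN: "Q \<subset> N" using N(2) by blast
      have zQ: "{0} \<subset> Q" using Q(2) submodule_zero[OF Q'(1)] by blast
      have z: "prime_in R {0}" unfolding prime_in_def
        using subring_zero[OF S] by (simp add: submodule_over_def)
      define P where "P i = (if i = 0 then {0} else if i = 1 then Q else N)" for i :: nat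
      have "(\<forall>i\<le>2. primeideal (P i) (ring_on R)) \<and> (\<forall>i<2. P i \<subset> P (Suc i))"
      proof (intro conjI allI impI)
        show "primeideal (P i) (ring_on R)" if "i \<le> 2" for i
          unfolding P_def using z Q(1) maximal_in_prime_in[OF mN] primeideal_ring_on[OF S] by simp
        show "P i \<subset> P (Suc i)" if "i < 2" for i
          using that zQ QN unfolding P_def by (cases "i = 0") auto
      qed
      then have "2 \<in> {l. \<exists>Q :: nat \<Rightarrow> 'k set.
          (\<forall>i\<le>l. primeideal (Q i) (ring_on R)) \<and> (\<forall>i<l. Q i \<subset> Q (Suc i))}" by blast
      then have "enat 2 \<le> altitude (ring_on R)" unfolding altitude_def by (rule SUP_upper)
      then show False using alt by (simp add: one_enat_def)
    qed
    then show ?thesis using mN by simp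
  qed
qed

text \<open>The second isomorphism theorem in the case \<open>C = A + J\<close>.\<close>

lemma quotient_ring_on_iso:
  fixes A C J :: "'k::field set"
  assumes A: "is_subring A" and C: "is_subring C" "A \<subseteq> C" and J: "submodule_over C J" "J \<subseteq> C"
    and sum: "\<And>c. c \<in> C \<Longrightarrow> \<exists>\<alpha>\<in>A. c - \<alpha> \<in> J"
  shows "ring_on C Quot J \<simeq> ring_on A Quot (J \<inter> A)"
proof -
  have Ji: "ideal J (ring_on C)" unfolding ideal_ring_on_iff[OF C(1)] using J by simp
  interpret q: ring_hom_ring "ring_on C" "ring_on C Quot J" "(+>\<^bsub>ring_on C\<^esub>) J"
    by (rule ideal.rcos_ring_hom_ring[OF Ji])
  have coset: "J +>\<^bsub>ring_on C\<^esub> x = (\<lambda>j. j + x) ` J" for x by (auto simp: a_r_coset_def')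
  have coset_eq: "(J +>\<^bsub>ring_on C\<^esub> x = J +>\<^bsub>ring_on C\<^esub> y) \<longleftrightarrow> x - y \<in> J" for x y
  proof
    assume "J +>\<^bsub>ring_on C\<^esub> x = J +>\<^bsub>ring_on C\<^esub> y"
    moreover have "x \<in> (\<lambda>j. j + x) ` J" using submodule_zero[OF J(1)] by force
    ultimately have "x \<in> (\<lambda>j. j + y) ` J" unfolding coset by simp
    then show "x - y \<in> J" by auto
  next
    assume d: "x - y \<in> J"
    have "j + x \<in> (\<lambda>j. j + y) ` J" if "j \<in> J" for j
      using submodule_add[OF J(1) that d] by (intro image_eqI[of _ _ "j + (x - y)"]) simp_all
    moreover have "j + y \<in> (\<lambda>j. j + x) ` J" if "j \<in> J" for j
      using submodule_diff[OF J(1) C(1) that d] by (intro image_eqI[of _ _ "j - (x - y)"]) simp_all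
    ultimately show "J +>\<^bsub>ring_on C\<^esub> x = J +>\<^bsub>ring_on C\<^esub> y" unfolding coset by blast
  qed
  have hom: "ring_hom_ring (ring_on A) (ring_on C Quot J) ((+>\<^bsub>ring_on C\<^esub>) J)"
  proof (rule ring_hom_ringI[OF ring_on_ring[OF A] q.S.ring_axioms])
    fix x y assume xy: "x \<in> carrier (ring_on A)" "y \<in> carrier (ring_on A)"
    then have xyC: "x \<in> carrier (ring_on C)" "y \<in> carrier (ring_on C)" using C(2) by auto
    show "J +>\<^bsub>ring_on C\<^esub> x \<in> carrier (ring_on C Quot J)" by (rule q.hom_closed[OF xyC(1)])
    show "J +>\<^bsub>ring_on C\<^esub> (x \<otimes>\<^bsub>ring_on A\<^esub> y) = (J +>\<^bsub>ring_on C\<^esub> x) \<otimes>\<^bsub>ring_on C Quot J\<^esub> (J +>\<^bsub>ring_on C\<^esub> y)"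
      using q.hom_mult[OF xyC] by simp
    show "J +>\<^bsub>ring_on C\<^esub> (x \<oplus>\<^bsub>ring_on A\<^esub> y) = (J +>\<^bsub>ring_on C\<^esub> x) \<oplus>\<^bsub>ring_on C Quot J\<^esub> (J +>\<^bsub>ring_on C\<^esub> y)"
      using q.hom_add[OF xyC] by simp
  next
    show "J +>\<^bsub>ring_on C\<^esub> \<one>\<^bsub>ring_on A\<^esub> = \<one>\<^bsub>ring_on C Quot J\<^esub>" using q.hom_one by simp
  qed
  have zero: "\<zero>\<^bsub>ring_on C Quot J\<^esub> = J +>\<^bsub>ring_on C\<^esub> 0" using q.hom_zero by simp
  have kernel: "a_kernel (ring_on A) (ring_on C Quot J) ((+>\<^bsub>ring_on C\<^esub>) J) = J \<inter> A"
    unfolding a_kernel_def' zero coset_eq by auto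
  have "(+>\<^bsub>ring_on C\<^esub>) J ` carrier (ring_on A) = carrier (ring_on C Quot J)"
  proof
    show "(+>\<^bsub>ring_on C\<^esub>) J ` carrier (ring_on A) \<subseteq> carrier (ring_on C Quot J)"
    proof (rule image_subsetI)
      fix x assume "x \<in> carrier (ring_on A)"
      then have "x \<in> carrier (ring_on C)" using C(2) by auto
      then show "J +>\<^bsub>ring_on C\<^esub> x \<in> carrier (ring_on C Quot J)" by (rule q.hom_closed)
    qed
    show "carrier (ring_on C Quot J) \<subseteq> (+>\<^bsub>ring_on C\<^esub>) J ` carrier (ring_on A)"
    proof
      fix Z assume "Z \<in> carrier (ring_on C Quot J)"
      then obtain c where c: "c \<in> C" "Z = J +>\<^bsub>ring_on C\<^esub> c"
        by (auto simp: FactRing_def A_RCOSETS_def')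
      obtain \<alpha> where \<alpha>: "\<alpha> \<in> A" "c - \<alpha> \<in> J" using sum[OF c(1)] by blast
      have "Z = J +>\<^bsub>ring_on C\<^esub> \<alpha>" unfolding c(2) coset_eq by (rule \<alpha>(2))
      then show "Z \<in> (+>\<^bsub>ring_on C\<^esub>) J ` carrier (ring_on A)" using \<alpha>(1) by simp
    qed
  qed
  from ring_hom_ring.FactRing_iso[OF hom this]
  have iso: "ring_on A Quot (J \<inter> A) \<simeq> ring_on C Quot J" unfolding kernel .
  have "ideal (J \<inter> A) (ring_on A)"
    unfolding ideal_ring_on_iff[OF A]
    using submodule_Int[OF submodule_restrict[OF J(1) C(2)] submodule_self[OF A]] by simp
  then have "ring (ring_on A Quot (J \<inter> A))" by (rule ideal.quotient_is_ring)
  then show ?thesis using ring_iso_sym iso by blast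
qed

section \<open>Integral closures of ideals\<close>

lemma ideal_power_subset:
  assumes B: "is_subring (B :: 'k::field set)" and K: "ideal K (ring_on B)" and m: "m \<ge> 1"
  shows "ideal_power B K m \<subseteq> K"
proof -
  obtain l where l: "m = Suc l" using m by (cases m) auto
  show ?thesis unfolding l ideal_power_Suc
    using ring.ideal_prod_inter[OF ring_on_ring[OF B] ideal_power_ideal[OF B K] K] by blast
qed

text \<open>A linear combination of elements of J involves only finitely many coefficients.\<close>

lemma lin_extension_finite:
  fixes C :: "'k::field set"
  assumes C: "is_subring C" and x: "x \<in> lin C J"
  shows "\<exists>W. finite W \<and> W \<subseteq> C \<and> (\<forall>B. is_subring B \<longrightarrow> W \<subseteq> B \<longrightarrow> x \<in> lin B J)"
  using x
proof (induction rule: lin_induct)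
  case zero
  have "0 \<in> lin B J" for B by (rule submodule_zero[OF lin_submodule])
  then show ?case by (intro exI[of _ "{}"]) simp
next
  case (add v w)
  then obtain V W where V: "finite V" "V \<subseteq> C" "\<forall>B. is_subring B \<longrightarrow> V \<subseteq> B \<longrightarrow> v \<in> lin B J"
    and W: "finite W" "W \<subseteq> C" "\<forall>B. is_subring B \<longrightarrow> W \<subseteq> B \<longrightarrow> w \<in> lin B J" by (elim exE conjE) (rule that)
  have "v + w \<in> lin B J" if "is_subring B" "V \<union> W \<subseteq> B" for B
    using V(3) W(3) that by (intro submodule_add[OF lin_submodule]) simp_all
  then show ?case using V(1,2) W(1,2) by (intro exI[of _ "V \<union> W"]) simp
next
  case (scale s v)
  then obtain V where V: "finite V" "V \<subseteq> C" "\<forall>B. is_subring B \<longrightarrow> V \<subseteq> B \<longrightarrow> v \<in> lin B J" by (elim exE conjE) (rule that)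
  have "s * v \<in> lin B J" if "is_subring B" "insert s V \<subseteq> B" for B
    using V(3) that by (intro submodule_scale[OF lin_submodule]) simp_all
  then show ?case using V(1,2) scale(1) by (intro exI[of _ "insert s V"]) simp
next
  case (gen g)
  have "g \<in> lin B J" for B by (rule lin_inc[OF gen])
  then show ?case by (intro exI[of _ "{}"]) simp
qed

text \<open>If x lies in the extension of J to C, it lies already in the extension to a finite
  extension B of A, and multiplication by x on B is given by a matrix with entries in J.\<close>

lemma contracted_extension_integral:
  assumes A: "is_subring A" and J: "ideal J (ring_on A)" and C: "is_subring C" "A \<subseteq> C"
    and int: "\<And>c. c \<in> C \<Longrightarrow> integral_over A c" and x: "x \<in> A" "x \<in> lin C J"
  shows "x \<in> ideal_integral_closure A J"
proof -
  have J': "submodule_over A J" "J \<subseteq> A" using J unfolding ideal_ring_on_iff[OF A] by simp_all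
  obtain W where W: "finite W" "W \<subseteq> C" "\<forall>B. is_subring B \<longrightarrow> W \<subseteq> B \<longrightarrow> x \<in> lin B J"
    using lin_extension_finite[OF C(1) x(2)] by (elim exE conjE) (rule that)
  have "\<exists>B. finite_extension A B \<and> A \<subseteq> B \<and> W \<subseteq> B \<and> (\<forall>C. is_subring C \<longrightarrow> A \<subseteq> C \<longrightarrow> W \<subseteq> C \<longrightarrow> B \<subseteq> C)"
    by (rule finite_extension_adjoin_set[OF A W(1) _ finite_extension_refl[OF A]]) (use W(2) int in blast)
  then obtain B where B: "finite_extension A B" "W \<subseteq> B" by blast
  obtain G where B': "is_subring B" "A \<subseteq> B" and G: "finite G" "B = lin A G" using B(1) by (rule finite_extensionE)
  have xB: "x \<in> lin B J" using W(3) B'(1) B(2) by blast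
  obtain g0 where g0: "g0 \<in> G" "g0 \<noteq> 0" using finite_extension_generators[OF G(2) B'(1)] .
  let ?JB = "\<lambda>v. \<exists>c. (\<forall>g\<in>G. c g \<in> J) \<and> v = (\<Sum>g\<in>G. c g * g)"
  have "\<forall>b\<in>B. ?JB (x * b)"
    using xB
  proof (induction rule: lin_induct)
    case zero
    show ?case using submodule_zero[OF J'(1)] by (intro ballI exI[of _ "\<lambda>_. 0"]) simp
  next
    case (add v w)
    show ?case
    proof
      fix b assume b: "b \<in> B"
      obtain c where c: "\<forall>g\<in>G. c g \<in> J" "v * b = (\<Sum>g\<in>G. c g * g)" using add(1) b by blast
      obtain c' where c': "\<forall>g\<in>G. c' g \<in> J" "w * b = (\<Sum>g\<in>G. c' g * g)" using add(2) b by blast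
      have "(v + w) * b = (\<Sum>g\<in>G. (c g + c' g) * g)"
        by (simp only: distrib_right c(2) c'(2) sum.distrib)
      moreover have "\<forall>g\<in>G. c g + c' g \<in> J" using c(1) c'(1) submodule_add[OF J'(1)] by simp
      ultimately show "?JB ((v + w) * b)" by (intro exI[of _ "\<lambda>g. c g + c' g"]) simp
    qed
  next
    case (scale s v)
    show ?case
    proof
      fix b assume b: "b \<in> B"
      have "s * b \<in> B" by (rule subring_mult[OF B'(1) scale(1) b])
      then have "?JB (v * (s * b))" using scale(2) by blast
      then show "?JB ((s * v) * b)" by (simp only: mult_ac)
    qed
  next
    case (gen z)
    show ?case
    proof
      fix b assume "b \<in> B"
      then have "b \<in> {\<Sum>g\<in>G. c g * g | c. \<forall>g\<in>G. c g \<in> A}" unfolding G(2) lin_finite[OF A G(1)] .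
      then obtain c where c: "b = (\<Sum>g\<in>G. c g * g)" "\<forall>g\<in>G. c g \<in> A" by (elim CollectE exE conjE) (rule that)
      have "z * b = (\<Sum>g\<in>G. (z * c g) * g)" unfolding c(1) by (simp only: sum_distrib_left mult.assoc)
      moreover have "\<forall>g\<in>G. z * c g \<in> J" using c(2) submodule_scale'[OF J'(1) _ gen] by simp
      ultimately show "?JB (z * b)" by (intro exI[of _ "\<lambda>g. z * c g"]) simp
    qed
  qed
  then have mat: "?JB (x * g)" if "g \<in> G" for g using lin_inc[OF that, of A] unfolding G(2)[symmetric] by blast
  note P = ideal_power_submodule(1)[OF A J]
  have "\<exists>h\<ge>1. \<exists>k. (\<forall>j\<in>{1..h}. k j \<in> ideal_power A J j) \<and> x ^ h + (\<Sum>j=1..h. k j * x ^ (h - j)) = 0"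
  proof (rule determinant_trick[where P = "ideal_power A J", OF G(1) g0])
    fix g assume "g \<in> G"
    from mat[OF this] obtain c where c: "\<forall>g\<in>G. c g \<in> J" "x * g = (\<Sum>g\<in>G. c g * g)" by (elim exE conjE) (rule that)
    have "\<forall>g\<in>G. c g \<in> ideal_power A J 1" using c(1) ideal_power_1_superset[OF A J] by blast
    then show "\<exists>c. (\<forall>g'\<in>G. c g' \<in> ideal_power A J 1) \<and> x * g = (\<Sum>g'\<in>G. c g' * g')"
      using c(2) by (intro exI[of _ c] conjI)
  next
    show "0 \<in> ideal_power A J m" for m by (rule submodule_zero[OF P])
    show "1 \<in> ideal_power A J 0" unfolding ideal_power_0 by (rule subring_one[OF A])
    show "- y \<in> ideal_power A J m" if "y \<in> ideal_power A J m" for m y by (rule submodule_uminus[OF P A that])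
    show "y + z \<in> ideal_power A J m" if "y \<in> ideal_power A J m" "z \<in> ideal_power A J m" for m y z
      by (rule submodule_add[OF P that])
    show "y * z \<in> ideal_power A J (m + l)" if "y \<in> ideal_power A J m" "z \<in> ideal_power A J l" for m l y z
      by (rule ideal_power_mult[OF A J that])
  qed
  then show ?thesis unfolding ideal_integral_closure_def using x(1) by simp
qed

lemma lin_ideal_power:
  assumes A: "is_subring (A :: 'k::field set)" and H: "ideal H (ring_on A)" and v: "v \<in> lin C H"
  shows "v ^ m \<in> lin C (ideal_power A H m)"
proof -
  have mult: "v * w \<in> lin C (ideal_power A H (m + l))"
    if "v \<in> lin C (ideal_power A H m)" "w \<in> lin C (ideal_power A H l)" for v w m l
    using that(1)
  proof (induction rule: lin_induct)
    case zero
    then show ?case using submodule_zero[OF lin_submodule] by simp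
  next
    case (add v v')
    then show ?case using submodule_add[OF lin_submodule] by (simp add: distrib_right)
  next
    case (scale s v)
    then show ?case using submodule_scale[OF lin_submodule] by (simp add: mult.assoc)
  next
    case (gen g)
    show ?case using that(2)
    proof (induction rule: lin_induct)
      case zero
      then show ?case using submodule_zero[OF lin_submodule] by simp
    next
      case (add w w')
      then show ?case using submodule_add[OF lin_submodule] by (simp add: distrib_left)
    next
      case (scale s w)
      have "s * (g * w) \<in> lin C (ideal_power A H (m + l))" by (rule submodule_scale[OF lin_submodule scale])
      then show ?case by (simp only: mult.left_commute)
    next
      case (gen h)
      show ?case by (rule lin_inc[OF ideal_power_mult[OF A H \<open>g \<in> _\<close> gen]])
    qed
  qed
  have v1: "v \<in> lin C (ideal_power A H 1)" using lin_mono[OF ideal_power_1_superset[OF A H]] v by blast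
  show ?thesis
  proof (induction m)
    case 0
    have "1 \<in> ideal_power A H 0" unfolding ideal_power_0 by (rule subring_one[OF A])
    then show ?case by (simp add: lin_inc)
  next
    case (Suc m)
    from mult[OF v1 Suc] show ?case by simp
  qed
qed

text \<open>In an equation of integral dependence of x on J every term but the leading one has, at a place
  where J has order at least \<open>m\<close>, larger order than the leading one unless x has order at
  least m.\<close>

lemma integral_closure_order:
  assumes A: "is_subring A" "ideal J (ring_on A)" and C: "is_subring C" "A \<subseteq> C"
    and N: "prime_in C N" and \<tau>: "uniformizer C N \<tau>"
    and J: "\<And>z. z \<in> J \<Longrightarrow> \<exists>s\<in>C - N. \<exists>y\<in>C. s * z = \<tau> ^ m * y" and x: "x \<in> ideal_integral_closure A J"
  shows "\<exists>s\<in>C - N. \<exists>y\<in>C. s * x = \<tau> ^ m * y"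
proof (cases "x = 0")
  case True
  then have "1 * x = \<tau> ^ m * 0" by simp
  then show ?thesis using prime_in_compl_one[OF N C(1)] subring_zero[OF C(1)] by blast
next
  case False
  note N' = prime_inD[OF N]
  have \<tau>N: "\<tau> \<in> N" and \<tau>0: "\<tau> \<noteq> 0" using \<tau> unfolding uniformizer_def by auto
  have \<tau>C: "\<tau> \<in> C" using \<tau>N N'(2) by blast
  have "x \<in> A \<and> (\<exists>h\<ge>1. \<exists>k. (\<forall>j\<in>{1..h}. k j \<in> ideal_power A J j) \<and> x ^ h + (\<Sum>j=1..h. k j * x ^ (h - j)) = 0)"
    using x unfolding ideal_integral_closure_def by simp
  then obtain h k where xA: "x \<in> A" and h: "h \<ge> 1" and k: "\<forall>j\<in>{1..h}. k j \<in> ideal_power A J j"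
    and eq: "x ^ h + (\<Sum>j=1..h. k j * x ^ (h - j)) = 0" by (elim exE conjE) (rule that)
  have xC: "x \<in> C" using xA C(2) by blast
  obtain i s u where su: "s \<in> C - N" "u \<in> C - N" "s * x = \<tau> ^ i * u" using uniformizerE[OF \<tau> xC False] .
  have "m \<le> i"
  proof (rule ccontr)
    assume "\<not> m \<le> i"
    then have im: "Suc i \<le> m" by simp
    let ?W = "local_multiples C N (\<tau> ^ Suc (i * h)) C"
    have W: "submodule_over C ?W" by (rule local_multiples_submodule[OF C(1) N submodule_self[OF C(1)]])
    have summand: "k j * x ^ (h - j) \<in> ?W" if j: "j \<in> {1..h}" for j
    proof -
      have kj: "k j \<in> ideal_power A J j" using k j by blast
      obtain t y where t: "t \<in> C - N" "y \<in> C" "t * k j = (\<tau> ^ m) ^ j * y"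
        using ideal_power_local[OF A(1) C N J kj] by blast
      obtain p where p: "m = Suc i + p" using im le_Suc_ex by blast
      obtain q where q: "h = j + q" using j le_Suc_ex[of j h] by auto
      obtain r where r: "j = Suc r" using j by (cases j) auto
      have "m * j + i * (h - j) = Suc (i * h) + (r + p * j)" unfolding p q r by (simp add: algebra_simps)
      then obtain l where l: "m * j + i * (h - j) = Suc (i * h) + l" by (rule that)
      have "(t * s ^ (h - j)) * (k j * x ^ (h - j)) = (t * k j) * (s * x) ^ (h - j)"
        unfolding power_mult_distrib by (simp only: mult_ac)
      also have "\<dots> = \<tau> ^ (m * j + i * (h - j)) * (y * u ^ (h - j))"
        unfolding t(3) su(3) power_add power_mult power_mult_distrib[of "\<tau> ^ i" u] by (simp only: mult_ac)
      also have "\<dots> = \<tau> ^ Suc (i * h) * (\<tau> ^ l * (y * u ^ (h - j)))" unfolding l power_add by (simp only: mult_ac)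
      finally have e: "(t * s ^ (h - j)) * (k j * x ^ (h - j)) = \<tau> ^ Suc (i * h) * (\<tau> ^ l * (y * u ^ (h - j)))" .
      have "\<tau> ^ l * (y * u ^ (h - j)) \<in> C"
        by (rule subring_mult[OF C(1) subring_power[OF C(1) \<tau>C] subring_mult[OF C(1) t(2) subring_power[OF C(1) DiffD1[OF su(2)]]]])
      moreover have "k j * x ^ (h - j) \<in> C"
        using ideal_power_submodule(2)[OF A] kj C(2)
        by (intro subring_mult[OF C(1) _ subring_power[OF C(1) xC]]) blast
      ultimately show ?thesis
        using local_multiplesI[OF _ prime_in_compl_mult[OF N C(1) t(1) prime_in_compl_power[OF N C(1) su(1)]] _ e] by blast
    qed
    have "(\<Sum>j=1..h. k j * x ^ (h - j)) \<in> ?W" by (rule submodule_sum[OF W summand])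
    then have "- (\<Sum>j=1..h. k j * x ^ (h - j)) \<in> ?W" by (rule submodule_uminus[OF W C(1)])
    moreover have "x ^ h = - (\<Sum>j=1..h. k j * x ^ (h - j))" using eq by (simp add: eq_neg_iff_add_eq_0)
    ultimately have "x ^ h \<in> ?W" by simp
    then obtain t y where t: "t \<in> C - N" "y \<in> C" "t * x ^ h = \<tau> ^ Suc (i * h) * y" by (rule local_multiplesE)
    have "\<tau> ^ (i * h) * (t * u ^ h) = t * (s * x) ^ h" unfolding su(3) power_mult_distrib power_mult by (simp only: mult_ac)
    also have "\<dots> = s ^ h * (t * x ^ h)" unfolding power_mult_distrib by (simp only: mult_ac)
    also have "\<dots> = \<tau> ^ (i * h) * (\<tau> * (s ^ h * y))" unfolding t(3) power_Suc by (simp only: mult_ac)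
    finally have "t * u ^ h = \<tau> * (s ^ h * y)" by (rule mult_left_cancel[OF power_not_zero[OF \<tau>0], THEN iffD1])
    moreover have "\<tau> * (s ^ h * y) \<in> N"
      by (rule submodule_scale'[OF N'(1) subring_mult[OF C(1) subring_power[OF C(1) DiffD1[OF su(1)]] t(2)] \<tau>N])
    moreover have "t * u ^ h \<in> C - N" by (rule prime_in_compl_mult[OF N C(1) t(1) prime_in_compl_power[OF N C(1) su(2)]])
    ultimately show False by simp
  qed
  then obtain l where l: "i = m + l" using le_Suc_ex by blast
  have "s * x = \<tau> ^ m * (\<tau> ^ l * u)" unfolding su(3) l power_add by (simp only: mult_ac)
  moreover have "\<tau> ^ l * u \<in> C" by (rule subring_mult[OF C(1) subring_power[OF C(1) \<tau>C] DiffD1[OF su(2)]])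
  ultimately show ?thesis using su(1) by blast
qed

text \<open>The elements r with rx in J form an ideal of C. If it were proper, it would lie in a maximal ideal N, by the
  finite length of \<open>C/a ^ k C\<close>. As J contains powers of the elements of I, so does N, which therefore lies over
  I; but some s outside N satisfies \<open>s * x \<in> J\<close>.\<close>

lemma (in noetherian_dim_one) local_membership:
  assumes C: "is_subring C" "R \<subseteq> C" and fl: "\<And>r. r \<in> R \<Longrightarrow> r \<noteq> 0 \<Longrightarrow> finite_length R ((*) r ` C) C"
    and I: "a \<in> I" "a \<noteq> 0" "I \<subseteq> R" and J: "submodule_over C J" and pow: "\<And>y. y \<in> I \<Longrightarrow> \<exists>k. y ^ k \<in> J"
    and x: "x \<in> C" and loc: "\<And>N. maximal_in C N \<Longrightarrow> I \<subseteq> N \<Longrightarrow> \<exists>s\<in>C - N. s * x \<in> J"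
  shows "x \<in> J"
proof (rule ccontr)
  assume xJ: "x \<notin> J"
  let ?E = "{r \<in> C. r * x \<in> J}"
  have E: "submodule_over C ?E" by (rule submodule_colon[OF C(1) J])
  obtain k where k: "a ^ k \<in> J" using pow[OF I(1)] by blast
  have akR: "a ^ k \<in> R" "a ^ k \<noteq> 0" using I subring_power[OF subring, of a k] by auto
  have powE: "y ^ l \<in> ?E" if "y \<in> C" "y ^ l \<in> J" for y l
    using submodule_scale'[OF J x that(2)] subring_power[OF C(1) that(1)] by simp
  have aC: "a \<in> C" using I C(2) by blast
  let ?F = "{Y. submodule_over C Y \<and> ?E \<subseteq> Y \<and> Y \<subseteq> C \<and> 1 \<notin> Y}"
  have akE: "(*) (a ^ k) ` C \<subseteq> Y" if "submodule_over C Y" "?E \<subseteq> Y" for Y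
  proof
    fix z assume "z \<in> (*) (a ^ k) ` C"
    then obtain c where c: "z = a ^ k * c" "c \<in> C" by blast
    have "a ^ k \<in> Y" using powE[OF aC k] that(2) by blast
    then show "z \<in> Y" unfolding c(1) by (rule submodule_scale'[OF that(1) c(2)])
  qed
  have "\<exists>Z\<in>?F. \<forall>Y\<in>?F. Z \<subseteq> Y \<longrightarrow> Y = Z"
  proof (rule finite_length_maximal[OF fl[OF akR]])
    have "?E \<in> ?F" using E xJ by simp
    then show "?F \<noteq> {}" by blast
    fix Y assume "Y \<in> ?F"
    then have Y: "submodule_over C Y" "?E \<subseteq> Y" "Y \<subseteq> C" by simp_all
    show "submodule_over R Y \<and> (*) (a ^ k) ` C \<subseteq> Y \<and> Y \<subseteq> C"
      using submodule_restrict[OF Y(1) C(2)] akE[OF Y(1,2)] Y(3) by simp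
  qed
  then obtain N where NF: "N \<in> ?F" and all: "\<forall>Y\<in>?F. N \<subseteq> Y \<longrightarrow> Y = N" by (rule bexE)
  have N: "submodule_over C N" "?E \<subseteq> N" "N \<subseteq> C" "1 \<notin> N" using NF by simp_all
  have Nmax: "Y = N" if "submodule_over C Y" "N \<subseteq> Y" "Y \<subseteq> C" "1 \<notin> Y" for Y
  proof -
    have "Y \<in> ?F" using that order_trans[OF N(2) that(2)] by simp
    then show ?thesis using all that(2) by blast
  qed
  have mN: "maximal_in C N" by (rule maximal_in_of_family_maximal[OF C(1) N(1,2,3,4) Nmax])
  have pN: "prime_in C N" by (rule maximal_in_prime_in[OF mN])
  have "I \<subseteq> N"
  proof
    fix y assume y: "y \<in> I"
    then have yC: "y \<in> C" using I(3) C(2) by blast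
    obtain l where l: "y ^ l \<in> J" using pow[OF y] by blast
    then have "y ^ l \<in> N" using powE[OF yC l] N(2) by blast
    show "y \<in> N"
    proof (rule ccontr)
      assume "y \<notin> N"
      then have "y ^ l \<in> C - N" using yC by (intro prime_in_compl_power[OF pN C(1)]) simp
      then show False using \<open>y ^ l \<in> N\<close> by simp
    qed
  qed
  then obtain s where s: "s \<in> C - N" "s * x \<in> J" using loc[OF mN] by blast
  then have "s \<in> ?E" by simp
  then show False using N(2) s(1) by blast
qed

text \<open>If J has order exactly m at every place over I, an element of A with at least this order lies locally in
  JC. As J contains powers of the elements of I, there is no condition at other places, and the element lies in JC;
  hence it is integral over J.\<close>

lemma (in noetherian_dim_one) integral_closure_eq_order:
  assumes A: "is_subring A" "R \<subseteq> A" and C: "is_subring C" "A \<subseteq> C"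
    and int: "\<And>c. c \<in> C \<Longrightarrow> integral_over A c"
    and fl: "\<And>r. r \<in> R \<Longrightarrow> r \<noteq> 0 \<Longrightarrow> finite_length R ((*) r ` C) C"
    and I: "a \<in> I" "a \<noteq> 0" "I \<subseteq> R"
    and \<tau>: "\<And>N. maximal_in C N \<Longrightarrow> I \<subseteq> N \<Longrightarrow> uniformizer C N (\<tau> N)"
    and J: "ideal J (ring_on A)" "\<And>y. y \<in> I \<Longrightarrow> \<exists>k. y ^ k \<in> J"
    and ge: "\<And>N z. maximal_in C N \<Longrightarrow> I \<subseteq> N \<Longrightarrow> z \<in> J \<Longrightarrow> \<exists>s\<in>C - N. \<exists>y\<in>C. s * z = \<tau> N ^ m * y"
    and le: "\<And>N. maximal_in C N \<Longrightarrow> I \<subseteq> N \<Longrightarrow> \<exists>s\<in>C - N. s * \<tau> N ^ m \<in> lin C J"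
  shows "ideal_integral_closure A J =
    {x \<in> A. \<forall>N. maximal_in C N \<longrightarrow> I \<subseteq> N \<longrightarrow> (\<exists>s\<in>C - N. \<exists>y\<in>C. s * x = \<tau> N ^ m * y)}" (is "_ = ?V")
proof
  show "ideal_integral_closure A J \<subseteq> ?V"
  proof
    fix x assume x: "x \<in> ideal_integral_closure A J"
    then have xA: "x \<in> A" unfolding ideal_integral_closure_def by simp
    have "\<exists>s\<in>C - N. \<exists>y\<in>C. s * x = \<tau> N ^ m * y" if N: "maximal_in C N" "I \<subseteq> N" for N
      by (rule integral_closure_order[OF A(1) J(1) C maximal_in_prime_in[OF N(1)] \<tau>[OF N] ge[OF N] x])
    then show "x \<in> ?V" using xA by simp
  qed
  show "?V \<subseteq> ideal_integral_closure A J"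
  proof
    fix x assume "x \<in> ?V"
    then have xA: "x \<in> A" and V: "\<And>N. maximal_in C N \<Longrightarrow> I \<subseteq> N \<Longrightarrow> \<exists>s\<in>C - N. \<exists>y\<in>C. s * x = \<tau> N ^ m * y" by simp_all
    have "x \<in> lin C J"
    proof (rule local_membership[OF C(1) order_trans[OF A(2) C(2)] fl I lin_submodule])
      show "\<exists>k. y ^ k \<in> lin C J" if "y \<in> I" for y using J(2)[OF that] lin_superset[of J C] by blast
      show "x \<in> C" using xA C(2) by blast
      fix N assume N: "maximal_in C N" "I \<subseteq> N"
      obtain s y where s: "s \<in> C - N" "y \<in> C" "s * x = \<tau> N ^ m * y" using V[OF N] by blast
      obtain t where t: "t \<in> C - N" "t * \<tau> N ^ m \<in> lin C J" using le[OF N] by blast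
      have "(t * s) * x = (t * \<tau> N ^ m) * y" by (simp only: mult.assoc s(3))
      moreover have "(t * \<tau> N ^ m) * y \<in> lin C J" by (rule submodule_scale'[OF lin_submodule s(2) t(2)])
      ultimately have "(t * s) * x \<in> lin C J" by (rule ssubst)
      then show "\<exists>s\<in>C - N. s * x \<in> lin C J"
        using prime_in_compl_mult[OF maximal_in_prime_in[OF N(1)] C(1) t(1) s(1)] by (rule bexI)
    qed
    show "x \<in> ideal_integral_closure A J"
      by (rule contracted_extension_integral[OF A(1) J(1) C int xA \<open>x \<in> lin C J\<close>])
  qed
qed

section \<open>Construction of the extension\<close>

lemma normalization_mono_ring:
  assumes "S \<subseteq> T" shows "normalization S \<subseteq> normalization T"
  unfolding normalization_def using quotient_field_mono[OF assms] integral_over_mono[OF _ assms] by blast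

context noetherian_dim_one
begin

lemma finite_length_normalization:
  assumes A: "finite_extension R A" and r: "r \<in> R" "r \<noteq> 0"
  shows "finite_length R ((*) r ` normalization A) (normalization A)"
proof -
  obtain G where A': "is_subring A" "R \<subseteq> A" and G: "finite G" "A = lin R G" using A by (rule finite_extensionE)
  have "\<exists>c\<in>R. c \<noteq> 0 \<and> c * x \<in> A" if "x \<in> normalization A" for x
  proof -
    have "x \<in> quotient_field A" using that normalization_quotient by blast
    then obtain p q where pq: "p \<in> A" "q \<in> A" "q \<noteq> 0" "x = p / q" by (rule quotient_fieldE)
    obtain q' where q': "q' \<in> A" "q * q' \<in> R" "q * q' \<noteq> 0"
      using integral_over_multiple[OF subring A' pq(2) finite_extension_integral[OF subring A pq(2)] pq(3)] by blast
    have "(q * q') * x = p * q'" using pq(3) unfolding pq(4) by simp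
    then have "(q * q') * x \<in> A" using subring_mult[OF A'(1) pq(1) q'(1)] by (rule ssubst)
    then show ?thesis using q'(2,3) by blast
  qed
  then show ?thesis
    by (rule Krull_Akizuki[OF A' G(2,1) normalization_subring[OF A'(1)] normalization_superset[OF A'(1)] _ r])
qed

lemma normalization_integral_over_base:
  assumes A: "finite_extension R A" and x: "x \<in> normalization A"
  shows "integral_over R x"
  using integral_over_trans[OF subring finite_extension_integral[OF subring A] normalization_integral[OF x]] .

text \<open>By the Krull--Akizuki theorem the normalization C of a finite extension is generated modulo aC
  by finitely many elements; adjoining them does not change the normalization.\<close>

lemma finite_extension_filling_normalization:
  assumes A0: "finite_extension R A0" and a: "a \<in> R" "a \<noteq> 0"
  obtains A where "finite_extension R A" "A0 \<subseteq> A" "A \<subseteq> normalization A0" "normalization A = normalization A0"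
    "\<And>c. c \<in> normalization A0 \<Longrightarrow> \<exists>\<alpha>\<in>A. \<exists>y\<in>normalization A0. c = \<alpha> + a * y"
proof -
  let ?C = "normalization A0"
  note A0' = finite_extensionD[OF A0]
  have C: "is_subring ?C" "A0 \<subseteq> ?C" by (rule normalization_subring[OF A0'(1)], rule normalization_superset[OF A0'(1)])
  have RC: "R \<subseteq> ?C" using A0'(2) C(2) by blast
  have sub: "submodule_over R ?C" by (rule submodule_restrict[OF submodule_self[OF C(1)] RC])
  have aC: "(*) a ` ?C \<subseteq> ?C" using subring_mult[OF C(1)] a(1) RC by blast
  obtain G where G: "finite G" "G \<subseteq> ?C" "?C = lin R ((*) a ` ?C \<union> G)"
    using finite_length_finitely_generated[OF finite_length_normalization[OF A0 a] sub aC] .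
  have "\<exists>A. finite_extension R A \<and> A0 \<subseteq> A \<and> G \<subseteq> A \<and> (\<forall>C. is_subring C \<longrightarrow> A0 \<subseteq> C \<longrightarrow> G \<subseteq> C \<longrightarrow> A \<subseteq> C)"
    by (rule finite_extension_adjoin_set[OF subring G(1) _ A0])
      (use G(2) normalization_integral_over_base[OF A0] in blast)
  then obtain A where A: "finite_extension R A" "A0 \<subseteq> A" "G \<subseteq> A"
    and least: "\<forall>C. is_subring C \<longrightarrow> A0 \<subseteq> C \<longrightarrow> G \<subseteq> C \<longrightarrow> A \<subseteq> C" by (elim exE conjE) (rule that)
  have AC: "A \<subseteq> ?C" by (rule least[rule_format, OF C G(2)])
  note A' = finite_extensionD[OF A(1)]
  have norm: "normalization A = ?C"
  proof (rule normalization_integral_extension[OF A'(1) A(2) A0'(1)])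
    show "integral_over A0 x" if "x \<in> A" for x by (rule normalization_integral[OF subsetD[OF AC that]])
    show "A \<subseteq> quotient_field A0" by (rule order_trans[OF AC normalization_quotient])
  qed
  let ?Y = "{v + w | v w. v \<in> A \<and> w \<in> (*) a ` ?C}"
  have Y: "submodule_over R ?Y"
    by (intro submodule_plus submodule_image_mult sub submodule_restrict[OF submodule_self[OF A'(1)] A'(2)])
  have "(*) a ` ?C \<union> G \<subseteq> ?Y"
  proof
    fix x assume x: "x \<in> (*) a ` ?C \<union> G"
    show "x \<in> ?Y"
    proof (cases "x \<in> G")
      case True
      have "x = x + a * 0" by simp
      then show ?thesis using True A(3) subring_zero[OF C(1)] by blast
    next
      case False
      have "x = 0 + x" by simp
      then show ?thesis using False x subring_zero[OF A'(1)] by blast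
    qed
  qed
  then have CY: "?C \<subseteq> ?Y" using lin_least[OF Y] G(3) by (metis (no_types, lifting))
  have "\<exists>\<alpha>\<in>A. \<exists>y\<in>?C. c = \<alpha> + a * y" if "c \<in> ?C" for c using subsetD[OF CY that] by blast
  then show ?thesis using that[OF A(1,2) AC norm] by blast
qed

end

text \<open>Lying between R[t] and its field of fractions, A has the quotient field generated by t over that of R.\<close>

lemma finite_extension_separable:
  fixes R :: "'k::alg_closed_field set"
  assumes R: "is_subring R" and A: "finite_extension R A" and t: "adjoin R t \<subseteq> A" "A \<subseteq> quotient_field (adjoin R t)"
    and f: "coeffs_in (quotient_field R) f" "rsquarefree f" "poly f t = 0"
  shows "finite_separable_integral_extension_domain R A"
proof -
  let ?K = "quotient_field R" let ?A0 = "adjoin R t"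
  note A' = finite_extensionD[OF A]
  have K: "is_subfield ?K" by (rule quotient_field_subfield[OF R])
  note K' = subfield_subring[OF K]
  have A0: "is_subring ?A0" by (rule adjoin_subring[OF R])
  have tint: "integral_over ?K t" by (rule generator_integral[OF K f])
  have E: "is_subfield (adjoin ?K t)" by (rule adjoin_subfield[OF K tint])
  have quot: "quotient_field A = quotient_field ?A0" by (rule quotient_field_idem[OF A0 t])
  have F: "is_subfield (quotient_field ?A0)" by (rule quotient_field_subfield[OF A0])
  have "?A0 \<subseteq> adjoin ?K t"
    by (rule adjoin_least[OF adjoin_subring[OF K'] _ adjoin_self[OF K']])
      (use quotient_field_superset[OF R] adjoin_superset[OF K'] in blast)
  then have 1: "quotient_field ?A0 \<subseteq> adjoin ?K t" by (rule quotient_field_least[OF E])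
  have KF: "?K \<subseteq> quotient_field ?A0" by (rule quotient_field_mono[OF adjoin_superset[OF R]])
  have "t \<in> quotient_field ?A0" using quotient_field_superset[OF A0] adjoin_self[OF R] by blast
  then have 2: "adjoin ?K t \<subseteq> quotient_field ?A0" by (rule adjoin_least[OF subfield_subring[OF F] KF])
  have eq: "quotient_field A = adjoin ?K t" unfolding quot using 1 2 by (rule subset_antisym)
  have "finite_extension ?K (adjoin ?K t)"
    by (rule finite_extension_adjoin[OF K' finite_extension_refl[OF K'] tint])
  then have "finitely_generated_module ?K (adjoin ?K t)"
    unfolding finitely_generated_module_iff[OF K'] by (elim finite_extensionE) blast
  then have "finite_separable_field_extension ?K (quotient_field A)"
    unfolding finite_separable_field_extension_def eq
    using adjoin_superset[OF K'] separable_adjoin[OF K f] by blast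
  moreover have "finitely_generated_module R A"
    unfolding finitely_generated_module_iff[OF R] using A by (elim finite_extensionE) blast
  ultimately show ?thesis
    unfolding finite_separable_integral_extension_domain_def
    using ring_on_domain[OF A'(1)] A'(2) finite_extension_integral[OF R A] by blast
qed

text \<open>If \<open>C = A + aC\<close> with a in P, then \<open>PC = P + aC\<close>, and A and C have the same residue rings.\<close>

lemma extended_maximal_ideal:
  assumes A: "is_subring A" and C: "is_subring C" "A \<subseteq> C" and int: "\<And>c. c \<in> C \<Longrightarrow> integral_over A c"
    and P: "maximalideal P (ring_on A)" and a: "a \<in> P"
    and fill: "\<And>c. c \<in> C \<Longrightarrow> \<exists>\<alpha>\<in>A. \<exists>y\<in>C. c = \<alpha> + a * y"
  shows "maximalideal (ideal_extension P C) (ring_on C)"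
    and "(ring_on C) Quot (ideal_extension P C) \<simeq> (ring_on A) Quot P"
proof -
  have mP: "maximal_in A P" using P unfolding maximalideal_ring_on_iff[OF A] .
  note P' = maximal_inD[OF mP]
  have Pid: "ideal P (ring_on A)" unfolding ideal_ring_on_iff[OF A] using P' by simp
  have PC: "P \<subseteq> C" using P'(2) C(2) by blast
  let ?PC = "lin C P"
  note PCm = lin_submodule[of C P]
  have ext: "ideal_extension P C = ?PC" by (rule ideal_extension_eq_lin[OF C(1) PC])
  have PPC: "P \<subseteq> ?PC" by (rule lin_superset)
  have PCC: "?PC \<subseteq> C" by (rule lin_least[OF submodule_self[OF C(1)] PC])
  have one: "1 \<notin> ?PC"
  proof
    assume one: "1 \<in> ?PC"
    have "1 \<in> ideal_integral_closure A P"
      by (rule contracted_extension_integral[OF A Pid C int subring_one[OF A] one])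
    then have "\<exists>h\<ge>1. \<exists>k. (\<forall>j\<in>{1..h}. k j \<in> ideal_power A P j) \<and> 1 ^ h + (\<Sum>j=1..h. k j * 1 ^ (h - j)) = 0"
      unfolding ideal_integral_closure_def by simp
    then obtain h and k :: "nat \<Rightarrow> _" where k: "\<forall>j\<in>{1..h}. k j \<in> ideal_power A P j" "1 + (\<Sum>j=1..h. k j) = 0"
      by auto
    have "(\<Sum>j=1..h. k j) \<in> P"
    proof (rule submodule_sum[OF P'(1)])
      fix j assume "j \<in> {1..h}"
      then show "k j \<in> P" using k(1) ideal_power_subset[OF A Pid, of j] by auto
    qed
    then have "- (\<Sum>j=1..h. k j) \<in> P" by (rule submodule_uminus[OF P'(1) A])
    moreover have "- (\<Sum>j=1..h. k j) = 1" using k(2) by (simp add: add_eq_0_iff)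
    ultimately show False using P'(3) by simp
  qed
  have contr: "?PC \<inter> A = P"
  proof
    show "?PC \<inter> A \<subseteq> P"
    proof
      fix x assume x: "x \<in> ?PC \<inter> A"
      show "x \<in> P"
      proof (rule ccontr)
        assume "x \<notin> P"
        then obtain y where y: "y \<in> A" "1 - x * y \<in> P" using P'(4) x by blast
        have yC: "y \<in> C" using y(1) C(2) by blast
        have "(1 - x * y) + x * y \<in> ?PC"
          by (rule submodule_add[OF PCm subsetD[OF PPC y(2)] submodule_scale'[OF PCm yC]]) (use x in blast)
        then show False using one by simp
      qed
    qed
    show "P \<subseteq> ?PC \<inter> A" using PPC P'(2) by blast
  qed
  have aPC: "a * y \<in> ?PC" if "y \<in> C" for y by (rule submodule_scale'[OF PCm that subsetD[OF PPC a]])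
  have "maximal_in C ?PC"
    unfolding maximal_in_def
  proof (intro conjI ballI)
    fix c assume c: "c \<in> C - ?PC"
    then obtain \<alpha> y where \<alpha>: "\<alpha> \<in> A" "y \<in> C" "c = \<alpha> + a * y" using fill by blast
    have "\<alpha> \<notin> P"
    proof
      assume "\<alpha> \<in> P"
      then have "\<alpha> + a * y \<in> ?PC" using PPC by (intro submodule_add[OF PCm _ aPC[OF \<alpha>(2)]]) blast
      then show False using c \<alpha>(3) by simp
    qed
    then obtain \<beta> where \<beta>: "\<beta> \<in> A" "1 - \<alpha> * \<beta> \<in> P" using P'(4)[OF \<alpha>(1)] by blast
    have \<beta>C: "\<beta> \<in> C" using \<beta>(1) C(2) by blast
    have "(1 - \<alpha> * \<beta>) - a * (y * \<beta>) \<in> ?PC"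
      by (rule submodule_diff[OF PCm C(1) subsetD[OF PPC \<beta>(2)] aPC[OF subring_mult[OF C(1) \<alpha>(2) \<beta>C]]])
    moreover have "(1 - \<alpha> * \<beta>) - a * (y * \<beta>) = 1 - c * \<beta>" unfolding \<alpha>(3) by (simp add: algebra_simps)
    ultimately show "\<exists>z\<in>C. 1 - c * z \<in> ?PC" using \<beta>C by (intro bexI[of _ \<beta>]) simp_all
  qed (rule PCm, rule PCC, rule one)
  then show "maximalideal (ideal_extension P C) (ring_on C)" unfolding ext maximalideal_ring_on_iff[OF C(1)] .
  have "ring_on C Quot ?PC \<simeq> ring_on A Quot (?PC \<inter> A)"
  proof (rule quotient_ring_on_iso[OF A C PCm PCC])
    fix c assume "c \<in> C"
    then obtain \<alpha> y where \<alpha>: "\<alpha> \<in> A" "y \<in> C" "c = \<alpha> + a * y" using fill by blast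
    have "c - \<alpha> = a * y" using \<alpha>(3) by simp
    then show "\<exists>\<alpha>\<in>A. c - \<alpha> \<in> ?PC" using \<alpha>(1) aPC[OF \<alpha>(2)] by (intro bexI[of _ \<alpha>]) simp_all
  qed
  then show "(ring_on C) Quot (ideal_extension P C) \<simeq> (ring_on A) Quot P" unfolding ext contr .
qed

text \<open>Since \<open>\<pi>\<close> has order d at the place N over \<open>M i\<close>, measured by \<open>\<tau>\<close>, and the elements of I have order at least \<open>e i\<close> at \<open>M i\<close>,
  they have order at least \<open>d * e i\<close> at N. Equality is attained by a product of \<open>\<pi> ^ e i\<close> with
  powers of elements of the other maximal ideals that lie outside \<open>M i\<close>.\<close>

lemma order_of_decomposed_ideal:
  fixes B C :: "'k::field set"
  assumes B: "is_subring B" and C: "is_subring C" "B \<subseteq> C" and F: "finite F" "inj_on M F"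
    and M: "\<And>j. j \<in> F \<Longrightarrow> maximal_in B (M j)" and i: "i \<in> F"
    and decomp: "lin B I = (\<Otimes>\<^bsub>ideals_set (ring_on B)\<^esub> j \<in> F. ideal_power B (M j) (e j))"
    and N: "prime_in C N" "N \<inter> B = M i" and \<pi>: "uniformizer B (M i) \<pi>"
    and rel: "u \<in> C - N" "s \<in> C - N" "u * \<pi> = \<tau> ^ d * s"
  shows "\<And>x. x \<in> I \<Longrightarrow> \<exists>s\<in>C - N. \<exists>y\<in>C. s * x = \<tau> ^ (d * e i) * y"
    and "\<exists>s\<in>C - N. s * \<tau> ^ (d * e i) \<in> lin C I"
proof -
  have compl: "z \<in> C - N" if "z \<in> B - M i" for z using that C(2) N(2) by blast
  have idl: "ideal (M j) (ring_on B)" if "j \<in> F" for j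
    unfolding ideal_ring_on_iff[OF B] using maximal_inD[OF M[OF that]] by simp
  have pow: "u ^ k * \<pi> ^ k = \<tau> ^ (d * k) * s ^ k" for k
    unfolding power_mult_distrib[symmetric] rel(3) by (simp only: power_mult_distrib power_mult)
  show "\<exists>s\<in>C - N. \<exists>y\<in>C. s * x = \<tau> ^ (d * e i) * y" if x: "x \<in> I" for x
  proof -
    have xM: "x \<in> ideal_power B (M i) (e i)"
      by (rule subsetD[OF finprod_ideal_powers(1)[OF B F(1), of M, OF idl i, of e, folded decomp] lin_inc[OF x]])
    have gen: "\<exists>s\<in>B - M i. \<exists>y\<in>B. s * z = \<pi> * y" if z: "z \<in> M i" for z
      by (rule uniformizer_generates[OF \<pi> B maximal_in_prime_in[OF M[OF i]] z])
    have "\<exists>s\<in>B - M i. \<exists>y\<in>B. s * x = \<pi> ^ e i * y"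
      by (rule ideal_power_local[OF B B order_refl maximal_in_prime_in[OF M[OF i]] gen xM])
    then obtain t y where t: "t \<in> B - M i" "y \<in> B" "t * x = \<pi> ^ e i * y" by (elim bexE) (rule that)
    have "(u ^ e i * t) * x = (u ^ e i * \<pi> ^ e i) * y" by (simp only: mult.assoc t(3))
    also have "\<dots> = \<tau> ^ (d * e i) * (s ^ e i * y)" unfolding pow by (simp only: mult.assoc)
    finally have eq: "(u ^ e i * t) * x = \<tau> ^ (d * e i) * (s ^ e i * y)" .
    have "u ^ e i * t \<in> C - N"
      by (rule prime_in_compl_mult[OF N(1) C(1) prime_in_compl_power[OF N(1) C(1) rel(1)] compl[OF t(1)]])
    moreover have "s ^ e i * y \<in> C"
      by (rule subring_mult[OF C(1) subring_power[OF C(1) DiffD1[OF rel(2)]] subsetD[OF C(2) t(2)]])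
    ultimately show ?thesis using eq by blast
  qed
  have "\<exists>z. z \<in> M j \<and> z \<notin> M i" if j: "j \<in> F - {i}" for j
  proof (rule ccontr)
    assume "\<not> ?thesis"
    then have sub: "M j \<subseteq> M i" by blast
    have "M j \<noteq> M i" using F(2) j i by (auto dest: inj_onD)
    then obtain x where x: "x \<in> M i" "x \<notin> M j" using sub by blast
    note mi = maximal_inD[OF M[OF i]]
    obtain y where y: "y \<in> B" "1 - x * y \<in> M j"
      using maximal_inD(4)[OF M subsetD[OF mi(2) x(1)] x(2)] j by blast
    have "(1 - x * y) + x * y \<in> M i"
      by (rule submodule_add[OF mi(1) subsetD[OF sub y(2)] submodule_scale'[OF mi(1) y(1) x(1)]])
    then show False using mi(3) by simp
  qed
  then have "\<forall>j\<in>F - {i}. \<exists>z. z \<in> M j \<and> z \<notin> M i" by blast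
  then obtain z where z: "\<forall>j\<in>F - {i}. z j \<in> M j \<and> z j \<notin> M i" by (rule bchoice[THEN exE])
  define x where "x j = (if j = i then \<pi> else z j)" for j
  have \<pi>M: "\<pi> \<in> M i" using \<pi> unfolding uniformizer_def by simp
  have xM: "x j \<in> M j" if "j \<in> F" for j
  proof (cases "j = i")
    case True
    then show ?thesis using \<pi>M unfolding x_def by simp
  next
    case False
    then have "j \<in> F - {i}" using that by simp
    then show ?thesis using z False unfolding x_def by simp
  qed
  have "(\<Prod>j\<in>F. x j ^ e j) \<in> lin B I" unfolding decomp
    by (rule finprod_ideal_powers(2)[OF B F(1), of M, OF idl xM])
  moreover have "(\<Prod>j\<in>F. x j ^ e j) = \<pi> ^ e i * (\<Prod>j\<in>F - {i}. z j ^ e j)"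
  proof -
    have "(\<Prod>j\<in>F - {i}. x j ^ e j) = (\<Prod>j\<in>F - {i}. z j ^ e j)" unfolding x_def by (intro prod.cong) simp_all
    then show ?thesis using prod.remove[OF F(1) i, of "\<lambda>j. x j ^ e j"] unfolding x_def by simp
  qed
  moreover have "lin B I \<subseteq> lin C I"
    by (rule lin_least[OF submodule_restrict[OF lin_submodule C(2)] lin_superset])
  ultimately have mem: "\<pi> ^ e i * (\<Prod>j\<in>F - {i}. z j ^ e j) \<in> lin C I" by (simp add: subset_iff)
  let ?z = "\<Prod>j\<in>F - {i}. z j ^ e j"
  have "?z \<in> B - M i"
  proof (rule prime_in_compl_prod[OF maximal_in_prime_in[OF M[OF i]] B])
    fix j assume j: "j \<in> F - {i}"
    have jF: "j \<in> F" and zj: "z j \<in> M j" "z j \<notin> M i" using z j by simp_all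
    have "z j \<in> B - M i" using subsetD[OF maximal_inD(2)[OF M[OF jF]] zj(1)] zj(2) by simp
    then show "z j ^ e j \<in> B - M i" by (rule prime_in_compl_power[OF maximal_in_prime_in[OF M[OF i]] B])
  qed
  then have cz: "s ^ e i * ?z \<in> C - N"
    by (intro prime_in_compl_mult[OF N(1) C(1) prime_in_compl_power[OF N(1) C(1) rel(2)] compl])
  have "(s ^ e i * ?z) * \<tau> ^ (d * e i) = u ^ e i * (\<pi> ^ e i * ?z)"
  proof -
    have "(s ^ e i * ?z) * \<tau> ^ (d * e i) = (\<tau> ^ (d * e i) * s ^ e i) * ?z" by (simp only: mult_ac)
    also have "\<dots> = u ^ e i * (\<pi> ^ e i * ?z)" unfolding pow[symmetric] by (simp only: mult.assoc)
    finally show ?thesis .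
  qed
  moreover have "u ^ e i * (\<pi> ^ e i * ?z) \<in> lin C I"
    by (rule submodule_scale[OF lin_submodule subring_power[OF C(1) DiffD1[OF rel(1)]] mem])
  ultimately have "(s ^ e i * ?z) * \<tau> ^ (d * e i) \<in> lin C I" by (rule ssubst)
  then show "\<exists>s\<in>C - N. s * \<tau> ^ (d * e i) \<in> lin C I" using cz by (rule bexI)
qed

text \<open>Multiplying a uniformizer at N by a factor from outside N brings it into every place over I. As
  \<open>C = A + aC\<close>, it differs by an element of aC from an element of A, which then lies in the radical of IA. So the
  D-th power of the radical has order D at N, as IA has.\<close>

lemma (in noetherian_dim_one) integral_closure_power_of_radical:
  assumes A: "is_subring A" "R \<subseteq> A" and C: "is_subring C" "A \<subseteq> C"
    and int: "\<And>c. c \<in> C \<Longrightarrow> integral_over A c"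
    and fl: "\<And>r. r \<in> R \<Longrightarrow> r \<noteq> 0 \<Longrightarrow> finite_length R ((*) r ` C) C"
    and I: "a \<in> I" "a \<noteq> 0" "I \<subseteq> R" and D: "D > 0"
    and fill: "\<And>c. c \<in> C \<Longrightarrow> \<exists>\<alpha>\<in>A. \<exists>y\<in>C. c = \<alpha> + a * y"
    and \<tau>: "\<And>N. maximal_in C N \<Longrightarrow> I \<subseteq> N \<Longrightarrow> uniformizer C N (\<tau> N)"
    and ge: "\<And>N x. maximal_in C N \<Longrightarrow> I \<subseteq> N \<Longrightarrow> x \<in> I \<Longrightarrow> \<exists>s\<in>C - N. \<exists>y\<in>C. s * x = \<tau> N ^ D * y"
    and le: "\<And>N. maximal_in C N \<Longrightarrow> I \<subseteq> N \<Longrightarrow> \<exists>s\<in>C - N. s * \<tau> N ^ D \<in> lin C I"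
  shows "ideal_integral_closure A (ideal_extension I A) =
    ideal_integral_closure A (ideal_power A (radical_ideal A (ideal_extension I A)) D)"
proof -
  have IA: "I \<subseteq> A" using I(3) A(2) by blast
  let ?IA = "ideal_extension I A" let ?H = "radical_ideal A (ideal_extension I A)"
  have ext: "?IA = lin A I" by (rule ideal_extension_eq_lin[OF A(1) IA])
  have IAA: "lin A I \<subseteq> A" by (rule lin_least[OF submodule_self[OF A(1)] IA])
  have IAid: "ideal ?IA (ring_on A)" unfolding ideal_ring_on_iff[OF A(1)] ext using IAA lin_submodule by simp
  have IIA: "I \<subseteq> ?IA" unfolding ext by (rule lin_superset)
  let ?V = "{x \<in> A. \<forall>N. maximal_in C N \<longrightarrow> I \<subseteq> N \<longrightarrow> (\<exists>s\<in>C - N. \<exists>y\<in>C. s * x = \<tau> N ^ D * y)}"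
  have IAN: "?IA \<subseteq> N" if N: "maximal_in C N" "I \<subseteq> N" for N
    unfolding ext by (rule lin_least[OF submodule_restrict[OF maximal_inD(1)[OF N(1)] C(2)] N(2)])
  have one: "ideal_integral_closure A ?IA = ?V"
  proof (rule integral_closure_eq_order[OF A C int fl I \<tau> IAid])
    show "\<exists>k. y ^ k \<in> ?IA" if "y \<in> I" for y using IIA that by (intro exI[of _ 1]) auto
    fix N assume N: "maximal_in C N" "I \<subseteq> N"
    have pN: "prime_in C N" by (rule maximal_in_prime_in[OF N(1)])
    show "\<exists>s\<in>C - N. \<exists>y\<in>C. s * z = \<tau> N ^ D * y" if z: "z \<in> ?IA" for z
    proof -
      have "I \<subseteq> local_multiples C N (\<tau> N ^ D) C"
        using ge[OF N] I(3) A(2) C(2) unfolding local_multiples_def by blast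
      then have "lin A I \<subseteq> local_multiples C N (\<tau> N ^ D) C"
        by (rule lin_least[OF submodule_restrict[OF local_multiples_submodule[OF C(1) pN submodule_self[OF C(1)]] C(2)]])
      then show ?thesis using z unfolding ext local_multiples_def by blast
    qed
    obtain s where "s \<in> C - N" "s * \<tau> N ^ D \<in> lin C I" using le[OF N] by blast
    then show "\<exists>s\<in>C - N. s * \<tau> N ^ D \<in> lin C ?IA" using lin_mono[OF IIA, of C] by blast
  qed
  have H_iff: "x \<in> ?H \<longleftrightarrow> x \<in> A \<and> (\<forall>N. maximal_in C N \<longrightarrow> I \<subseteq> N \<longrightarrow> x \<in> N)" for x
  proof
    assume "x \<in> ?H"
    then obtain m where x: "x \<in> A" "x ^ m \<in> ?IA" unfolding radical_ideal_def by blast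
    have "x \<in> N" if N: "maximal_in C N" "I \<subseteq> N" for N
    proof (rule ccontr)
      assume "x \<notin> N"
      then have "x ^ m \<in> C - N"
        using x(1) C(2) by (intro prime_in_compl_power[OF maximal_in_prime_in[OF N(1)] C(1)]) blast
      then show False using x(2) IAN[OF N] by blast
    qed
    then show "x \<in> A \<and> (\<forall>N. maximal_in C N \<longrightarrow> I \<subseteq> N \<longrightarrow> x \<in> N)" using x(1) by blast
  next
    assume x: "x \<in> A \<and> (\<forall>N. maximal_in C N \<longrightarrow> I \<subseteq> N \<longrightarrow> x \<in> N)"
    have "\<exists>s\<in>C - N. \<exists>y\<in>C. s * x ^ D = \<tau> N ^ D * y" if N: "maximal_in C N" "I \<subseteq> N" for N
    proof -
      have pN: "prime_in C N" by (rule maximal_in_prime_in[OF N(1)])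
      obtain s y where s: "s \<in> C - N" "y \<in> C" "s * x = \<tau> N * y"
        using uniformizer_generates[OF \<tau>[OF N] C(1) pN, of x] x N by blast
      have "s ^ D * x ^ D = \<tau> N ^ D * y ^ D" unfolding power_mult_distrib[symmetric] s(3) ..
      then show ?thesis using prime_in_compl_power[OF pN C(1) s(1)] subring_power[OF C(1) s(2)] by blast
    qed
    then have "x ^ D \<in> ideal_integral_closure A ?IA" unfolding one using x subring_power[OF A(1)] by simp
    then have "\<exists>h\<ge>1. \<exists>k. (\<forall>j\<in>{1..h}. k j \<in> ideal_power A ?IA j) \<and> (x ^ D) ^ h + (\<Sum>j=1..h. k j * (x ^ D) ^ (h - j)) = 0"
      unfolding ideal_integral_closure_def by simp
    then obtain h and k where h: "h \<ge> 1" "\<forall>j\<in>{1..h}. k j \<in> ideal_power A ?IA j"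
      "(x ^ D) ^ h + (\<Sum>j=1..h. k j * (x ^ D) ^ (h - j)) = 0" by (elim exE conjE) (rule that)
    have IAm: "submodule_over A ?IA" unfolding ext by (rule lin_submodule)
    have "(\<Sum>j=1..h. k j * (x ^ D) ^ (h - j)) \<in> ?IA"
    proof (rule submodule_sum[OF IAm])
      fix j assume j: "j \<in> {1..h}"
      then have "k j \<in> ?IA" using h(2) ideal_power_subset[OF A(1) IAid, of j] by auto
      then show "k j * (x ^ D) ^ (h - j) \<in> ?IA"
        using x by (intro submodule_scale'[OF IAm] subring_power[OF A(1)]) simp_all
    qed
    then have "- (\<Sum>j=1..h. k j * (x ^ D) ^ (h - j)) \<in> ?IA" by (rule submodule_uminus[OF IAm A(1)])
    moreover have "- (\<Sum>j=1..h. k j * (x ^ D) ^ (h - j)) = x ^ (D * h)"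
      using h(3) by (simp add: power_mult add_eq_0_iff)
    ultimately have "x ^ (D * h) \<in> ?IA" by simp
    moreover have "D * h \<ge> 1" using D h(1) by simp
    ultimately show "x \<in> ?H" unfolding radical_ideal_def using x by blast
  qed
  have Hid: "ideal ?H (ring_on A)"
    unfolding ideal_ring_on_iff[OF A(1)] submodule_over_def
  proof (intro conjI ballI subsetI)
    have sub: "submodule_over C N" if "maximal_in C N" for N by (rule maximal_inD(1)[OF that])
    show "0 \<in> ?H" unfolding H_iff using subring_zero[OF A(1)] submodule_zero[OF sub] by blast
    show "v + w \<in> ?H" if "v \<in> ?H" "w \<in> ?H" for v w
      using that unfolding H_iff using subring_add[OF A(1)] submodule_add[OF sub] by blast
    show "s * v \<in> ?H" if "s \<in> A" "v \<in> ?H" for s v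
      using that C(2) unfolding H_iff using subring_mult[OF A(1)] submodule_scale[OF sub] by blast
    show "x \<in> A" if "x \<in> ?H" for x using that unfolding H_iff by blast
  qed
  have IH: "I \<subseteq> ?H" using IA unfolding subset_eq H_iff by blast
  have "ideal_integral_closure A (ideal_power A ?H D) = ?V"
  proof (rule integral_closure_eq_order[OF A C int fl I \<tau> ideal_power_ideal[OF A(1) Hid]])
    show "\<exists>k. y ^ k \<in> ideal_power A ?H D" if "y \<in> I" for y
      using power_in_ideal_power[OF A(1) Hid, of y D] IH that by blast
    fix N assume N: "maximal_in C N" "I \<subseteq> N"
    have pN: "prime_in C N" by (rule maximal_in_prime_in[OF N(1)])
    note N' = maximal_inD[OF N(1)]
    show "\<exists>s\<in>C - N. \<exists>y\<in>C. s * z = \<tau> N ^ D * y" if z: "z \<in> ideal_power A ?H D" for z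
    proof (rule ideal_power_local[OF A(1) C pN _ z])
      fix x assume "x \<in> ?H"
      then have "x \<in> N" using N unfolding H_iff by blast
      then show "\<exists>s\<in>C - N. \<exists>y\<in>C. s * x = \<tau> N * y" by (rule uniformizer_generates[OF \<tau>[OF N] C(1) pN])
    qed
    obtain s where s: "s \<in> C - N" "s * \<tau> N ^ D \<in> lin C I" using le[OF N] by blast
    have \<tau>C: "\<tau> N \<in> C" using \<tau>[OF N] N'(2) unfolding uniformizer_def by blast
    have sC: "s * \<tau> N \<in> C" using s(1) \<tau>C by (intro subring_mult[OF C(1)]) simp_all
    \<comment> \<open>The element s times the uniformizer lies in every place over I, since its D-th power lies in IC.\<close>
    have rad: "s * \<tau> N \<in> N1" if N1: "maximal_in C N1" "I \<subseteq> N1" for N1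
    proof (rule ccontr)
      assume "s * \<tau> N \<notin> N1"
      then have "(s * \<tau> N) ^ D \<in> C - N1"
        using sC by (intro prime_in_compl_power[OF maximal_in_prime_in[OF N1(1)] C(1)]) simp
      moreover obtain D' where D': "D = Suc D'" using D by (cases D) auto
      have "(s * \<tau> N) ^ D = s ^ D' * (s * \<tau> N ^ D)"
        unfolding power_mult_distrib D' by (simp only: power_Suc mult_ac)
      then have "(s * \<tau> N) ^ D \<in> lin C I"
        using submodule_scale[OF lin_submodule subring_power[OF C(1) DiffD1[OF s(1)], of D'] s(2)] by simp
      moreover have "lin C I \<subseteq> N1" by (rule lin_least[OF maximal_inD(1)[OF N1(1)] N1(2)])
      ultimately show False by blast
    qed
    obtain \<alpha> y where \<alpha>: "\<alpha> \<in> A" "y \<in> C" "s * \<tau> N = \<alpha> + a * y" using fill[OF sC] by blast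
    have "\<alpha> \<in> ?H" unfolding H_iff
    proof (intro conjI allI impI \<alpha>(1))
      fix N1 assume N1: "maximal_in C N1" "I \<subseteq> N1"
      have "a * y \<in> N1" by (rule submodule_scale'[OF maximal_inD(1)[OF N1(1)] \<alpha>(2)]) (use I(1) N1(2) in blast)
      then have "s * \<tau> N - a * y \<in> N1" by (rule submodule_diff[OF maximal_inD(1)[OF N1(1)] C(1) rad[OF N1]])
      then show "\<alpha> \<in> N1" using \<alpha>(3) by simp
    qed
    then have "\<alpha> \<in> lin C ?H" by (rule lin_inc)
    moreover have "a * y \<in> lin C ?H"
      by (rule submodule_scale'[OF lin_submodule \<alpha>(2) lin_inc]) (use I(1) IH in blast)
    ultimately have "s * \<tau> N \<in> lin C ?H" unfolding \<alpha>(3) by (rule submodule_add[OF lin_submodule])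
    then have "(s * \<tau> N) ^ D \<in> lin C (ideal_power A ?H D)" by (rule lin_ideal_power[OF A(1) Hid])
    then have "s ^ D * \<tau> N ^ D \<in> lin C (ideal_power A ?H D)" by (simp only: power_mult_distrib)
    then show "\<exists>s\<in>C - N. s * \<tau> N ^ D \<in> lin C (ideal_power A ?H D)"
      using prime_in_compl_power[OF pN C(1) s(1)] by blast
  qed
  then show ?thesis using one by simp
qed

theorem corollary3p10:
  fixes R I :: "'k::alg_closed_field set"
    and n :: nat and M :: "nat \<Rightarrow> 'k set" and e :: "nat \<Rightarrow> nat"
  assumes "noetherian_domain (ring_on R)"
    and "altitude (ring_on R) = 1"
    and "ideal I (ring_on R)" and "I \<noteq> {0}" and "I \<noteq> R"
    and "normal_primary_decomposition (normalization R)
           (ideal_extension I (normalization R)) n M e"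
  shows "\<exists>A. finite_separable_integral_extension_domain R A \<and>
     ideal_integral_closure A (ideal_extension I A) =
       ideal_integral_closure A
         (ideal_power A (radical_ideal A (ideal_extension I A)) (\<Prod>i=1..n. e i)) \<and>
     (\<forall>P\<in>maximal_ideals_over R n M A.
        maximalideal (ideal_extension P (normalization A)) (ring_on (normalization A)) \<and>
        (ring_on (normalization A)) Quot (ideal_extension P (normalization A)) \<simeq>
          (ring_on A) Quot P)"
proof -
  interpret noetherian_dim_one R by (rule noetherian_dim_one_ring_on[OF assms(1,2)])
  let ?B = "normalization R" let ?F = "{1..n}"
  define D where "D = (\<Prod>i=1..n. e i)"
  define d where "d i = (\<Prod>j\<in>?F - {i}. e j)" for i
  have B: "is_subring ?B" "R \<subseteq> ?B"
    by (rule normalization_subring[OF subring], rule normalization_superset[OF subring])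
  have flB: "finite_length R ((*) r ` ?B) ?B" if "r \<in> R" "r \<noteq> 0" for r
    by (rule finite_length_normalization[OF finite_extension_refl[OF subring] that])
  have I': "submodule_over R I" "I \<subseteq> R" using assms(3) unfolding ideal_ring_on_iff[OF subring] by simp_all
  have I1: "1 \<notin> I" using submodule_with_one[OF I'(1)] I'(2) assms(5) by blast
  obtain a where a: "a \<in> I" "a \<noteq> 0" using assms(4) submodule_zero[OF I'(1)] by blast
  have aR: "a \<in> R" using a(1) I'(2) by blast
  have IB: "I \<subseteq> ?B" using I'(2) B(2) by blast
  note npd = assms(6)[unfolded normal_primary_decomposition_def ideal_extension_eq_lin[OF B(1) IB]]
  have inj: "inj_on M ?F" using npd by blast
  have Mset: "M ` ?F = {N. maximalideal N (ring_on ?B) \<and> lin ?B I \<subseteq> N}" using npd by blast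
  have epos: "e i > 0" if "i \<in> ?F" for i using npd that by blast
  have decomp: "lin ?B I = (\<Otimes>\<^bsub>ideals_set (ring_on ?B)\<^esub> j \<in> ?F. ideal_power ?B (M j) (e j))" using npd by blast
  have MB: "maximal_in ?B (M i)" "I \<subseteq> M i" if i: "i \<in> ?F" for i
  proof -
    have "M i \<in> {N. maximalideal N (ring_on ?B) \<and> lin ?B I \<subseteq> N}" using Mset i by blast
    then show "maximal_in ?B (M i)" "I \<subseteq> M i"
      unfolding maximalideal_ring_on_iff[OF B(1)] using lin_superset[of I ?B] by auto
  qed
  have Mall: "\<exists>i\<in>?F. N = M i" if N: "maximal_in ?B N" "I \<subseteq> N" for N
  proof -
    have "lin ?B I \<subseteq> N" by (rule lin_least[OF maximal_inD(1)[OF N(1)] N(2)])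
    then have "N \<in> M ` ?F" unfolding Mset maximalideal_ring_on_iff[OF B(1)] using N(1) by simp
    then show ?thesis by blast
  qed
  have Bint: "integral_over R x" if "x \<in> ?B" for x by (rule normalization_integral[OF that])
  have Bclosed: "x \<in> ?B" if x: "x \<in> quotient_field ?B" "integral_over ?B x" for x
  proof (rule normalization_closed[OF subring _ x(2)])
    have "quotient_field ?B \<subseteq> quotient_field R"
      by (rule quotient_field_least[OF quotient_field_subfield[OF subring] normalization_quotient])
    then show "x \<in> quotient_field R" using x(1) by blast
  qed
  have "\<forall>i\<in>?F. \<exists>\<pi>. uniformizer ?B (M i) \<pi>"
  proof
    fix i assume i: "i \<in> ?F"
    have "a \<in> M i" using MB(2)[OF i] a(1) by blast
    from uniformizer_exists[OF B Bint Bclosed flB MB(1)[OF i] this aR a(2)]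
    show "\<exists>\<pi>. uniformizer ?B (M i) \<pi>" by blast
  qed
  then obtain \<pi> where \<pi>: "\<forall>i\<in>?F. uniformizer ?B (M i) (\<pi> i)" by (rule bchoice[THEN exE])
  have Dpos: "D > 0" unfolding D_def using epos by (simp add: prod_pos)
  have ed: "0 < e i \<and> 0 < d i \<and> e i * d i = D" if i: "i \<in> ?F" for i
    unfolding d_def D_def using epos i prod.remove[of ?F i e] by (simp add: prod_pos)
  have apow: "a ^ m \<noteq> 1" if m: "m > 0" for m
  proof
    assume "a ^ m = 1"
    obtain l where "m = Suc l" using m by (rule gr0_conv_Suc[THEN iffD1, THEN exE])
    then have "a ^ l * a = 1" using \<open>a ^ m = 1\<close> by (simp add: mult.commute)
    moreover have "a ^ l * a \<in> I" by (rule submodule_scale[OF I'(1) subring_power[OF subring aR] a(1)])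
    ultimately show False using I1 by simp
  qed
  have "\<exists>f. coeffs_in ?B f \<and> degree f = D \<and> lead_coeff f = 1 \<and> rsquarefree f \<and>
    (\<forall>i\<in>?F. coeffs_in (local_multiples ?B (M i) (\<pi> i) (M i)) (f - (separable_poly (M i) (e i) ^ d i + [:\<pi> i:])))"
  proof (rule ramified_polynomial_exists[OF B(1) _ inj _ ed Dpos _ _ a(2) apow])
    show "maximal_in ?B (M i) \<and> uniformizer ?B (M i) (\<pi> i)" if "i \<in> ?F" for i using MB(1)[OF that] \<pi> that by blast
    show "a \<in> M i" if "i \<in> ?F" for i using MB(2)[OF that] a(1) by blast
    show "a \<in> ?B" using aR B(2) by blast
  qed simp_all
  then obtain f where f: "coeffs_in ?B f" "degree f = D" "lead_coeff f = 1" "rsquarefree f"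
    and near: "\<And>i. i \<in> ?F \<Longrightarrow>
      coeffs_in (local_multiples ?B (M i) (\<pi> i) (M i)) (f - (separable_poly (M i) (e i) ^ d i + [:\<pi> i:]))" by blast
  obtain t where t: "poly f t = 0" using alg_closed_imp_poly_has_root[of f] f(2) Dpos by auto
  have tB: "integral_over ?B t" unfolding integral_over_iff using f(1,3) t by blast
  have tR: "integral_over R t" by (rule integral_over_trans[OF subring Bint tB])
  let ?A0 = "adjoin R t" let ?S = "adjoin ?B t"
  have A0: "finite_extension R ?A0" by (rule finite_extension_adjoin[OF subring finite_extension_refl[OF subring] tR])
  note A0' = finite_extensionD[OF A0]
  obtain A where A: "finite_extension R A" "?A0 \<subseteq> A" "A \<subseteq> normalization ?A0" "normalization A = normalization ?A0"
    and fill: "\<And>c. c \<in> normalization ?A0 \<Longrightarrow> \<exists>\<alpha>\<in>A. \<exists>y\<in>normalization ?A0. c = \<alpha> + a * y"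
    using finite_extension_filling_normalization[OF A0 aR a(2)] by metis
  note A' = finite_extensionD[OF A(1)]
  let ?C = "normalization A"
  have C: "is_subring ?C" "A \<subseteq> ?C"
    by (rule normalization_subring[OF A'(1)], rule normalization_superset[OF A'(1)])
  have Cint: "integral_over A c" if "c \<in> ?C" for c by (rule normalization_integral[OF that])
  have flC: "finite_length R ((*) r ` ?C) ?C" if "r \<in> R" "r \<noteq> 0" for r
    by (rule finite_length_normalization[OF A(1) that])
  have fillC: "\<exists>\<alpha>\<in>A. \<exists>y\<in>?C. c = \<alpha> + a * y" if "c \<in> ?C" for c using fill that unfolding A(4) .
  have RC: "R \<subseteq> ?C" using A'(2) C(2) by blast
  have BC: "?B \<subseteq> ?C" by (rule normalization_mono_ring[OF A'(2)])
  have tC: "t \<in> ?C" using adjoin_self[OF subring, of t] A(2) C(2) by blast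
  have S: "is_subring ?S" "?B \<subseteq> ?S" "?S \<subseteq> ?C"
    by (rule adjoin_subring[OF B(1)], rule adjoin_superset[OF B(1)], rule adjoin_least[OF C(1) BC tC])
  have A0S: "?A0 \<subseteq> ?S"
    by (rule adjoin_least[OF S(1) order_trans[OF B(2) S(2)] adjoin_self[OF B(1)]])
  have CS: "?C \<subseteq> quotient_field ?S"
    unfolding A(4) using normalization_quotient[of ?A0] quotient_field_mono[OF A0S] by (rule order_trans)
  have Smult: "\<exists>y\<in>?S. x * y \<in> ?B \<and> x * y \<noteq> 0" if x: "x \<in> ?S" "x \<noteq> 0" for x
  proof -
    have "integral_over ?B x"
      by (rule finite_extension_integral[OF B(1) finite_extension_adjoin[OF B(1) finite_extension_refl[OF B(1)] tB] x(1)])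
    then show ?thesis using integral_over_multiple[OF B(1) S(1,2) x(1) _ x(2)] by blast
  qed
  \<comment> \<open>Every place over I lies over some \<open>M i\<close>; there \<open>h i (t)\<close> is a uniformizer and I has order \<open>d i * e i\<close>.\<close>
  have place: "\<exists>\<tau>. uniformizer ?C N \<tau> \<and> (\<forall>x\<in>I. \<exists>s\<in>?C - N. \<exists>y\<in>?C. s * x = \<tau> ^ D * y) \<and>
      (\<exists>s\<in>?C - N. s * \<tau> ^ D \<in> lin ?C I)" if N: "maximal_in ?C N" "I \<subseteq> N" for N
  proof -
    have pN: "prime_in ?C N" by (rule maximal_in_prime_in[OF N(1)])
    have pNB: "prime_in ?B (N \<inter> ?B)" by (rule prime_in_contract[OF pN B(1) BC])
    have aN: "a \<in> N \<inter> ?B" using a(1) N(2) IB by blast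
    have "maximal_in ?B (N \<inter> ?B)" by (rule prime_over_maximal[OF B Bint pNB aN aR a(2)])
    moreover have "I \<subseteq> N \<inter> ?B" using N(2) IB by blast
    ultimately obtain i where i: "i \<in> ?F" "N \<inter> ?B = M i" using Mall by blast
    have pNS: "prime_in ?S (N \<inter> ?S)" by (rule prime_in_contract[OF pN S(1,3)])
    have NSB: "(N \<inter> ?S) \<inter> ?B = M i" using i(2) S(2) by blast
    let ?\<tau> = "poly (separable_poly (M i) (e i)) t"
    have ui: "uniformizer ?B (M i) (\<pi> i)" using \<pi> i(1) by blast
    have ei: "e i > 0" "d i > 0" using ed[OF i(1)] by simp_all
    have uS: "uniformizer ?S (N \<inter> ?S) ?\<tau>"
      and rel: "\<exists>u\<in>?S - (N \<inter> ?S). \<exists>s\<in>?S - (N \<inter> ?S). u * \<pi> i = ?\<tau> ^ d i * s"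
      using uniformizer_adjoin[OF B(1) MB(1)[OF i(1)] ui ei near[OF i(1)] t Smult pNS NSB] by simp_all
    obtain u s where us: "u \<in> ?C - N" "s \<in> ?C - N" "u * \<pi> i = ?\<tau> ^ d i * s" using rel S(3) by blast
    have "uniformizer ?C N ?\<tau>" by (rule uniformizer_overring[OF uS S(1) C(1) S(3) CS pN refl])
    moreover have Dei: "d i * e i = D" using ed[OF i(1)] by (simp add: mult.commute)
    ultimately show ?thesis
      using order_of_decomposed_ideal[OF B(1) C(1) BC _ inj MB(1) i(1) decomp pN i(2) ui us, unfolded Dei]
      by blast
  qed
  define \<tau> where "\<tau> N = (SOME \<tau>. uniformizer ?C N \<tau> \<and> (\<forall>x\<in>I. \<exists>s\<in>?C - N. \<exists>y\<in>?C. s * x = \<tau> ^ D * y) \<and>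
      (\<exists>s\<in>?C - N. s * \<tau> ^ D \<in> lin ?C I))" for N
  have \<tau>: "uniformizer ?C N (\<tau> N)" "\<And>x. x \<in> I \<Longrightarrow> \<exists>s\<in>?C - N. \<exists>y\<in>?C. s * x = \<tau> N ^ D * y"
    "\<exists>s\<in>?C - N. s * \<tau> N ^ D \<in> lin ?C I" if N: "maximal_in ?C N" "I \<subseteq> N" for N
    using someI_ex[OF place[OF N]] unfolding \<tau>_def[symmetric] by blast+
  have closure: "ideal_integral_closure A (ideal_extension I A) =
      ideal_integral_closure A (ideal_power A (radical_ideal A (ideal_extension I A)) D)"
    by (rule integral_closure_power_of_radical[OF A' C Cint flC a I'(2) Dpos fillC \<tau>])
  have separable: "finite_separable_integral_extension_domain R A"
  proof (rule finite_extension_separable[OF subring A(1,2) _ _ f(4) t])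
    show "A \<subseteq> quotient_field ?A0" using A(3) normalization_quotient by blast
    show "coeffs_in (quotient_field R) f" by (rule coeffs_in_mono[OF f(1) normalization_quotient])
  qed
  have residue: "maximalideal (ideal_extension P ?C) (ring_on ?C) \<and>
      (ring_on ?C) Quot (ideal_extension P ?C) \<simeq> (ring_on A) Quot P" if P: "P \<in> maximal_ideals_over R n M A" for P
  proof -
    have mP: "maximalideal P (ring_on A)" and "P \<inter> R \<in> (\<lambda>i. M i \<inter> R) ` ?F"
      using P unfolding maximal_ideals_over_def by simp_all
    then obtain i where i: "i \<in> ?F" "P \<inter> R = M i \<inter> R" by blast
    have "a \<in> P" using MB(2)[OF i(1)] a(1) aR i(2) by blast
    then show ?thesis
      using extended_maximal_ideal[OF A'(1) C Cint mP _ fillC] by blast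
  qed
  show ?thesis using separable closure residue unfolding D_def by blast
qed

end
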